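(* Consider system (A) of the context, under its standing hypotheses, and suppose that $H:\mathbb{R}^+\times C\to\mathcal Y$ is equivalent to the finite-dimensional mapping $h:[-r,+\infty)\times\mathbb{R}^n\to\mathbb{R}^p$. Moreover, suppose that there exist a locally Lipschitz function $V:[-r,+\infty)\times\mathbb{R}^n\to\mathbb{R}^+$, functions $a_1,a_2,a$ of class $K_\infty$ with $a(s)<s$ for all $s>0$, $\beta$ of class $K^+$ and a continuous positive definite function $\rho:\mathbb{R}^+\to\mathbb{R}^+$ such that $$a_1(|h(t-r,x)|)\le V(t-r,x)\le a_2(\beta(t)|x|),\quad\forall(t,x)\in\mathbb{R}^+\times\mathbb{R}^n,$$ $$D^+V(t,x(0);f(t,x,d))\le-\rho(V(t,x(0)))$$ for all $(t,x,d)\in\mathbb{R}^+\times C\times D$ with $a\Big(\sup_{\theta\in[-r,0]}V(t+\theta,x(\theta))\Big)\le V(t,x(0))$. Finally, suppose that one of the following holds: (i) system (A) is RFC; (ii) there exist functions $\zeta\in K_\infty$, $\mu\in K^+$ and a constant $R\ge0$ such that $\zeta(\mu(t)|x|)\le V(t-r,x)+R$ for all $(t,x)\in\mathbb{R}^+\times\mathbb{R}^n$. Then system (A) is non-uniformly in time RGAOS with disturbances $d\in M_D$. Moreover, if $\beta$ is bounded then system (A) is URGAOS with disturbances $d\in M_D$.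
   Context: **Notation.** $\mathbb{R}^+=[0,+\infty)$; $|\cdot|$ is the Euclidean norm. $r>0$ is a constant, $C:=C^0([-r,0];\mathbb{R}^n)$, $\|x\|_r:=\max_{\theta\in[-r,0]}|x(\theta)|$. For a function $x$ defined on an interval containing $[t-r,t]$, $T_r(t)x$ denotes the function $\theta\mapsto x(t+\theta)$, $\theta\in[-r,0]$. $K^+$: positive continuous functions on $\mathbb{R}^+$. $\rho:\mathbb{R}^+\to\mathbb{R}^+$ is positive definite if $\rho(0)=0$ and $\rho(s)>0$ for $s>0$. $K$: positive definite, (strictly) increasing, continuous functions $\mathbb{R}^+\to\mathbb{R}^+$; $K_\infty$: those in $K$ tending to $+\infty$ at $+\infty$. $KL$: continuous $\sigma:\mathbb{R}^+\times\mathbb{R}^+\to\mathbb{R}^+$ with $\sigma(\cdot,t)\in K$ for each $t$ and $\sigma(s,\cdot)$ non-increasing with limit $0$ at $+\infty$ for each $s$. For nonempty $D\subseteq\mathbb{R}^l$, $M_D$ is the class of Lebesgue measurable, locally essentially bounded $d:\mathbb{R}^+\to D$. **System (A).** Let $D\subseteq\mathbb{R}^l$ be nonempty, $\mathcal Y$ a normed linear space with norm $\|\cdot\|_{\mathcal Y}$, and $f:\mathbb{R}^+\times C\times D\to\mathbb{R}^n$, $H:\mathbb{R}^+\times C\to\mathcal Y$ with $f(t,0,d)=0$, $H(t,0)=0$ for all $(t,d)\in\mathbb{R}^+\times D$. System (A) is $$\dot x(t)=f(t,T_r(t)x,d(t)),\quad Y(t)=H(t,T_r(t)x),\quad t\ge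 t_0,\qquad T_r(t_0)x=x_0\in C .$$ **Standing hypotheses.** 1. $(x,d)\mapsto f(t,x,d)$ is continuous for each fixed $t\ge0$, and for all bounded $I\subseteq\mathbb{R}^+$, $S\subset C$ there is $L\ge0$ with $(x(0)-y(0))'(f(t,x,d)-f(t,y,d))\le L\|x-y\|_r^2$ for all $t\in I$, $x,y\in S$, $d\in D$. 2. For every bounded $\Omega\subset\mathbb{R}^+\times C$ the set $f(\Omega\times D)$ is bounded. 3. There is a set $A\subset\mathbb{R}^+$, either finite or $A=\{t_k:k=1,2,\dots\}$ with $t_{k+1}>t_k>0$, $t_k\to+\infty$, such that $f$ is continuous on $(\mathbb{R}^+\setminus A)\times C\times D$; and $\lim_{t\to t_0^+}f(t,x,d)=f(t_0,x,d)$ for each fixed $(t_0,x,d)$. 4. For every $\varepsilon>0$, $t\ge0$ there is $\delta>0$ with $\sup\{|f(\tau,x,d)|:\tau\in\mathbb{R}^+,d\in D,|\tau-t|+\|x\|_r<\delta\}<\varepsilon$. 5. For all bounded $I\subseteq\mathbb{R}^+$, $S\subset C$ there is $L_H\ge0$ with $\|H(t,x)-H(\tau,y)\|_{\mathcal Y}\le L_H(|t-\tau|+\|x-y\|_r)$ for all $t,\tau\in I$, $x,y\in S$. Under these, for every $(t_0,x_0,d)\in\mathbb{R}^+\times C\times M_D$ there is a unique maximal solution $x:[t_0-r,t_{\max})\to\mathbb{R}^n$ (continuous, locally absolutely continuous on $[t_0,t_{\max})$, satisfying the equation a.e.); write $\phi(t,t_0,x_0;d):=T_r(t)x$. **RFC.**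 (A) is robustly forward complete (RFC) if for all $s,T\ge0$: $\sup\{\|\phi(t_0+\xi,t_0,x_0;d)\|_r:\xi\in[0,T],\|x_0\|_r\le s,t_0\in[0,T],d\in M_D\}<+\infty$. **RGAOS and URGAOS.** (A) is non-uniformly in time Robustly Globally Asymptotically Output Stable (RGAOS) with disturbances $d\in M_D$ if it is RFC and: P1: for all $\varepsilon>0$, $T\ge0$: $\sup\{\|H(t,\phi(t,t_0,x_0;d))\|_{\mathcal Y}:t\ge t_0,\|x_0\|_r\le\varepsilon,t_0\in[0,T],d\in M_D\}<+\infty$; P2: for all $\varepsilon>0$, $T\ge0$ there is $\delta>0$ such that $\|x_0\|_r\le\delta$, $t_0\in[0,T]$ imply $\|H(t,\phi(t,t_0,x_0;d))\|_{\mathcal Y}\le\varepsilon$ for all $t\ge t_0$, $d\in M_D$; P3: for all $\varepsilon>0$, $T,R\ge0$ there is $\tau\ge0$ such that $\|x_0\|_r\le R$, $t_0\in[0,T]$ imply $\|H(t,\phi(t,t_0,x_0;d))\|_{\mathcal Y}\le\varepsilon$ for all $t\ge t_0+\tau$, $d\in M_D$. It is Uniformly RGAOS (URGAOS) with disturbances $d\in M_D$ if moreover there is $\sigma\in KL$ such that $\|H(t,\phi(t,t_0,x_0;d))\|_{\mathcal Y}\le\sigma(\|x_0\|_r,t-t_0)$ for all $(t_0,x_0)\in\mathbb{R}^+\times C$, $d\in M_D$, $t\ge t_0$. **Derivative.** For locally Lipschitz $V:[-r,+\infty)\times\mathbb{R}^n\to\mathbb{R}$ and $(t,x,v)\in\mathbb{R}^+\times\mathbb{R}^n\times\mathbb{R}^n$,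 $D^+V(t,x;v):=\limsup_{h\to0^+}h^{-1}\big(V(t+h,x+hv)-V(t,x)\big)$. **Equivalence to a finite-dimensional mapping.** $H$ is equivalent to the finite-dimensional mapping $h$ if $h:[-r,+\infty)\times\mathbb{R}^n\to\mathbb{R}^p$ is continuous with $h(t,0)=0$ for all $t\ge-r$, and there are $b_1,b_2\in K_\infty$ with $b_1(|h(t,x(0))|)\le\|H(t,x)\|_{\mathcal Y}\le b_2(\sup_{\theta\in[-r,0]}|h(t+\theta,x(\theta))|)$ for all $(t,x)\in\mathbb{R}^+\times C$. *)

theory Defs
  imports "HOL-Analysis.Analysis"
begin

section \<open>The history space\<close>

text \<open>
  The space of continuous functions from the interval \<open>[-r, 0]\<close> to \<open>'b\<close> is identified with the
  closed subspace of those bounded continuous functions on the real line that are constant on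
  \<open>(-\<infinity>, -r]\<close> and on \<open>[0, \<infinity>)\<close>: every function on the interval has exactly one such extension
  (lemma \<open>hist_space_ex1\<close>), and the supremum norm of the extension is the maximum of \<open>norm (x \<theta>)\<close>
  over \<open>\<theta> \<in> [-r, 0]\<close> (lemma \<open>norm_hist_space\<close>). Thus \<open>norm\<close>, \<open>0\<close>, boundedness and continuity on
  the history space are those of the type of bounded continuous functions.
\<close>

definition hist_space :: "real \<Rightarrow> (real \<Rightarrow>\<^sub>C 'b::metric_space) set" where
  "hist_space r = {x. (\<forall>\<theta>\<le>-r. apply_bcontfun x \<theta> = apply_bcontfun x (-r)) \<and>
       (\<forall>\<theta>\<ge>0. apply_bcontfun x \<theta> = apply_bcontfun x 0)}"

text \<open>
  The segment \<open>\<theta> \<mapsto> x (t + \<theta>)\<close> as an element of \<open>hist_space r\<close>. It depends only on \<open>x\<close> restricted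
  to \<open>[t - r, t]\<close>, and is meaningful if \<open>x\<close> is continuous there.
\<close>

definition hist :: "real \<Rightarrow> real \<Rightarrow> (real \<Rightarrow> 'b::metric_space) \<Rightarrow> (real \<Rightarrow>\<^sub>C 'b)" where
  "hist r t x = Bcontfun (\<lambda>\<theta>. x (t + max (-r) (min 0 \<theta>)))"

lemma apply_hist_ext:
  assumes "r \<ge> 0" "continuous_on {t - r..t} x"
  shows "apply_bcontfun (hist r t x) = (\<lambda>\<theta>. x (t + max (-r) (min 0 \<theta>)))"
proof -
  let ?g = "\<lambda>\<theta>::real. t + max (-r) (min 0 \<theta>)"
  have r: "range ?g \<subseteq> {t - r..t}"
    using assms(1) by auto
  have "continuous_on UNIV (\<lambda>\<theta>. x (?g \<theta>))"
    by (rule continuous_on_compose2[OF assms(2) _ r]) (intro continuous_intros)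
  moreover have "bounded (range (\<lambda>\<theta>. x (?g \<theta>)))"
    by (rule bounded_subset[OF compact_imp_bounded[OF compact_continuous_image[OF assms(2) compact_Icc]]])
      (use r in auto)
  ultimately show ?thesis
    unfolding hist_def by (intro Bcontfun_inverse) (simp add: bcontfun_def)
qed

lemma hist_in_hist_space:
  assumes "r \<ge> 0" "continuous_on {t - r..t} x"
  shows "hist r t x \<in> hist_space r"
  using assms(1) by (auto simp: hist_space_def apply_hist_ext[OF assms])

lemma apply_hist:
  assumes "r \<ge> 0" "continuous_on {t - r..t} x" "\<theta> \<in> {-r..0}"
  shows "hist r t x \<theta> = x (t + \<theta>)"
  using assms(3) by (simp add: apply_hist_ext[OF assms(1,2)])

lemma hist_space_eqI:
  fixes x y :: "real \<Rightarrow>\<^sub>C 'b::metric_space"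
  assumes "x \<in> hist_space r" "y \<in> hist_space r" "r \<ge> 0" "\<And>\<theta>. \<theta> \<in> {-r..0} \<Longrightarrow> x \<theta> = y \<theta>"
  shows "x = y"
proof (rule bcontfun_eqI)
  fix \<theta>
  consider "\<theta> \<le> -r" | "\<theta> \<in> {-r..0}" | "\<theta> \<ge> 0" by force
  then show "x \<theta> = y \<theta>"
  proof cases
    case 1
    then have "x \<theta> = x (-r)" "y \<theta> = y (-r)" using assms(1,2) unfolding hist_space_def by blast+
    with assms(3,4) show ?thesis by simp
  next
    case 3
    then have "x \<theta> = x 0" "y \<theta> = y 0" using assms(1,2) unfolding hist_space_def by blast+
    with assms(3,4) show ?thesis by simp
  qed (use assms(4) in auto)
qed

lemma hist_space_ex1:
  assumes "r \<ge> 0" "continuous_on {-r..0} g"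
  shows "\<exists>!x. x \<in> hist_space r \<and> (\<forall>\<theta>\<in>{-r..0}. apply_bcontfun x \<theta> = g \<theta>)"
proof (rule ex1I[of _ "hist r 0 g"])
  show 1: "hist r 0 g \<in> hist_space r \<and> (\<forall>\<theta>\<in>{-r..0}. hist r 0 g \<theta> = g \<theta>)"
    using assms hist_in_hist_space[of r 0 g] apply_hist[of r 0 g] by simp
  fix x assume "x \<in> hist_space r \<and> (\<forall>\<theta>\<in>{-r..0}. apply_bcontfun x \<theta> = g \<theta>)"
  then show "x = hist r 0 g"
    using 1 assms(1) by (intro hist_space_eqI[of x r]) auto
qed

lemma norm_hist_space:
  fixes x :: "real \<Rightarrow>\<^sub>C 'b::real_normed_vector"
  assumes "x \<in> hist_space r" "r \<ge> 0"
  shows "norm x = (SUP \<theta>\<in>{-r..0}. norm (x \<theta>))"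
proof -
  have "range (\<lambda>\<theta>. norm (x \<theta>)) = (\<lambda>\<theta>. norm (x \<theta>)) ` {-r..0}"
  proof (intro equalityI subsetI)
    fix z assume "z \<in> range (\<lambda>\<theta>. norm (x \<theta>))"
    then obtain \<theta> where z: "z = norm (x \<theta>)" by auto
    consider "\<theta> \<le> -r" | "\<theta> \<in> {-r..0}" | "\<theta> \<ge> 0" by force
    then show "z \<in> (\<lambda>\<theta>. norm (x \<theta>)) ` {-r..0}"
    proof cases
      case 1
      then have "x \<theta> = x (-r)" using assms(1) unfolding hist_space_def by blast
      with z assms(2) show ?thesis by auto
    next
      case 3
      then have "x \<theta> = x 0" using assms(1) unfolding hist_space_def by blast
      with z assms(2) show ?thesis by auto
    qed (use z in auto)
  qed auto
  moreover have "norm x = (SUP \<theta>. norm (x \<theta>))"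
    unfolding norm_bcontfun_def dist_bcontfun_def by (simp add: zero_bcontfun.rep_eq)
  ultimately show ?thesis by simp
qed

section \<open>Comparison functions and regularity notions\<close>

text \<open>Functions on the half-line are total functions that are only considered on \<open>{0..}\<close>.\<close>

definition class_Kplus :: "(real \<Rightarrow> real) \<Rightarrow> bool" where
  "class_Kplus \<beta> \<longleftrightarrow> continuous_on {0..} \<beta> \<and> (\<forall>t\<ge>0. \<beta> t > 0)"

definition pos_definite :: "(real \<Rightarrow> real) \<Rightarrow> bool" where
  "pos_definite \<rho> \<longleftrightarrow> \<rho> 0 = 0 \<and> (\<forall>s>0. \<rho> s > 0)"

definition class_K :: "(real \<Rightarrow> real) \<Rightarrow> bool" where
  "class_K a \<longleftrightarrow> pos_definite a \<and> strict_mono_on {0..} a \<and> continuous_on {0..} a"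

definition class_Kinf :: "(real \<Rightarrow> real) \<Rightarrow> bool" where
  "class_Kinf a \<longleftrightarrow> class_K a \<and> filterlim a at_top at_top"

definition class_KL :: "(real \<Rightarrow> real \<Rightarrow> real) \<Rightarrow> bool" where
  "class_KL \<sigma> \<longleftrightarrow>
     continuous_on ({0..} \<times> {0..}) (\<lambda>(s, t). \<sigma> s t) \<and>
     (\<forall>t\<ge>0. class_K (\<lambda>s. \<sigma> s t)) \<and>
     (\<forall>s\<ge>0. antimono_on {0..} (\<sigma> s) \<and> (\<sigma> s \<longlongrightarrow> 0) at_top)"

definition locally_lipschitz_on :: "'a::metric_space set \<Rightarrow> ('a \<Rightarrow> 'b::metric_space) \<Rightarrow> bool" where
  "locally_lipschitz_on S F \<longleftrightarrow> (\<forall>z\<in>S. \<exists>u>0. \<exists>L. L-lipschitz_on (cball z u \<inter> S) F)"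

definition abs_continuous_on :: "real \<Rightarrow> real \<Rightarrow> (real \<Rightarrow> 'b::real_normed_vector) \<Rightarrow> bool" where
  "abs_continuous_on a b x \<longleftrightarrow>
     (\<forall>\<epsilon>>0. \<exists>\<delta>>0. \<forall>I::(real \<times> real) set.
        finite I \<and> (\<forall>(u, v)\<in>I. a \<le> u \<and> u \<le> v \<and> v \<le> b) \<and>
        disjoint_family_on (\<lambda>(u, v). {u<..<v}) I \<and> (\<Sum>(u, v)\<in>I. v - u) < \<delta>
        \<longrightarrow> (\<Sum>(u, v)\<in>I. norm (x v - x u)) < \<epsilon>)"

definition Dplus :: "(real \<Rightarrow> 'a::real_vector \<Rightarrow> real) \<Rightarrow> real \<Rightarrow> 'a \<Rightarrow> 'a \<Rightarrow> ereal" where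
  "Dplus V t x v = Limsup (at_right 0) (\<lambda>h. ereal ((V (t + h) (x + h *\<^sub>R v) - V t x) / h))"

section \<open>The system\<close>

type_synonym ('n, 'l) rhs = "real \<Rightarrow> (real \<Rightarrow>\<^sub>C (real ^ 'n)) \<Rightarrow> real ^ 'l \<Rightarrow> real ^ 'n"

type_synonym ('n, 'y) output_map = "real \<Rightarrow> (real \<Rightarrow>\<^sub>C (real ^ 'n)) \<Rightarrow> 'y"

definition disturbances :: "(real ^ 'l) set \<Rightarrow> (real \<Rightarrow> real ^ 'l) set" where
  "disturbances D = {d.
     d \<in> borel_measurable (lebesgue_on {0..}) \<and> (\<forall>t\<ge>0. d t \<in> D) \<and>
     (\<forall>T\<ge>0. \<exists>B. AE t in lebesgue_on {0..T}. norm (d t) \<le> B)}"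

definition system_A ::
  "real \<Rightarrow> ('n::finite, 'l::finite) rhs \<Rightarrow> ('n, 'y::real_normed_vector) output_map \<Rightarrow>
   (real ^ 'l) set \<Rightarrow> bool" where
  "system_A r f H D \<longleftrightarrow> r > 0 \<and> D \<noteq> {} \<and> (\<forall>t\<ge>0. \<forall>d\<in>D. f t 0 d = 0) \<and> (\<forall>t\<ge>0. H t 0 = 0)"

definition hyp1 :: "real \<Rightarrow> ('n::finite, 'l::finite) rhs \<Rightarrow> (real ^ 'l) set \<Rightarrow> bool" where
  "hyp1 r f D \<longleftrightarrow>
     (\<forall>t\<ge>0. continuous_on (hist_space r \<times> D) (\<lambda>(x, d). f t x d)) \<and>
     (\<forall>I S. I \<subseteq> {0..} \<and> bounded I \<and> S \<subseteq> hist_space r \<and> bounded S \<longrightarrow>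
        (\<exists>L\<ge>0. \<forall>t\<in>I. \<forall>x\<in>S. \<forall>y\<in>S. \<forall>d\<in>D.
           (apply_bcontfun x 0 - apply_bcontfun y 0) \<bullet> (f t x d - f t y d) \<le> L * (norm (x - y))\<^sup>2))"

definition hyp2 :: "real \<Rightarrow> ('n::finite, 'l::finite) rhs \<Rightarrow> (real ^ 'l) set \<Rightarrow> bool" where
  "hyp2 r f D \<longleftrightarrow>
     (\<forall>\<Omega>. \<Omega> \<subseteq> {0..} \<times> hist_space r \<and> bounded \<Omega> \<longrightarrow>
        bounded ((\<lambda>((t, x), d). f t x d) ` (\<Omega> \<times> D)))"

definition hyp3 :: "real \<Rightarrow> ('n::finite, 'l::finite) rhs \<Rightarrow> (real ^ 'l) set \<Rightarrow> bool" where
  "hyp3 r f D \<longleftrightarrow>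
     (\<exists>A\<subseteq>{0..}.
        (finite A \<or>
         (\<exists>\<tau>::nat \<Rightarrow> real. A = range \<tau> \<and> (\<forall>k. 0 < \<tau> k \<and> \<tau> k < \<tau> (Suc k)) \<and>
            filterlim \<tau> at_top sequentially)) \<and>
        continuous_on (({0..} - A) \<times> hist_space r \<times> D) (\<lambda>(t, x, d). f t x d)) \<and>
     (\<forall>t0\<ge>0. \<forall>x\<in>hist_space r. \<forall>d\<in>D. ((\<lambda>t. f t x d) \<longlongrightarrow> f t0 x d) (at_right t0))"

definition hyp4 :: "real \<Rightarrow> ('n::finite, 'l::finite) rhs \<Rightarrow> (real ^ 'l) set \<Rightarrow> bool" where
  "hyp4 r f D \<longleftrightarrow>
     (\<forall>\<epsilon>>0. \<forall>t\<ge>0. \<exists>\<delta>>0.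
        (SUP (\<tau>, x, d) \<in> {(\<tau>, x, d). \<tau> \<ge> 0 \<and> x \<in> hist_space r \<and> d \<in> D \<and> \<bar>\<tau> - t\<bar> + norm x < \<delta>}.
           ereal (norm (f \<tau> x d))) < ereal \<epsilon>)"

definition hyp5 :: "real \<Rightarrow> ('n::finite, 'y::real_normed_vector) output_map \<Rightarrow> bool" where
  "hyp5 r H \<longleftrightarrow>
     (\<forall>I S. I \<subseteq> {0..} \<and> bounded I \<and> S \<subseteq> hist_space r \<and> bounded S \<longrightarrow>
        (\<exists>L\<ge>0. \<forall>t\<in>I. \<forall>\<tau>\<in>I. \<forall>x\<in>S. \<forall>y\<in>S.
           norm (H t x - H \<tau> y) \<le> L * (\<bar>t - \<tau>\<bar> + norm (x - y))))"

definition standing_hyps ::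
  "real \<Rightarrow> ('n::finite, 'l::finite) rhs \<Rightarrow> ('n, 'y::real_normed_vector) output_map \<Rightarrow>
   (real ^ 'l) set \<Rightarrow> bool" where
  "standing_hyps r f H D \<longleftrightarrow> hyp1 r f D \<and> hyp2 r f D \<and> hyp3 r f D \<and> hyp4 r f D \<and> hyp5 r H"

section \<open>Solutions\<close>

text \<open>A solution is a total function \<open>x\<close> considered on \<open>[t0 - r, tm)\<close>, where \<open>tm\<close> may be \<open>\<infinity>\<close>.\<close>

definition is_solution ::
  "real \<Rightarrow> ('n::finite, 'l::finite) rhs \<Rightarrow> real \<Rightarrow> (real \<Rightarrow>\<^sub>C (real ^ 'n)) \<Rightarrow> (real \<Rightarrow> real ^ 'l) \<Rightarrow>
   (real \<Rightarrow> real ^ 'n) \<Rightarrow> ereal \<Rightarrow> bool" where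
  "is_solution r f t0 x0 d x tm \<longleftrightarrow>
     ereal t0 < tm \<and>
     continuous_on {t. t0 - r \<le> t \<and> ereal t < tm} x \<and>
     (\<forall>b\<ge>t0. ereal b < tm \<longrightarrow> abs_continuous_on t0 b x) \<and>
     hist r t0 x = x0 \<and>
     (AE t in lebesgue. t0 \<le> t \<and> ereal t < tm \<longrightarrow>
        (x has_vector_derivative f t (hist r t x) (d t)) (at t))"

definition is_maximal_solution ::
  "real \<Rightarrow> ('n::finite, 'l::finite) rhs \<Rightarrow> real \<Rightarrow> (real \<Rightarrow>\<^sub>C (real ^ 'n)) \<Rightarrow> (real \<Rightarrow> real ^ 'l) \<Rightarrow>
   (real \<Rightarrow> real ^ 'n) \<Rightarrow> ereal \<Rightarrow> bool" where
  "is_maximal_solution r f t0 x0 d x tm \<longleftrightarrow>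
     is_solution r f t0 x0 d x tm \<and>
     (\<forall>y tm'. is_solution r f t0 x0 d y tm' \<and> tm \<le> tm' \<and>
        (\<forall>t. t0 - r \<le> t \<and> ereal t < tm \<longrightarrow> y t = x t) \<longrightarrow> tm' = tm)"

text \<open>
  The maximal solution together with its maximal time of existence. Under the standing hypotheses
  it is unique up to the irrelevant values of \<open>x\<close> outside \<open>[t0 - r, tmax)\<close>; this is why \<open>SOME\<close>
  rather than \<open>THE\<close> is used.
\<close>

definition max_solution ::
  "real \<Rightarrow> ('n::finite, 'l::finite) rhs \<Rightarrow> real \<Rightarrow> (real \<Rightarrow>\<^sub>C (real ^ 'n)) \<Rightarrow> (real \<Rightarrow> real ^ 'l) \<Rightarrow>
   (real \<Rightarrow> real ^ 'n) \<times> ereal" where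
  "max_solution r f t0 x0 d = (SOME (x, tm). is_maximal_solution r f t0 x0 d x tm)"

definition tmax ::
  "real \<Rightarrow> ('n::finite, 'l::finite) rhs \<Rightarrow> real \<Rightarrow> (real \<Rightarrow>\<^sub>C (real ^ 'n)) \<Rightarrow> (real \<Rightarrow> real ^ 'l) \<Rightarrow>
   ereal" where
  "tmax r f t0 x0 d = snd (max_solution r f t0 x0 d)"

definition phi ::
  "real \<Rightarrow> ('n::finite, 'l::finite) rhs \<Rightarrow> real \<Rightarrow> real \<Rightarrow> (real \<Rightarrow>\<^sub>C (real ^ 'n)) \<Rightarrow>
   (real \<Rightarrow> real ^ 'l) \<Rightarrow> (real \<Rightarrow>\<^sub>C (real ^ 'n))" where
  "phi r f t t0 x0 d = hist r t (fst (max_solution r f t0 x0 d))"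

section \<open>Stability notions\<close>

text \<open>
  The first conjunct makes explicit that \<open>phi\<close> has to be defined for all times occurring in the
  supremum, i.e. that no maximal solution ceases to exist in finite time.
\<close>

definition RFC :: "real \<Rightarrow> ('n::finite, 'l::finite) rhs \<Rightarrow> (real ^ 'l) set \<Rightarrow> bool" where
  "RFC r f D \<longleftrightarrow>
     (\<forall>t0\<ge>0. \<forall>x0\<in>hist_space r. \<forall>d\<in>disturbances D. tmax r f t0 x0 d = \<infinity>) \<and>
     (\<forall>s\<ge>0. \<forall>T\<ge>0. bdd_above {norm (phi r f (t0 + \<xi>) t0 x0 d) | \<xi> x0 t0 d.
        \<xi> \<in> {0..T} \<and> x0 \<in> hist_space r \<and> norm x0 \<le> s \<and> t0 \<in> {0..T} \<and> d \<in> disturbances D})"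

definition RGAOS ::
  "real \<Rightarrow> ('n::finite, 'l::finite) rhs \<Rightarrow> ('n, 'y::real_normed_vector) output_map \<Rightarrow>
   (real ^ 'l) set \<Rightarrow> bool" where
  "RGAOS r f H D \<longleftrightarrow>
     RFC r f D \<and>
     (\<forall>\<epsilon>>0. \<forall>T\<ge>0. bdd_above {norm (H t (phi r f t t0 x0 d)) | t x0 t0 d.
        t \<ge> t0 \<and> x0 \<in> hist_space r \<and> norm x0 \<le> \<epsilon> \<and> t0 \<in> {0..T} \<and> d \<in> disturbances D}) \<and>
     (\<forall>\<epsilon>>0. \<forall>T\<ge>0. \<exists>\<delta>>0. \<forall>x0\<in>hist_space r. \<forall>t0\<in>{0..T}. norm x0 \<le> \<delta> \<longrightarrow>
        (\<forall>t\<ge>t0. \<forall>d\<in>disturbances D. norm (H t (phi r f t t0 x0 d)) \<le> \<epsilon>)) \<and>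
     (\<forall>\<epsilon>>0. \<forall>T\<ge>0. \<forall>R\<ge>0. \<exists>\<tau>\<ge>0. \<forall>x0\<in>hist_space r. \<forall>t0\<in>{0..T}. norm x0 \<le> R \<longrightarrow>
        (\<forall>t\<ge>t0 + \<tau>. \<forall>d\<in>disturbances D. norm (H t (phi r f t t0 x0 d)) \<le> \<epsilon>))"

definition URGAOS ::
  "real \<Rightarrow> ('n::finite, 'l::finite) rhs \<Rightarrow> ('n, 'y::real_normed_vector) output_map \<Rightarrow>
   (real ^ 'l) set \<Rightarrow> bool" where
  "URGAOS r f H D \<longleftrightarrow>
     RGAOS r f H D \<and>
     (\<exists>\<sigma>. class_KL \<sigma> \<and>
        (\<forall>t0\<ge>0. \<forall>x0\<in>hist_space r. \<forall>d\<in>disturbances D. \<forall>t\<ge>t0.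
           norm (H t (phi r f t t0 x0 d)) \<le> \<sigma> (norm x0) (t - t0)))"

section \<open>Equivalence of the output map to a finite-dimensional mapping\<close>

definition equiv_finite_dim ::
  "real \<Rightarrow> ('n::finite, 'y::real_normed_vector) output_map \<Rightarrow>
   (real \<Rightarrow> real ^ 'n \<Rightarrow> real ^ 'p::finite) \<Rightarrow> bool" where
  "equiv_finite_dim r H h \<longleftrightarrow>
     continuous_on ({-r..} \<times> UNIV) (\<lambda>(t, x). h t x) \<and>
     (\<forall>t\<ge>-r. h t 0 = 0) \<and>
     (\<exists>b1 b2. class_Kinf b1 \<and> class_Kinf b2 \<and>
        (\<forall>t\<ge>0. \<forall>x\<in>hist_space r.
           b1 (norm (h t (apply_bcontfun x 0))) \<le> norm (H t x) \<and>
           norm (H t x) \<le> b2 (SUP \<theta>\<in>{-r..0}. norm (h (t + \<theta>) (apply_bcontfun x \<theta>)))))"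

end

(*
  Every maximal solution is obtained by Zorn's lemma from local solutions, which are limits of
  solutions of the equation with a small additional delay (Arzela-Ascoli and dominated convergence).
  Along a solution v t = V t (x t) is absolutely continuous, so the almost everywhere Dini inequality
  integrates: as long as the level q <= v <= P satisfies a P <= q, v decreases at least at the rate
  inf rho on [q, P]. Since a P < P, the maximum of v over a window can neither be exceeded later nor
  stay bounded away from 0, and the time needed to fall below a given level depends only on the
  initial maximum of v. The bounds a1, a2, b2 translate this into the stability of the output.
*)
theory Submission
  imports Defs "HOL-Complex_Analysis.Great_Picard" "HOL-Real_Asymp.Real_Asymp"
begin

section \<open>Absolutely continuous functions\<close>

text \<open>\<open>tmax\<close> and \<open>phi\<close> are chosen by \<open>SOME\<close>, so nothing
  can be said of them before a maximal solution is known to exist. The right-hand side is only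
  one-sided Lipschitz in the state, which rules out a contraction argument; with a positive delay
  the equation is solved by plain integration, and boundedness of \<open>f\<close> on bounded sets
  supplies the equicontinuity. The estimates hold along every solution, hence along the chosen one.

  The differential inequality holds only off a null set of times, and the Cantor function shows that
  mere continuity of v would not allow it to be integrated; this is why absolute continuity is
  carried along. It also holds only where V dominates \<open>a\<close> of its window maximum, so no
  single comparison equation governs v. Fixing two levels q and P removes this condition from the
  argument, at the price of reaching 0 through an infimum of levels instead of an explicit rate. The
  waiting times found in this way do not involve the initial time, the disturbance or the particular
  solution, so a KL bound can be assembled afterwards from all triples (initial norm, elapsed time,
  output norm).\<close>

lemma abs_continuous_on_uniform:
  assumes "abs_continuous_on a b x" "\<epsilon> > 0"
  obtains \<delta> where "\<delta> > 0"
    "\<And>u v. a \<le> u \<Longrightarrow> u \<le> b \<Longrightarrow> a \<le> v \<Longrightarrow> v \<le> b \<Longrightarrow> \<bar>v - u\<bar> < \<delta> \<Longrightarrow> norm (x v - x u) < \<epsilon>"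
proof -
  obtain \<delta> where "\<delta> > 0" and \<delta>: "\<And>I::(real \<times> real) set.
      finite I \<and> (\<forall>(u, v)\<in>I. a \<le> u \<and> u \<le> v \<and> v \<le> b) \<and>
      disjoint_family_on (\<lambda>(u, v). {u<..<v}) I \<and> (\<Sum>(u, v)\<in>I. v - u) < \<delta>
        \<Longrightarrow> (\<Sum>(u, v)\<in>I. norm (x v - x u)) < \<epsilon>"
    using assms unfolding abs_continuous_on_def by blast
  have *: "norm (x v - x u) < \<epsilon>" if "a \<le> u" "u \<le> v" "v \<le> b" "v - u < \<delta>" for u v
    using \<delta>[of "{(u, v)}"] that by (simp add: disjoint_family_on_def)
  show ?thesis
  proof (rule that[OF \<open>\<delta> > 0\<close>])
    fix u v assume "a \<le> u" "u \<le> b" "a \<le> v" "v \<le> b" "\<bar>v - u\<bar> < \<delta>"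
    then show "norm (x v - x u) < \<epsilon>"
      using *[of u v] *[of v u] by (cases "u \<le> v") (auto simp: norm_minus_commute)
  qed
qed

lemma abs_continuous_on_imp_continuous_on:
  assumes "abs_continuous_on a b x"
  shows "continuous_on {a..b} x"
  unfolding continuous_on_iff dist_norm
  by (metis abs_continuous_on_uniform[OF assms] atLeastAtMost_iff real_norm_def)

lemma abs_continuous_on_subinterval:
  assumes "abs_continuous_on a b x" "a \<le> a'" "b' \<le> b"
  shows "abs_continuous_on a' b' x"
  unfolding abs_continuous_on_def
proof (intro allI impI)
  fix \<epsilon> :: real assume "\<epsilon> > 0"
  then obtain \<delta> where "\<delta> > 0" and \<delta>: "\<And>I::(real \<times> real) set.
      finite I \<and> (\<forall>(u, v)\<in>I. a \<le> u \<and> u \<le> v \<and> v \<le> b) \<and>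
      disjoint_family_on (\<lambda>(u, v). {u<..<v}) I \<and> (\<Sum>(u, v)\<in>I. v - u) < \<delta>
        \<Longrightarrow> (\<Sum>(u, v)\<in>I. norm (x v - x u)) < \<epsilon>"
    using assms(1) unfolding abs_continuous_on_def by blast
  show "\<exists>\<delta>>0. \<forall>I::(real \<times> real) set.
        finite I \<and> (\<forall>(u, v)\<in>I. a' \<le> u \<and> u \<le> v \<and> v \<le> b') \<and>
        disjoint_family_on (\<lambda>(u, v). {u<..<v}) I \<and> (\<Sum>(u, v)\<in>I. v - u) < \<delta>
        \<longrightarrow> (\<Sum>(u, v)\<in>I. norm (x v - x u)) < \<epsilon>"
    using \<open>\<delta> > 0\<close> \<delta> assms(2,3) by (intro exI[of _ \<delta>]) fastforce
qed

text \<open>The term \<open>v - u\<close> lets \<open>w\<close> depend on time as well as on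
  \<open>x\<close>. This covers functions such as \<open>V t (x t) + c * t\<close>, and with a
  constant \<open>x\<close> it yields the Lipschitz case.\<close>

lemma abs_continuous_on_bound:
  assumes "abs_continuous_on a b x" "L \<ge> 0"
    and "\<And>u v. a \<le> u \<Longrightarrow> u \<le> v \<Longrightarrow> v \<le> b \<Longrightarrow> norm (w v - w u) \<le> L * (norm (x v - x u) + (v - u))"
  shows "abs_continuous_on a b w"
  unfolding abs_continuous_on_def
proof (intro allI impI)
  fix \<epsilon> :: real assume "\<epsilon> > 0"
  \<comment> \<open>\<open>L\<close> may be 0; the shift by 1 permits division and makes the final
    comparison strict.\<close>
  define K where "K = L + 1"
  have K: "K > 0" "L < K" using assms(2) by (auto simp: K_def)
  let ?\<epsilon> = "\<epsilon> / (2 * K)"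
  have "?\<epsilon> > 0" using \<open>\<epsilon> > 0\<close> K(1) by simp
  then obtain \<delta> where "\<delta> > 0" and \<delta>: "\<And>I::(real \<times> real) set.
      finite I \<and> (\<forall>(u, v)\<in>I. a \<le> u \<and> u \<le> v \<and> v \<le> b) \<and>
      disjoint_family_on (\<lambda>(u, v). {u<..<v}) I \<and> (\<Sum>(u, v)\<in>I. v - u) < \<delta>
        \<Longrightarrow> (\<Sum>(u, v)\<in>I. norm (x v - x u)) < ?\<epsilon>"
    using assms(1) unfolding abs_continuous_on_def by blast
  show "\<exists>\<delta>>0. \<forall>I::(real \<times> real) set.
        finite I \<and> (\<forall>(u, v)\<in>I. a \<le> u \<and> u \<le> v \<and> v \<le> b) \<and>
        disjoint_family_on (\<lambda>(u, v). {u<..<v}) I \<and> (\<Sum>(u, v)\<in>I. v - u) < \<delta>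
        \<longrightarrow> (\<Sum>(u, v)\<in>I. norm (w v - w u)) < \<epsilon>"
  proof (intro exI[of _ "min \<delta> ?\<epsilon>"] conjI allI impI)
    show "min \<delta> ?\<epsilon> > 0" using \<open>\<delta> > 0\<close> \<open>?\<epsilon> > 0\<close> by linarith
    fix I :: "(real \<times> real) set"
    assume I: "finite I \<and> (\<forall>(u, v)\<in>I. a \<le> u \<and> u \<le> v \<and> v \<le> b) \<and>
        disjoint_family_on (\<lambda>(u, v). {u<..<v}) I \<and> (\<Sum>(u, v)\<in>I. v - u) < min \<delta> ?\<epsilon>"
    have "(\<Sum>(u, v)\<in>I. norm (w v - w u)) \<le> (\<Sum>(u, v)\<in>I. L * (norm (x v - x u) + (v - u)))"
      by (rule sum_mono) (use I assms(3) in auto)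
    also have "\<dots> = L * ((\<Sum>(u, v)\<in>I. norm (x v - x u)) + (\<Sum>(u, v)\<in>I. v - u))"
      by (simp add: sum_distrib_left case_prod_unfold algebra_simps sum.distrib sum_subtractf)
    also have "\<dots> \<le> L * (?\<epsilon> + ?\<epsilon>)"
      using \<delta>[of I] I assms(2) by (intro mult_left_mono) auto
    also have "\<dots> < K * (?\<epsilon> + ?\<epsilon>)"
      using \<open>?\<epsilon> > 0\<close> K by (intro mult_strict_right_mono) linarith+
    also have "\<dots> = \<epsilon>" using K(1) by simp
    finally show "(\<Sum>(u, v)\<in>I. norm (w v - w u)) < \<epsilon>" .
  qed
qed

lemma abs_continuous_on_lipschitz:
  assumes "L-lipschitz_on {a..b} x"
  shows "abs_continuous_on a b x"
proof -
  have "abs_continuous_on a b (\<lambda>t. 0 :: real)"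
    unfolding abs_continuous_on_def by (auto simp: case_prod_unfold intro: exI[of _ 1])
  moreover have "norm (x v - x u) \<le> L * (norm ((0::real) - 0) + (v - u))"
    if "a \<le> u" "u \<le> v" "v \<le> b" for u v
    using lipschitz_onD[OF assms, of v u] that by (simp add: dist_norm)
  ultimately show ?thesis
    by (intro abs_continuous_on_bound[of a b "\<lambda>t. 0 :: real" L x]) (use lipschitz_on_nonneg[OF assms] in auto)
qed

lemma abs_continuous_on_cong:
  assumes "\<And>t. a \<le> t \<Longrightarrow> t \<le> b \<Longrightarrow> x t = y t"
  shows "abs_continuous_on a b x \<longleftrightarrow> abs_continuous_on a b y"
proof -
  have "abs_continuous_on a b w" if "abs_continuous_on a b z" "\<And>t. a \<le> t \<Longrightarrow> t \<le> b \<Longrightarrow> z t = w t"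
    for z w :: "real \<Rightarrow> 'a"
    by (rule abs_continuous_on_bound[OF that(1), of 1]) (use that(2) in auto)
  from this[of x y] this[of y x] assms show ?thesis by auto
qed

section \<open>Monotonicity from almost everywhere Dini bounds\<close>

lemma sum_intervals_le_measure:
  fixes I :: "(real \<times> real) set"
  assumes "finite I" "\<forall>(u, v)\<in>I. u \<le> v \<and> {u<..<v} \<subseteq> U"
    and "disjoint_family_on (\<lambda>(u, v). {u<..<v}) I" "U \<in> lmeasurable"
  shows "(\<Sum>(u, v)\<in>I. v - u) \<le> measure lebesgue U"
proof -
  have "(\<Sum>(u, v)\<in>I. v - u) = (\<Sum>i\<in>I. measure lebesgue (case i of (u, v) \<Rightarrow> {u<..<v}))"
    by (rule sum.cong) (use assms(2) in \<open>auto simp: case_prod_unfold\<close>)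
  also have "\<dots> = measure lebesgue (\<Union>i\<in>I. case i of (u, v) \<Rightarrow> {u<..<v})"
    by (rule measure_finite_Union[symmetric]) (use assms in \<open>auto simp: case_prod_unfold\<close>)
  also have "\<dots> \<le> measure lebesgue U"
    by (rule measure_mono_fmeasurable) (use assms in \<open>auto intro!: sets.finite_UN\<close>)
  finally show ?thesis .
qed

text \<open>
  Continuous induction: outside \<open>N\<close> the growth of \<open>w\<close> is controlled by the Dini derivative, inside a
  small open neighbourhood \<open>U\<close> of \<open>N\<close> by the variation \<open>F\<close> of \<open>w\<close> over \<open>U\<close>, which absolute
  continuity makes small.
\<close>

lemma abs_continuous_on_dini_nonincreasing:
  fixes w :: "real \<Rightarrow> real"
  assumes ab: "a \<le> b" and ac: "abs_continuous_on a b w" and N: "negligible N"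
    and dini: "\<And>t \<epsilon>. a \<le> t \<Longrightarrow> t < b \<Longrightarrow> t \<notin> N \<Longrightarrow> \<epsilon> > 0 \<Longrightarrow>
      \<exists>\<eta>>0. \<forall>h. 0 < h \<and> h < \<eta> \<longrightarrow> w (t + h) \<le> w t + \<epsilon> * h"
  shows "w b \<le> w a"
proof -
  have main: "w b \<le> w a + \<epsilon> * (b - a) + \<epsilon>" if e: "\<epsilon> > 0" for \<epsilon>
  proof -
    obtain \<delta> where "\<delta> > 0" and \<delta>: "\<And>I::(real \<times> real) set.
      finite I \<and> (\<forall>(u, v)\<in>I. a \<le> u \<and> u \<le> v \<and> v \<le> b) \<and>
      disjoint_family_on (\<lambda>(u, v). {u<..<v}) I \<and> (\<Sum>(u, v)\<in>I. v - u) < \<delta>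
        \<Longrightarrow> (\<Sum>(u, v)\<in>I. norm (w v - w u)) < \<epsilon>"
      using ac e unfolding abs_continuous_on_def by blast
    have N0: "N \<in> lmeasurable" "measure lebesgue N = 0"
      using N by (auto simp: negligible_imp_measurable negligible_imp_measure0)
    \<comment> \<open>\<open>N\<close> is null, so \<open>U\<close> can have measure below the
      \<delta> of absolute continuity; every disjoint family of intervals inside \<open>U\<close>
      then has total length below \<delta>.\<close>
    obtain U where U: "open U" "N \<subseteq> U" "U - N \<in> lmeasurable" "emeasure lebesgue (U - N) < ennreal \<delta>"
      using sets_lebesgue_outer_open[OF fmeasurableD[OF N0(1)] \<open>\<delta> > 0\<close>] by blast
    have "U = (U - N) \<union> N" using U(2) by blast
    then have Um: "U \<in> lmeasurable" using fmeasurable.Un[OF U(3) N0(1)] by simp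
    have "measure lebesgue U \<le> measure lebesgue (U - N) + measure lebesgue N"
      using measure_Un_le[of "U - N" lebesgue N] U(3) N0(1) \<open>U = (U - N) \<union> N\<close> by (simp add: fmeasurableD)
    moreover have "measure lebesgue (U - N) < \<delta>"
      using U(3,4) by (simp add: emeasure_eq_measure2 ennreal_less_iff)
    ultimately have Ud: "measure lebesgue U < \<delta>" using N0(2) by simp
    \<comment> \<open>Requiring the families to end by \<open>t\<close> makes \<open>F\<close>
      monotone and lets an interval starting at \<open>t\<close> be appended without
      overlap.\<close>
    define \<I> where "\<I> t = {I::(real \<times> real) set. finite I \<and>
      (\<forall>(u, v)\<in>I. a \<le> u \<and> u \<le> v \<and> v \<le> t \<and> {u<..<v} \<subseteq> U) \<and> disjoint_family_on (\<lambda>(u, v). {u<..<v}) I}" for t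
    define var where "var I = (\<Sum>(u, v)\<in>I. norm (w v - w u))" for I
    define F where "F t = (SUP I\<in>\<I> t. var I)" for t
    have ne: "{} \<in> \<I> t" for t by (auto simp: \<I>_def disjoint_family_on_def)
    have small: "var I \<le> \<epsilon>" if "I \<in> \<I> t" "t \<le> b" for I t
    proof -
      have "(\<Sum>(u, v)\<in>I. v - u) \<le> measure lebesgue U"
        by (rule sum_intervals_le_measure) (use that Um in \<open>auto simp: \<I>_def\<close>)
      with \<delta>[of I] that Ud show ?thesis unfolding \<I>_def var_def by fastforce
    qed
    have bdd: "bdd_above (var ` \<I> t)" if "t \<le> b" for t
      by (rule bdd_aboveI2[of _ _ \<epsilon>]) (rule small[OF _ that])
    have F_le: "F t \<le> \<epsilon>" if "t \<le> b" for t
      unfolding F_def by (rule cSUP_least) (use ne small that in auto)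
    have F_mono: "F t \<le> F t'" if "t \<le> t'" "t' \<le> b" for t t'
      unfolding F_def
    proof (rule cSUP_subset_mono)
      show "\<I> t \<noteq> {}" using ne by blast
      show "\<I> t \<subseteq> \<I> t'" using that(1) by (fastforce simp: \<I>_def)
    qed (use bdd[OF that(2)] in auto)
    have F_step: "F t + \<bar>w t' - w t\<bar> \<le> F t'" if "t < t'" "t' \<le> b" "a \<le> t" "{t<..<t'} \<subseteq> U" for t t'
    proof -
      have "F t \<le> F t' - \<bar>w t' - w t\<bar>"
        unfolding F_def[of t]
      proof (rule cSUP_least)
        fix I assume I: "I \<in> \<I> t"
        \<comment> \<open>Members of \<open>I\<close> end by \<open>t < t'\<close>, so
          \<open>(t, t')\<close> is new and its term is not absorbed by the insertion into a
          set.\<close>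
        have notin: "(t, t') \<notin> I" using I that by (auto simp: \<I>_def)
        have "insert (t, t') I \<in> \<I> t'"
          using I that by (fastforce simp: \<I>_def disjoint_family_on_def)
        then have "var (insert (t, t') I) \<le> F t'"
          unfolding F_def by (rule cSUP_upper) (use bdd that in auto)
        moreover have "var (insert (t, t') I) = \<bar>w t' - w t\<bar> + var I"
          using I notin by (simp add: var_def \<I>_def)
        ultimately show "var I \<le> F t' - \<bar>w t' - w t\<bar>" by simp
      qed (use ne in auto)
      then show ?thesis by simp
    qed
    define S where "S = {t. a \<le> t \<and> t \<le> b \<and> w t \<le> w a + \<epsilon> * (t - a) + F t}"
    have "var {} = 0" by (simp add: var_def)
    then have "F a \<ge> 0" unfolding F_def using cSUP_upper[OF ne bdd[OF ab]] by simp
    then have aS: "a \<in> S" using ab by (simp add: S_def)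
    have bddS: "bdd_above S" by (auto simp: S_def)
    define s where "s = Sup S"
    have s: "a \<le> s" unfolding s_def by (rule cSup_upper[OF aS bddS])
    have s': "s \<le> b" unfolding s_def by (rule cSup_least) (use aS in \<open>auto simp: S_def\<close>)
    note s = s s'
    have sS: "s \<in> S"
    proof -
      \<comment> \<open>\<open>F\<close> may jump, so membership of the supremum uses only its
        monotonicity together with the continuity of \<open>w\<close>.\<close>
      have "w s \<le> w a + \<epsilon> * (s - a) + F s + \<eta>" if "\<eta> > 0" for \<eta>
      proof -
        obtain \<kappa> where "\<kappa> > 0" and \<kappa>: "\<And>u v. a \<le> u \<Longrightarrow> u \<le> b \<Longrightarrow> a \<le> v \<Longrightarrow> v \<le> b \<Longrightarrow>
            \<bar>v - u\<bar> < \<kappa> \<Longrightarrow> norm (w v - w u) < \<eta>"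
          using abs_continuous_on_uniform[OF ac \<open>\<eta> > 0\<close>] by metis
        obtain t where t: "t \<in> S" "s - \<kappa> < t"
          using less_cSupD[of S "s - \<kappa>"] aS \<open>\<kappa> > 0\<close> unfolding s_def by auto
        have "t \<le> s" using cSup_upper[OF t(1) bddS] by (simp add: s_def)
        have "norm (w s - w t) < \<eta>" using \<kappa>[of t s] t s \<open>t \<le> s\<close> by (auto simp: S_def)
        then have "w s \<le> w t + \<eta>" by simp
        also have "\<dots> \<le> w a + \<epsilon> * (t - a) + F t + \<eta>" using t by (simp add: S_def)
        also have "\<dots> \<le> w a + \<epsilon> * (s - a) + F s + \<eta>"
          using F_mono[OF \<open>t \<le> s\<close> s(2)] mult_left_mono[of "t - a" "s - a" \<epsilon>] \<open>t \<le> s\<close> e by linarith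
        finally show ?thesis .
      qed
      then show ?thesis using s by (auto simp: S_def intro: field_le_epsilon)
    qed
    have "s = b"
    proof (rule ccontr)
      assume "s \<noteq> b"
      then have "s < b" using s by simp
      have "\<exists>h>0. s + h \<in> S"
      proof (cases "s \<in> N")
        case True
        then obtain h where h: "h > 0" "ball s h \<subseteq> U" using U openE by blast
        define k where "k = min h (b - s)"
        have k: "k > 0" "k \<le> h" "s + k \<le> b" using h \<open>s < b\<close> by (auto simp: k_def)
        have "{s<..<s + k} \<subseteq> U" using h k by (auto simp: dist_real_def subset_iff)
        then have "F s + \<bar>w (s + k) - w s\<bar> \<le> F (s + k)" using k s by (intro F_step) auto
        moreover have "\<epsilon> * k \<ge> 0" using e k by simp
        ultimately have "s + k \<in> S" using sS k s by (auto simp: S_def algebra_simps)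
        with k show ?thesis by blast
      next
        case False
        then obtain h where h: "h > 0" "\<And>k. 0 < k \<Longrightarrow> k < h \<Longrightarrow> w (s + k) \<le> w s + \<epsilon> * k"
          using dini[of s \<epsilon>] s \<open>s < b\<close> e by auto
        define k where "k = min (h/2) (b - s)"
        have k: "k > 0" "k < h" "s + k \<le> b" using h \<open>s < b\<close> by (auto simp: k_def)
        have "F s \<le> F (s + k)" using k by (intro F_mono) auto
        then have "s + k \<in> S" using sS k s h(2)[of k] by (auto simp: S_def algebra_simps)
        with k show ?thesis by blast
      qed
      then obtain h where "h > 0" "s + h \<in> S" by blast
      then show False using cSup_upper[OF _ bddS] unfolding s_def by fastforce
    qed
    with sS F_le[of b] show ?thesis by (simp add: S_def)
  qed
  have "w b - w a \<le> 0"
  proof (rule field_le_epsilon)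
    fix e :: real assume "e > 0"
    define k where "k = e / (b - a + 1)"
    have "k > 0" using ab \<open>e > 0\<close> by (simp add: k_def)
    then have "w b \<le> w a + k * (b - a) + k" by (rule main)
    also have "\<dots> = w a + k * (b - a + 1)" by (simp add: algebra_simps)
    also have "\<dots> = w a + e" using ab by (simp add: k_def)
    finally show "w b - w a \<le> 0 + e" by simp
  qed
  then show ?thesis by simp
qed

text \<open>Projecting onto the direction \<open>e\<close> of \<open>x t - x s\<close> turns the
  vector bound into a scalar one: \<open>e \<bullet> x \<tau> - M * \<tau>\<close> has a nonpositive
  derivative off \<open>N\<close> and is therefore nonincreasing. A mean value theorem alone would
  not tolerate the exceptional set.\<close>

lemma abs_continuous_on_derivative_bound:
  fixes x :: "real \<Rightarrow> 'a::euclidean_space"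
  assumes ac: "abs_continuous_on a b x" and "M \<ge> 0" and N: "negligible N"
    and der: "\<And>t. a \<le> t \<Longrightarrow> t < b \<Longrightarrow> t \<notin> N \<Longrightarrow> \<exists>y. norm y \<le> M \<and> (x has_vector_derivative y) (at t)"
  shows "M-lipschitz_on {a..b} x"
proof (rule lipschitz_on_leI)
  fix s t assume st: "s \<in> {a..b}" "t \<in> {a..b}" "s \<le> t"
  define e where "e = sgn (x t - x s)"
  have e1: "norm e \<le> 1" by (simp add: e_def norm_sgn)
  define w where "w \<tau> = e \<bullet> x \<tau> - M * \<tau>" for \<tau>
  have inner_le: "\<bar>e \<bullet> y\<bar> \<le> norm y" for y
    using Cauchy_Schwarz_ineq2[of e y] mult_right_mono[OF e1, of "norm y"] by simp
  have "w t \<le> w s"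
  proof (rule abs_continuous_on_dini_nonincreasing[OF \<open>s \<le> t\<close> _ N])
    have "abs_continuous_on s t x" using ac st by (intro abs_continuous_on_subinterval[OF ac]) auto
    then show "abs_continuous_on s t w"
    proof (rule abs_continuous_on_bound[where L = "M + 1"])
      fix u v :: real assume "u \<le> v"
      have "norm (w v - w u) = \<bar>e \<bullet> (x v - x u) - M * (v - u)\<bar>"
        by (simp add: w_def inner_diff_right algebra_simps)
      also have "\<dots> \<le> norm (x v - x u) + M * (v - u)"
        using inner_le[of "x v - x u"] \<open>u \<le> v\<close> \<open>M \<ge> 0\<close> abs_triangle_ineq4[of "e \<bullet> (x v - x u)" "M * (v - u)"]
        by (simp add: abs_mult)
      also have "\<dots> \<le> (M + 1) * (norm (x v - x u) + (v - u))"
        using \<open>u \<le> v\<close> mult_nonneg_nonneg[OF \<open>M \<ge> 0\<close> norm_ge_zero[of "x v - x u"]]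
        by (simp add: algebra_simps)
      finally show "norm (w v - w u) \<le> (M + 1) * (norm (x v - x u) + (v - u))" .
    qed (use \<open>M \<ge> 0\<close> in simp)
    fix \<tau> \<epsilon> :: real assume \<tau>: "s \<le> \<tau>" "\<tau> < t" "\<tau> \<notin> N" "\<epsilon> > 0"
    then obtain y where y: "norm y \<le> M" "(x has_vector_derivative y) (at \<tau>)"
      using der[of \<tau>] st by auto
    then obtain d where d: "d > 0" "\<And>\<tau>'. norm (\<tau>' - \<tau>) < d \<Longrightarrow>
        norm (x \<tau>' - x \<tau> - (\<tau>' - \<tau>) *\<^sub>R y) \<le> \<epsilon> * norm (\<tau>' - \<tau>)"
      using \<open>\<epsilon> > 0\<close> unfolding has_vector_derivative_def has_derivative_at_alt by blast
    show "\<exists>\<eta>>0. \<forall>h. 0 < h \<and> h < \<eta> \<longrightarrow> w (\<tau> + h) \<le> w \<tau> + \<epsilon> * h"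
    proof (intro exI[of _ d] conjI allI impI)
      fix h assume h: "0 < h \<and> h < d"
      have "e \<bullet> (x (\<tau> + h) - x \<tau> - h *\<^sub>R y) \<le> \<epsilon> * h"
        using inner_le[of "x (\<tau> + h) - x \<tau> - h *\<^sub>R y"] d(2)[of "\<tau> + h"] h by simp
      moreover have "h * (e \<bullet> y) \<le> h * M"
        using inner_le[of y] y h by (intro mult_left_mono) auto
      ultimately show "w (\<tau> + h) \<le> w \<tau> + \<epsilon> * h"
        by (simp add: w_def inner_diff_right algebra_simps)
    qed (use d in auto)
  qed
  then have "e \<bullet> (x t - x s) \<le> M * (t - s)" by (simp add: w_def inner_diff_right algebra_simps)
  moreover have "e \<bullet> (x t - x s) = norm (x t - x s)"
    by (cases "x t = x s")
      (simp_all add: e_def sgn_div_norm dot_square_norm power2_eq_square)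
  ultimately show "dist (x s) (x t) \<le> M * dist s t"
    using st by (simp add: dist_norm norm_minus_commute abs_if)
qed fact

section \<open>Histories and the right-hand side along them\<close>

lemma hist_cong:
  assumes "r \<ge> 0" "\<And>\<tau>. t - r \<le> \<tau> \<Longrightarrow> \<tau> \<le> t \<Longrightarrow> x \<tau> = y \<tau>"
  shows "hist r t x = hist r t y"
proof -
  have "x (t + max (-r) (min 0 \<theta>)) = y (t + max (-r) (min 0 \<theta>))" for \<theta>
    by (rule assms(2)) (use assms(1) in auto)
  then show ?thesis by (simp add: hist_def)
qed

lemma dist_hist_le:
  fixes x y :: "real \<Rightarrow> 'b::metric_space"
  assumes "r \<ge> 0" "continuous_on {s - r..s} x" "continuous_on {t - r..t} y"
    and "\<And>\<theta>. -r \<le> \<theta> \<Longrightarrow> \<theta> \<le> 0 \<Longrightarrow> dist (x (s + \<theta>)) (y (t + \<theta>)) \<le> e"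
  shows "dist (hist r s x) (hist r t y) \<le> e"
  by (rule dist_bound)
    (use assms(1) in \<open>auto simp: apply_hist_ext[OF assms(1,2)] apply_hist_ext[OF assms(1,3)] intro!: assms(4)\<close>)

lemma norm_hist_le:
  fixes x :: "real \<Rightarrow> 'b::real_normed_vector"
  assumes "r \<ge> 0" "continuous_on {t - r..t} x"
    and "\<And>\<tau>. t - r \<le> \<tau> \<Longrightarrow> \<tau> \<le> t \<Longrightarrow> norm (x \<tau>) \<le> e"
  shows "norm (hist r t x) \<le> e"
  by (rule norm_bound) (use assms(1) in \<open>auto simp: apply_hist_ext[OF assms(1,2)] intro!: assms(3)\<close>)

text \<open>The history norm is a supremum over the window, so all shifts must be controlled at
  once; uniform continuity of \<open>x\<close> on the compact interval does this.\<close>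

lemma continuous_on_hist:
  assumes "r \<ge> 0" "continuous_on {a - r..b} x"
  shows "continuous_on {a..b} (\<lambda>t. hist r t x)"
  unfolding continuous_on_iff
proof (intro ballI allI impI)
  fix t e :: real assume t: "t \<in> {a..b}" and "e > 0"
  have c: "continuous_on {t - r..t} x" if "t \<in> {a..b}" for t
    by (rule continuous_on_subset[OF assms(2)]) (use that in auto)
  have "uniformly_continuous_on {a - r..b} x"
    using assms(2) by (intro compact_uniformly_continuous) auto
  then obtain d where d: "d > 0" "\<And>u v. u \<in> {a - r..b} \<Longrightarrow> v \<in> {a - r..b} \<Longrightarrow> dist v u < d \<Longrightarrow> dist (x v) (x u) < e / 2"
    unfolding uniformly_continuous_on_def using \<open>e > 0\<close> half_gt_zero by metis
  show "\<exists>d>0. \<forall>t'\<in>{a..b}. dist t' t < d \<longrightarrow> dist (hist r t' x) (hist r t x) < e"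
  proof (intro exI[of _ d] conjI ballI impI)
    fix t' assume t': "t' \<in> {a..b}" "dist t' t < d"
    have "dist (hist r t' x) (hist r t x) \<le> e / 2"
    proof (rule dist_hist_le[OF assms(1) c[OF t'(1)] c[OF t]])
      fix \<theta> :: real assume "-r \<le> \<theta>" "\<theta> \<le> 0"
      then show "dist (x (t' + \<theta>)) (x (t + \<theta>)) \<le> e / 2"
        using t t' by (intro less_imp_le[OF d(2)]) (auto simp: dist_real_def)
    qed
    then show "dist (hist r t' x) (hist r t x) < e" using \<open>e > 0\<close> by simp
  qed (use d in auto)
qed

text \<open>Off the countable set \<open>A\<close> the right-hand side is jointly continuous, hence
  a continuous function of the measurable curve \<open>t \<mapsto> (t, d t)\<close>. The times in
  \<open>A\<close> form a null set, and every subset of a null set is Lebesgue measurable.\<close>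

lemma rhs_borel_measurable:
  fixes f :: "('n::finite, 'l::finite) rhs"
  assumes f: "hyp3 r f D" and d: "d \<in> disturbances D" and a: "0 \<le> a"
    and c: "continuous_on {a..b} \<psi>" and \<psi>: "\<And>t. t \<in> {a..b} \<Longrightarrow> \<psi> t \<in> hist_space r"
  shows "(\<lambda>t. f t (\<psi> t) (d t)) \<in> borel_measurable (lebesgue_on {a..b})"
proof -
  obtain A :: "real set" where A: "finite A \<or> (\<exists>\<tau>::nat \<Rightarrow> real. A = range \<tau>)"
    and cont: "continuous_on (({0..} - A) \<times> hist_space r \<times> D) (\<lambda>(t, x, d). f t x d)"
    using f unfolding hyp3_def by blast
  have "countable A" using A by (auto intro: countable_finite)
  then have "negligible (\<Union>((\<lambda>t. {t}) ` A))" by (intro negligible_countable_Union) auto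
  then have nA: "negligible A" by simp
  let ?S = "{a..b} - A"
  have Sm: "?S \<in> sets lebesgue" using negligible_imp_sets[OF nA] by (intro sets.Diff) auto
  have cg: "continuous_on (?S \<times> D) (\<lambda>(t, u). f t (\<psi> t) u)"
  proof -
    have "continuous_on (?S \<times> D) (\<lambda>p. (fst p, \<psi> (fst p), snd p))"
      by (intro continuous_intros continuous_on_compose2[OF c]) auto
    moreover have "(\<lambda>p. (fst p, \<psi> (fst p), snd p)) ` (?S \<times> D) \<subseteq> ({0..} - A) \<times> hist_space r \<times> D"
      using a \<psi> by auto
    ultimately have "continuous_on (?S \<times> D) (\<lambda>p. case (fst p, \<psi> (fst p), snd p) of (t, x, d) \<Rightarrow> f t x d)"
      by (intro continuous_on_compose2[OF cont])
    then show ?thesis by (simp add: case_prod_unfold)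
  qed
  have dm: "d \<in> borel_measurable (lebesgue_on ?S)"
    by (rule measurable_restrict_mono[of _ _ "{0..}"]) (use d a in \<open>auto simp: disturbances_def\<close>)
  have pm: "(\<lambda>t. (t, d t)) \<in> borel_measurable (lebesgue_on ?S)"
    by (intro borel_measurable_Pair dm) (auto intro!: measurable_restrict_space1 measurable_completion)
  show ?thesis
  proof (rule borel_measurableI)
    fix W :: "(real ^ 'n) set" assume "open W"
    \<comment> \<open>\<open>D\<close> is an arbitrary set, so the preimage of \<open>W\<close> is
      only relatively open; measurability of the curve is applied to an ambient open set
      \<open>G\<close> with the same trace.\<close>
    then obtain G where G: "open G" "G \<inter> (?S \<times> D) = (\<lambda>(t, u). f t (\<psi> t) u) -` W \<inter> (?S \<times> D)"
      using cg unfolding continuous_on_open_invariant by blast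
    let ?g = "\<lambda>t. f t (\<psi> t) (d t)"
    have inD: "d t \<in> D" if "t \<in> {a..b}" for t using d that a by (auto simp: disturbances_def)
    have "?g -` W \<inter> ?S = (\<lambda>t. (t, d t)) -` G \<inter> ?S"
    proof -
      have "?g t \<in> W \<longleftrightarrow> (t, d t) \<in> G" if "t \<in> ?S" for t
      proof -
        have "(t, d t) \<in> ?S \<times> D" using that inD by blast
        then have "(t, d t) \<in> G \<longleftrightarrow> (t, d t) \<in> (\<lambda>(t, u). f t (\<psi> t) u) -` W \<inter> (?S \<times> D)"
          by (subst G(2)[symmetric]) simp
        with \<open>(t, d t) \<in> ?S \<times> D\<close> show ?thesis by simp
      qed
      then show ?thesis by auto
    qed
    moreover have "(\<lambda>t. (t, d t)) -` G \<inter> space (lebesgue_on ?S) \<in> sets (lebesgue_on ?S)"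
      by (rule measurable_sets[OF pm borel_open[OF G(1)]])
    ultimately have 1: "?g -` W \<inter> ?S \<in> sets lebesgue"
      using Sm by (simp add: sets_restrict_space_iff)
    have 2: "?g -` W \<inter> ({a..b} \<inter> A) \<in> sets lebesgue"
      by (rule negligible_imp_sets[OF negligible_subset[OF nA]]) auto
    have "?g -` W \<inter> {a..b} = (?g -` W \<inter> ?S) \<union> (?g -` W \<inter> ({a..b} \<inter> A))" by auto
    then have "?g -` W \<inter> {a..b} \<in> sets lebesgue" using sets.Un[OF 1 2] by simp
    then show "?g -` W \<inter> space (lebesgue_on {a..b}) \<in> sets (lebesgue_on {a..b})"
      by (simp add: sets_restrict_space_iff)
  qed
qed

lemma rhs_integrable:
  fixes f :: "('n::finite, 'l::finite) rhs"
  assumes "hyp3 r f D" "d \<in> disturbances D" "0 \<le> a" "continuous_on {a..b} \<psi>"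
    and "\<And>t. t \<in> {a..b} \<Longrightarrow> \<psi> t \<in> hist_space r"
    and "\<And>t. t \<in> {a..b} \<Longrightarrow> norm (f t (\<psi> t) (d t)) \<le> M"
  shows "(\<lambda>t. f t (\<psi> t) (d t)) integrable_on {a..b}"
  by (rule measurable_bounded_by_integrable_imp_integrable[OF rhs_borel_measurable[OF assms(1-5)], of "\<lambda>_. M"])
    (use assms(6) in auto)

section \<open>Almost everywhere differentiation of indefinite integrals\<close>

lemma indefinite_integral_has_vector_derivative_ae:
  fixes g :: "real \<Rightarrow> 'b::euclidean_space"
  assumes "g integrable_on {a..b}"
  obtains N where "negligible N"
    "\<And>t. a < t \<Longrightarrow> t < b \<Longrightarrow> t \<notin> N \<Longrightarrow> ((\<lambda>t. integral {a..t} g) has_vector_derivative g t) (at t)"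
proof -
  \<comment> \<open>The differentiation theorem asks for integrability on every interval; extension
    by 0 provides it.\<close>
  define G where "G t = (if t \<in> {a..b} then g t else 0)" for t
  have GU: "G integrable_on UNIV"
    using assms unfolding G_def by (subst integrable_restrict_UNIV)
  then have GI: "G integrable_on cbox u v" for u v by (rule integrable_on_subcbox) auto
  \<comment> \<open>The theorem concerns averages over \<open>[x, x + h]\<close> and thus gives
    right derivatives only; applied to the reflection it gives the left ones.\<close>
  define Gm where "Gm = (\<lambda>t. G (- t))"
  have GmI: "Gm integrable_on cbox u v" for u v
    unfolding Gm_def using GI[of "-v" "-u"] Henstock_Kurzweil_Integration.integrable_reflect_real[where f = G and a = "-v" and b = "-u"]
    by simp
  obtain N1 where N1: "negligible N1" "\<And>x e. x \<notin> N1 \<Longrightarrow> 0 < e \<Longrightarrow>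
      \<exists>d>0. \<forall>h. 0 < h \<and> h < d \<longrightarrow> norm (integral (cbox x (x + h *\<^sub>R One)) G /\<^sub>R h ^ DIM(real) - G x) < e"
    using integrable_ccontinuous_explicit[of G] GI by blast
  obtain N2 where N2: "negligible N2" "\<And>x e. x \<notin> N2 \<Longrightarrow> 0 < e \<Longrightarrow>
      \<exists>d>0. \<forall>h. 0 < h \<and> h < d \<longrightarrow> norm (integral (cbox x (x + h *\<^sub>R One)) Gm /\<^sub>R h ^ DIM(real) - Gm x) < e"
    using integrable_ccontinuous_explicit[of Gm] GmI by blast
  define N where "N = N1 \<union> uminus ` N2"
  have "negligible (uminus ` N2)"
    using N2(1) by (intro negligible_differentiable_image_negligible) (auto intro!: derivative_intros simp: differentiable_on_def)
  then have "negligible N" using N1(1) by (simp add: N_def)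
  moreover have "((\<lambda>t. integral {a..t} g) has_vector_derivative g t) (at t)"
    if t: "a < t" "t < b" "t \<notin> N" for t
    unfolding has_vector_derivative_def has_derivative_at_alt
  proof (intro conjI allI impI bounded_linear_scaleR_left)
    fix e :: real assume "e > 0"
    have "t \<notin> N1" "-t \<notin> N2" using t unfolding N_def by (auto simp: image_iff)
    then obtain d1 d2 where d1: "d1 > 0" "\<And>h. 0 < h \<Longrightarrow> h < d1 \<Longrightarrow>
        norm (integral {t..t + h} G /\<^sub>R h - G t) < e"
      and d2: "d2 > 0" "\<And>h. 0 < h \<Longrightarrow> h < d2 \<Longrightarrow> norm (integral {-t..-t + h} Gm /\<^sub>R h - Gm (-t)) < e"
      using N1(2)[of t e] N2(2)[of "-t" e] \<open>e > 0\<close> by auto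
    have scale: "norm (I - h *\<^sub>R y) \<le> e * h" if "norm (I /\<^sub>R h - y) < e" "h > 0" for I y :: 'b and h
    proof -
      have "I - h *\<^sub>R y = h *\<^sub>R (I /\<^sub>R h - y)" using that by (simp add: algebra_simps)
      then have "norm (I - h *\<^sub>R y) = h * norm (I /\<^sub>R h - y)" using that by simp
      then show ?thesis using that by (simp add: mult.commute mult_left_mono)
    qed
    define d where "d = min (min d1 d2) (min (t - a) (b - t))"
    have d: "d > 0" "d \<le> d1" "d \<le> d2" "d \<le> t - a" "d \<le> b - t" using d1 d2 t by (auto simp: d_def)
    have sub: "g integrable_on {u..v}" if "a \<le> u" "v \<le> b" for u v
      by (rule integrable_on_subinterval[OF assms]) (use that in auto)
    have Gg: "integral {u..v} G = integral {u..v} g" if "a \<le> u" "v \<le> b" for u v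
      by (rule integral_cong) (use that in \<open>auto simp: G_def\<close>)
    show "\<exists>d>0. \<forall>s. norm (s - t) < d \<longrightarrow>
      norm (integral {a..s} g - integral {a..t} g - (s - t) *\<^sub>R g t) \<le> e * norm (s - t)"
    proof (intro exI[of _ d] conjI allI impI)
      fix s assume s: "norm (s - t) < d"
      consider "s = t" | "s > t" | "s < t" by linarith
      then show "norm (integral {a..s} g - integral {a..t} g - (s - t) *\<^sub>R g t) \<le> e * norm (s - t)"
      proof cases
        case 2
        have "integral {a..t} g + integral {t..s} g = integral {a..s} g"
          by (rule Henstock_Kurzweil_Integration.integral_combine) (use 2 s d t sub[of a s] in auto)
        then have "integral {a..s} g - integral {a..t} g = integral {t..s} g"
          by (metis add_diff_cancel_left')
        moreover have "norm (integral {t..t + (s - t)} G /\<^sub>R (s - t) - G t) < e"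
          by (rule d1(2)) (use 2 s d in auto)
        then have "norm (integral {t..t + (s - t)} G - (s - t) *\<^sub>R G t) \<le> e * (s - t)"
          by (rule scale) (use 2 in simp)
        moreover have "integral {t..t + (s - t)} G = integral {t..s} g"
          using Gg[of t s] 2 s d t by simp
        ultimately show ?thesis using 2 t by (simp add: G_def)
      next
        case 3
        have "integral {a..s} g + integral {s..t} g = integral {a..t} g"
          by (rule Henstock_Kurzweil_Integration.integral_combine) (use 3 s d t sub[of a t] in auto)
        moreover have "norm (integral {-t..-t + (t - s)} Gm /\<^sub>R (t - s) - Gm (-t)) < e"
          by (rule d2(2)) (use 3 s d in auto)
        then have "norm (integral {-t..-t + (t - s)} Gm - (t - s) *\<^sub>R Gm (-t)) \<le> e * (t - s)"
          by (rule scale) (use 3 in simp)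
        moreover have "integral {-t..-t + (t - s)} Gm = integral {s..t} g"
          using Gg[of s t] 3 s d t Henstock_Kurzweil_Integration.integral_reflect_real[where f = G and a = s and b = t] by (simp add: Gm_def)
        ultimately have "norm (integral {s..t} g - (t - s) *\<^sub>R g t) \<le> e * (t - s)"
          "integral {a..s} g - integral {a..t} g = - integral {s..t} g"
          using t by (simp_all add: G_def Gm_def algebra_simps)
        moreover have "- integral {s..t} g - (s - t) *\<^sub>R g t = - (integral {s..t} g - (t - s) *\<^sub>R g t)"
          by (simp add: algebra_simps)
        ultimately show ?thesis using 3 by (metis norm_minus_cancel real_norm_def abs_minus_commute abs_of_nonneg diff_ge_0_iff_ge less_imp_le)
      qed simp
    qed (use d in auto)
  qed
  ultimately show ?thesis using that by blast
qed

section \<open>Local solutions\<close>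

lemma indefinite_integral_lipschitz:
  fixes g :: "real \<Rightarrow> 'b::euclidean_space"
  assumes "g integrable_on {a..b}" "M \<ge> 0" "\<And>t. t \<in> {a..b} \<Longrightarrow> norm (g t) \<le> M"
  shows "M-lipschitz_on {a..b} (\<lambda>t. integral {a..t} g)"
proof (rule lipschitz_on_leI)
  fix u v assume uv: "u \<in> {a..b}" "v \<in> {a..b}" "u \<le> v"
  have av: "g integrable_on {a..v}" by (rule integrable_on_subinterval[OF assms(1)]) (use uv in auto)
  have "integral {a..u} g + integral {u..v} g = integral {a..v} g"
    by (rule Henstock_Kurzweil_Integration.integral_combine) (use uv av in auto)
  then have eq: "integral {a..v} g - integral {a..u} g = integral {u..v} g"
    by (metis add_diff_cancel_left')
  have "g integrable_on {u..v}" by (rule integrable_on_subinterval[OF assms(1)]) (use uv in auto)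
  then have "(g has_integral integral {u..v} g) (cbox u v)" by (simp add: has_integral_integral[symmetric])
  then have "norm (integral {u..v} g) \<le> M * measure lborel (cbox u v)"
    by (rule has_integral_bound[OF assms(2)]) (use assms(3) uv in auto)
  moreover have "dist (integral {a..u} g) (integral {a..v} g) = norm (integral {u..v} g)"
    by (metis dist_commute dist_norm eq)
  ultimately show "dist (integral {a..u} g) (integral {a..v} g) \<le> M * dist u v"
    using uv by (simp add: dist_real_def)
qed fact

text \<open>
  Approximate solutions with the right-hand side delayed by \<open>\<delta>\<close>: iterating the integral operator
  \<open>m\<close> times determines such a function up to time \<open>t0 + m \<delta>\<close>.
\<close>

lemma delayed_solution:
  fixes f :: "('n::finite, 'l::finite) rhs"
  assumes r: "r > 0" and f3: "hyp3 r f D" and t0: "0 \<le> t0" and x0: "x0 \<in> hist_space r"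
    and d: "d \<in> disturbances D" and M: "M \<ge> 0" "t0 \<le> e" "M * (e - t0) \<le> 1"
    and bound: "\<And>s \<psi>. s \<in> {t0..e} \<Longrightarrow> \<psi> \<in> hist_space r \<Longrightarrow> norm \<psi> \<le> norm x0 + 1 \<Longrightarrow> norm (f s \<psi> (d s)) \<le> M"
    and \<delta>: "\<delta> > 0"
  shows "\<exists>x. continuous_on UNIV x \<and> (\<forall>t\<le>t0. x t = apply_bcontfun x0 (t - t0)) \<and>
    (\<forall>t. norm (x t) \<le> norm x0 + 1) \<and> M-lipschitz_on {t0..e} x \<and>
    (\<forall>t\<in>{t0..e}. (\<lambda>s. f s (hist r (s - \<delta>) x) (d s)) integrable_on {t0..t} \<and>
       x t = x0 0 + integral {t0..t} (\<lambda>s. f s (hist r (s - \<delta>) x) (d s)))"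
proof -
  define P where "P x \<longleftrightarrow> continuous_on UNIV x \<and> (\<forall>t\<le>t0. x t = apply_bcontfun x0 (t - t0)) \<and>
    (\<forall>t. norm (x t) \<le> norm x0 + 1) \<and> M-lipschitz_on {t0..e} x" for x
  define g where "g x = (\<lambda>s. f s (hist r (s - \<delta>) x) (d s))" for x
  \<comment> \<open>Freezing the value after \<open>e\<close> keeps the iterates continuous on the
    whole line, so that every history of them is meaningful.\<close>
  define \<Phi> where "\<Phi> x t = (if t \<le> t0 then apply_bcontfun x0 (t - t0) else x0 0 + integral {t0..min t e} (g x))" for x t
  have hist1: "hist r s x \<in> hist_space r" "norm (hist r s x) \<le> norm x0 + 1" if "P x" for s x
    using that r unfolding P_def
    by (auto intro!: hist_in_hist_space norm_hist_le intro: continuous_on_subset)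
  have g_bound: "norm (g x s) \<le> M" if "P x" "s \<in> {t0..e}" for x s
    unfolding g_def using hist1[OF that(1)] that(2) by (intro bound) auto
  have g_int: "g x integrable_on {t0..e}" if "P x" for x
  proof -
    have "continuous_on {t0 - \<delta> - r..e - \<delta>} x"
      using that unfolding P_def by (auto intro: continuous_on_subset)
    then have "continuous_on {t0 - \<delta>..e - \<delta>} (\<lambda>s. hist r s x)"
      using r by (intro continuous_on_hist) auto
    then have "continuous_on {t0..e} (\<lambda>s. hist r (s - \<delta>) x)"
      by (rule continuous_on_compose2) (auto intro!: continuous_intros)
    then show ?thesis
      using g_bound[OF that] hist1[OF that] unfolding g_def
      by (intro rhs_integrable[OF f3 d t0]) auto
  qed
  have \<Phi>_eq: "\<Phi> x t = x0 0 + integral {t0..min t e} (g x)" if "t0 \<le> t" for x t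
    using that by (cases "t = t0") (auto simp: \<Phi>_def min_def)
  have \<Phi>_P: "P (\<Phi> x)" if "P x" for x
  proof -
    have lip: "M-lipschitz_on {t0..e} (\<lambda>t. integral {t0..t} (g x))"
      using g_bound[OF that] M by (intro indefinite_integral_lipschitz g_int[OF that]) auto
    have "M-lipschitz_on {t0..e} (\<Phi> x)"
      by (rule lipschitz_on_transform[where f = "\<lambda>t. x0 0 + integral {t0..t} (g x)"])
        (use lip in \<open>auto simp: \<Phi>_eq lipschitz_on_def\<close>)
    moreover have "continuous_on UNIV (\<Phi> x)"
    proof -
      have "continuous_on {t0..} (\<lambda>t. integral {t0..min t e} (g x))"
        by (rule continuous_on_compose2[OF lipschitz_on_continuous_on[OF lip]])
          (use M in \<open>auto intro!: continuous_intros\<close>)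
      then have "continuous_on {t0..} (\<Phi> x)"
        by (subst continuous_on_cong[OF refl \<Phi>_eq]) (auto intro!: continuous_intros)
      moreover have "continuous_on {..t0} (\<lambda>t. apply_bcontfun x0 (t - t0))"
        by (rule continuous_on_compose2[OF continuous_on_apply_bcontfun[of UNIV x0]])
          (auto intro!: continuous_intros)
      then have "continuous_on {..t0} (\<Phi> x)" by (rule continuous_on_eq) (auto simp: \<Phi>_def)
      moreover have "{..t0} \<union> {t0..} = UNIV" by auto
      ultimately show ?thesis using continuous_on_closed_Un[of "{..t0}" "{t0..}" "\<Phi> x"] by simp
    qed
    moreover have "norm (\<Phi> x t) \<le> norm x0 + 1" for t
    proof (cases "t \<le> t0")
      case True
      then show ?thesis using norm_bounded[of x0 "t - t0"] by (simp add: \<Phi>_def)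
    next
      case False
      have "norm (integral {t0..min t e} (g x)) \<le> M * (min t e - t0)"
        using lipschitz_onD[OF lip, of "min t e" t0] False M by (simp add: dist_norm)
      also have "\<dots> \<le> M * (e - t0)" using M by (intro mult_left_mono) auto
      \<comment> \<open>This is where \<open>M * (e - t0) \<le> 1\<close> enters: the iterate stays
        within the radius \<open>norm x0 + 1\<close> on which \<open>M\<close> bounds the right-hand
        side.\<close>
      finally have "norm (integral {t0..min t e} (g x)) \<le> 1" using M by simp
      then show ?thesis
        using norm_bounded[of x0 0] norm_triangle_ineq[of "x0 0" "integral {t0..min t e} (g x)"] False
        by (simp add: \<Phi>_def)
    qed
    ultimately show ?thesis by (simp add: P_def \<Phi>_def)
  qed
  have "\<exists>x. P x \<and> (\<forall>t\<in>{t0..min e (t0 + real m * \<delta>)}. x t = x0 0 + integral {t0..t} (g x))" for m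
  proof (induction m)
    case 0
    define y where "y t = apply_bcontfun x0 (min t t0 - t0)" for t
    have "P y" unfolding P_def y_def
    proof (intro conjI allI impI)
      show "continuous_on UNIV (\<lambda>t. x0 (min t t0 - t0))"
        by (rule continuous_on_compose2[OF continuous_on_apply_bcontfun[of UNIV x0]])
          (auto intro!: continuous_intros)
      show "norm (x0 (min t t0 - t0)) \<le> norm x0 + 1" for t
        using norm_bounded[of x0 "min t t0 - t0"] by simp
      show "M-lipschitz_on {t0..e} (\<lambda>t. x0 (min t t0 - t0))"
        using M by (intro lipschitz_onI) auto
    qed auto
    moreover have "y t = x0 0 + integral {t0..t} (g y)" if "t \<in> {t0..min e (t0 + real 0 * \<delta>)}" for t
    proof -
      have "t = t0" using that by auto
      then show ?thesis by (simp add: y_def[of t0])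
    qed
    ultimately show ?case by blast
  next
    case (Suc m)
    then obtain x where x: "P x"
      "\<And>t. t0 \<le> t \<Longrightarrow> t \<le> e \<Longrightarrow> t \<le> t0 + real m * \<delta> \<Longrightarrow> x t = x0 0 + integral {t0..t} (g x)"
      by auto
    have same: "\<Phi> x t = x t" if "t \<le> e" "t \<le> t0 + real m * \<delta>" for t
      using x(2)[of t] x(1) that by (cases "t \<le> t0") (auto simp: P_def \<Phi>_def min_absorb1)
    have "\<Phi> x t = x0 0 + integral {t0..t} (g (\<Phi> x))"
      if t: "t0 \<le> t" "t \<le> e" "t \<le> t0 + real (Suc m) * \<delta>" for t
    proof -
      have "integral {t0..t} (g (\<Phi> x)) = integral {t0..t} (g x)"
      proof (rule integral_cong)
        fix s assume "s \<in> {t0..t}"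
        \<comment> \<open>For \<open>s \<le> t0 + (m + 1) * \<delta>\<close> the delayed history
          looks no later than \<open>t0 + m * \<delta>\<close>, where \<open>\<Phi> x\<close> and
          \<open>x\<close> coincide.\<close>
        then have "hist r (s - \<delta>) (\<Phi> x) = hist r (s - \<delta>) x"
          using r t \<delta> by (intro hist_cong same) (auto simp: algebra_simps)
        then show "g (\<Phi> x) s = g x s" by (simp add: g_def)
      qed
      then show ?thesis using t by (simp add: \<Phi>_eq min_absorb1)
    qed
    with \<Phi>_P[OF x(1)] show ?case by (intro exI[of _ "\<Phi> x"]) auto
  qed
  moreover obtain m where "e - t0 \<le> real m * \<delta>"
    using reals_Archimedean3[OF \<delta>] less_imp_le by blast
  ultimately obtain x where x: "P x" "\<forall>t\<in>{t0..e}. x t = x0 0 + integral {t0..t} (g x)"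
    by (metis add.commute diff_le_eq min_absorb1)
  moreover have "g x integrable_on {t0..t}" if "t \<in> {t0..e}" for t
    by (rule integrable_on_subinterval[OF g_int[OF x(1)]]) (use that in auto)
  ultimately show ?thesis unfolding P_def g_def by blast
qed

text \<open>All delayed solutions share one bound and one Lipschitz constant, whatever the delay;
  this is the compactness needed. The Lipschitz constant of the limit is part of the conclusion
  because the continuation argument glues this solution to an earlier one.\<close>

lemma local_solution:
  fixes f :: "('n::finite, 'l::finite) rhs"
  assumes r: "r > 0" and f1: "hyp1 r f D" and f2: "hyp2 r f D" and f3: "hyp3 r f D"
    and t0: "0 \<le> t0" and x0: "x0 \<in> hist_space r" and d: "d \<in> disturbances D"
  obtains e x L where "t0 < e" "is_solution r f t0 x0 d x (ereal e)" "L-lipschitz_on {t0..e} x"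
proof -
  have dD: "d t \<in> D" if "t \<ge> 0" for t using d that by (auto simp: disturbances_def)
  let ?S = "{\<psi> \<in> hist_space r. norm \<psi> \<le> norm x0 + 1}"
  let ?\<Omega> = "{t0..t0 + 1} \<times> ?S"
  have "bounded ?\<Omega>"
    by (intro bounded_Times bounded_closed_interval) (auto simp: bounded_iff)
  moreover have "?\<Omega> \<subseteq> {0..} \<times> hist_space r" using t0 by auto
  ultimately have "bounded ((\<lambda>((t, x), d). f t x d) ` (?\<Omega> \<times> D))"
    using f2 unfolding hyp2_def by blast
  then obtain M where M: "M > 0" "\<And>t \<psi> u. t \<in> {t0..t0 + 1} \<Longrightarrow> \<psi> \<in> ?S \<Longrightarrow> u \<in> D \<Longrightarrow> norm (f t \<psi> u) \<le> M"
    unfolding bounded_pos by fastforce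
  \<comment> \<open>The length is at most 1, so that \<open>M\<close> is a valid bound, and at most
    \<open>1 / M\<close>, so that solutions move by at most 1.\<close>
  define e where "e = t0 + min 1 (1 / M)"
  have e: "t0 < e" "e \<le> t0 + 1" "M * (e - t0) \<le> 1"
    using M(1) mult_left_mono[of "min 1 (1 / M)" "1 / M" M] by (auto simp: e_def)
  have bound: "norm (f s \<psi> (d s)) \<le> M"
    if "s \<in> {t0..e}" "\<psi> \<in> hist_space r" "norm \<psi> \<le> norm x0 + 1" for s \<psi>
    using that e t0 by (intro M(2) dD) auto
  let ?\<delta> = "\<lambda>k. inverse (real (Suc k))"
  define Q where "Q k x \<longleftrightarrow> continuous_on UNIV x \<and> (\<forall>t\<le>t0. x t = apply_bcontfun x0 (t - t0)) \<and>
    (\<forall>t. norm (x t) \<le> norm x0 + 1) \<and> M-lipschitz_on {t0..e} x \<and>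
    (\<forall>t\<in>{t0..e}. (\<lambda>s. f s (hist r (s - ?\<delta> k) x) (d s)) integrable_on {t0..t} \<and>
       x t = x0 0 + integral {t0..t} (\<lambda>s. f s (hist r (s - ?\<delta> k) x) (d s)))" for k x
  have "\<exists>x. Q k x" for k
    unfolding Q_def by (rule delayed_solution[OF r f3 t0 x0 d _ _ e(3) bound]) (use M e in auto)
  then obtain X where XQ: "Q k (X k)" for k by metis
  have X: "continuous_on UNIV (X k)" "t \<le> t0 \<Longrightarrow> X k t = apply_bcontfun x0 (t - t0)"
    "norm (X k t) \<le> norm x0 + 1" "M-lipschitz_on {t0..e} (X k)"
    "t \<in> {t0..e} \<Longrightarrow> (\<lambda>s. f s (hist r (s - ?\<delta> k) (X k)) (d s)) integrable_on {t0..t}"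
    "t \<in> {t0..e} \<Longrightarrow> X k t = x0 0 + integral {t0..t} (\<lambda>s. f s (hist r (s - ?\<delta> k) (X k)) (d s))" for k t
    using XQ[of k] unfolding Q_def by blast+
  obtain y \<kappa> where y: "continuous_on {t0..e} y" "strict_mono (\<kappa> :: nat \<Rightarrow> nat)"
    "\<And>\<epsilon>. 0 < \<epsilon> \<Longrightarrow> \<exists>N. \<forall>n t. n \<ge> N \<and> t \<in> {t0..e} \<longrightarrow> norm (X (\<kappa> n) t - y t) < \<epsilon>"
  proof (rule Arzela_Ascoli[of "{t0..e}" X "norm x0 + 1"])
    fix t \<epsilon> :: real assume t: "t \<in> {t0..e}" "0 < \<epsilon>"
    show "\<exists>d>0. \<forall>n s. s \<in> {t0..e} \<and> norm (t - s) < d \<longrightarrow> norm (X n t - X n s) < \<epsilon>"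
    proof (intro exI[of _ "\<epsilon> / M"] conjI allI impI)
      fix n s assume s: "s \<in> {t0..e} \<and> norm (t - s) < \<epsilon> / M"
      have "norm (X n t - X n s) \<le> M * norm (t - s)"
        using lipschitz_onD[OF X(4)[of n], of t s] t s by (simp add: dist_norm)
      also have "\<dots> < \<epsilon>" using s M(1) by (simp add: pos_less_divide_eq mult.commute)
      finally show "norm (X n t - X n s) < \<epsilon>" .
    qed (use t M in auto)
  next
    fix g :: "real \<Rightarrow> real ^ 'n" and k :: "nat \<Rightarrow> nat"
    assume "continuous_on {t0..e} g" "strict_mono k"
      "\<And>\<epsilon>. 0 < \<epsilon> \<Longrightarrow> \<exists>N. \<forall>n t. n \<ge> N \<and> t \<in> {t0..e} \<longrightarrow> norm (X (k n) t - g t) < \<epsilon>"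
    then show thesis by (rule that)
  qed (use X(3) in auto)
  define x where "x t = (if t \<le> t0 then apply_bcontfun x0 (t - t0) else y (min t e))" for t
  have lim: "(\<lambda>k. X (\<kappa> k) t) \<longlonglongrightarrow> y t" if "t \<in> {t0..e}" for t
    unfolding LIMSEQ_iff using y(3) that by blast
  have "X (\<kappa> k) t0 = x0 0" for k using X(2)[of t0 "\<kappa> k"] by simp
  then have yt0: "y t0 = x0 0"
    using lim[of t0] e(1) LIMSEQ_unique[OF _ tendsto_const] by simp
  have xy: "x t = y t" if "t \<in> {t0..e}" for t
    using that yt0 by (cases "t = t0") (auto simp: x_def)
  have xc: "continuous_on UNIV x"
  proof -
    have "continuous_on {t0..} (\<lambda>t. y (min t e))"
      by (rule continuous_on_compose2[OF y(1)]) (use e in \<open>auto intro!: continuous_intros\<close>)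
    then have "continuous_on {t0..} x"
      by (rule continuous_on_eq) (use yt0 e in \<open>auto simp: x_def\<close>)
    moreover have "continuous_on {..t0} (\<lambda>t. apply_bcontfun x0 (t - t0))"
      by (rule continuous_on_compose2[OF continuous_on_apply_bcontfun[of UNIV x0]])
        (auto intro!: continuous_intros)
    then have "continuous_on {..t0} x" by (rule continuous_on_eq) (auto simp: x_def)
    moreover have "{..t0} \<union> {t0..} = UNIV" by auto
    ultimately show ?thesis using continuous_on_closed_Un[of "{..t0}" "{t0..}" x] by simp
  qed
  have xlip: "M-lipschitz_on {t0..e} x"
  proof (rule lipschitz_onI)
    fix s t assume st: "s \<in> {t0..e}" "t \<in> {t0..e}"
    have "(\<lambda>k. dist (X (\<kappa> k) s) (X (\<kappa> k) t)) \<longlonglongrightarrow> dist (y s) (y t)"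
      by (intro tendsto_intros lim st)
    then have "dist (y s) (y t) \<le> M * dist s t"
      by (rule LIMSEQ_le_const2) (use lipschitz_onD[OF X(4) st] in blast)
    then show "dist (x s) (x t) \<le> M * dist s t" using xy[OF st(1)] xy[OF st(2)] by simp
  qed (use M in simp)
  have hist_lim: "(\<lambda>k. hist r (s - ?\<delta> (\<kappa> k)) (X (\<kappa> k))) \<longlonglongrightarrow> hist r s x" if s: "s \<in> {t0..e}" for s
  proof (rule metric_LIMSEQ_I)
    fix \<epsilon> :: real assume "\<epsilon> > 0"
    \<comment> \<open>The delays are at most 1, hence the left end \<open>t0 - r - 1\<close>. A
      quarter of \<epsilon> pays for the time shift, another for the uniform convergence.\<close>
    have "uniformly_continuous_on {t0 - r - 1..e} x"
      using xc by (intro compact_uniformly_continuous) (auto intro: continuous_on_subset)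
    then obtain \<eta> where \<eta>: "\<eta> > 0"
      "\<And>u v. u \<in> {t0 - r - 1..e} \<Longrightarrow> v \<in> {t0 - r - 1..e} \<Longrightarrow> dist v u < \<eta> \<Longrightarrow> dist (x v) (x u) < \<epsilon> / 4"
      unfolding uniformly_continuous_on_def using \<open>\<epsilon> > 0\<close>
      by (metis zero_less_divide_iff zero_less_numeral)
    obtain N1 where N1: "\<And>n t. n \<ge> N1 \<Longrightarrow> t \<in> {t0..e} \<Longrightarrow> norm (X (\<kappa> n) t - y t) < \<epsilon> / 4"
      using y(3)[of "\<epsilon> / 4"] \<open>\<epsilon> > 0\<close> by auto
    obtain N2 where N2: "inverse (real (Suc N2)) < \<eta>" using reals_Archimedean[OF \<eta>(1)] by blast
    show "\<exists>N. \<forall>n\<ge>N. dist (hist r (s - ?\<delta> (\<kappa> n)) (X (\<kappa> n))) (hist r s x) < \<epsilon>"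
    proof (intro exI[of _ "max N1 N2"] allI impI)
      fix n assume n: "n \<ge> max N1 N2"
      have "N2 \<le> \<kappa> n" using n seq_suble[OF y(2), of n] by simp
      then have "?\<delta> (\<kappa> n) \<le> ?\<delta> N2" by (intro le_imp_inverse_le) auto
      then have \<delta>n: "?\<delta> (\<kappa> n) < \<eta>" using N2 by (rule le_less_trans)
      have "0 < ?\<delta> (\<kappa> n)" "?\<delta> (\<kappa> n) \<le> 1" by (auto simp: inverse_le_1_iff)
      note \<delta>n = \<delta>n this
      define w where "w = ?\<delta> (\<kappa> n)"
      note \<delta>n = \<delta>n[folded w_def]
      have close: "dist (X (\<kappa> n) t) (x t) \<le> \<epsilon> / 4" if "t \<le> e" for t
        using N1[of n t] n that X(2)[of t "\<kappa> n"] xy[of t] \<open>\<epsilon> > 0\<close>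
        by (cases "t \<le> t0") (auto simp: dist_norm x_def)
      have "dist (hist r (s - w) (X (\<kappa> n))) (hist r s x) \<le> \<epsilon> / 2"
      proof (rule dist_hist_le)
        fix \<theta> assume \<theta>: "-r \<le> \<theta>" "\<theta> \<le> 0"
        have "dist (x (s - w + \<theta>)) (x (s + \<theta>)) < \<epsilon> / 4"
          by (rule \<eta>(2)) (use \<theta> s \<delta>n in \<open>auto simp: dist_real_def\<close>)
        moreover have "dist (X (\<kappa> n) (s - w + \<theta>)) (x (s - w + \<theta>)) \<le> \<epsilon> / 4"
          by (rule close) (use \<theta> s \<delta>n in auto)
        ultimately show "dist (X (\<kappa> n) (s - w + \<theta>)) (x (s + \<theta>)) \<le> \<epsilon> / 2"
          using dist_triangle[of "X (\<kappa> n) (s - w + \<theta>)" "x (s + \<theta>)" "x (s - w + \<theta>)"] by linarith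
      qed (use r in \<open>auto intro: continuous_on_subset[OF X(1)] continuous_on_subset[OF xc]\<close>)
      then show "dist (hist r (s - ?\<delta> (\<kappa> n)) (X (\<kappa> n))) (hist r s x) < \<epsilon>"
        using \<open>\<epsilon> > 0\<close> by (simp add: w_def)
    qed
  qed
  have hX: "hist r s (X k) \<in> hist_space r" "norm (hist r s (X k)) \<le> norm x0 + 1" for s k
    using r X(1,3) by (auto intro!: hist_in_hist_space norm_hist_le intro: continuous_on_subset)
  have hx: "hist r s x \<in> hist_space r" for s
    using r by (intro hist_in_hist_space continuous_on_subset[OF xc]) auto
  define g where "g s = f s (hist r s x) (d s)" for s
  have f_lim: "(\<lambda>k. f s (hist r (s - ?\<delta> (\<kappa> k)) (X (\<kappa> k))) (d s)) \<longlonglongrightarrow> g s" if s: "s \<in> {t0..e}" for s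
  proof -
    have s0: "s \<ge> 0" using s t0 by simp
    \<comment> \<open>Continuity in state and disturbance holds at each fixed time, including the
      exceptional times of \<open>hyp3\<close>, so the integrands converge at every
      \<open>s\<close>.\<close>
    have "continuous_on (hist_space r \<times> D) (\<lambda>(\<psi>, u). f s \<psi> u)"
      using f1 s0 unfolding hyp1_def by blast
    then have "continuous_on (hist_space r) (\<lambda>\<psi>. case (\<psi>, d s) of (\<psi>, u) \<Rightarrow> f s \<psi> u)"
      by (rule continuous_on_compose2) (use dD[OF s0] in \<open>auto intro!: continuous_intros\<close>)
    from continuous_on_tendsto_compose[OF this hist_lim[OF s] hx] show ?thesis
      using hX(1) by (simp add: g_def)
  qed
  have int: "g integrable_on {t0..t} \<and> y t = x0 0 + integral {t0..t} g" if t: "t \<in> {t0..e}" for t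
  proof -
    let ?F = "\<lambda>k s. f s (hist r (s - ?\<delta> (\<kappa> k)) (X (\<kappa> k))) (d s)"
    have "g integrable_on {t0..t}" and I: "(\<lambda>k. integral {t0..t} (?F k)) \<longlonglongrightarrow> integral {t0..t} g"
    proof -
      have 1: "?F k integrable_on {t0..t}" for k using X(5)[OF t] by simp
      have 2: "(\<lambda>s. M) integrable_on {t0..t}" by (rule integrable_const_ivl)
      have 3: "norm (?F k s) \<le> M" if "s \<in> {t0..t}" for k s
        using that t hX by (intro bound) auto
      have 4: "(\<lambda>k. ?F k s) \<longlonglongrightarrow> g s" if "s \<in> {t0..t}" for s
        using that t by (intro f_lim) auto
      show "g integrable_on {t0..t}" "(\<lambda>k. integral {t0..t} (?F k)) \<longlonglongrightarrow> integral {t0..t} g"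
        using dominated_convergence[OF 1 2 3 4] by auto
    qed
    moreover have "(\<lambda>k. X (\<kappa> k) t) \<longlonglongrightarrow> x0 0 + integral {t0..t} g"
      unfolding X(6)[OF t] by (intro tendsto_intros I)
    ultimately show ?thesis using LIMSEQ_unique[OF lim[OF t]] by blast
  qed
  obtain N where N: "negligible N"
    "\<And>t. t0 < t \<Longrightarrow> t < e \<Longrightarrow> t \<notin> N \<Longrightarrow> ((\<lambda>t. integral {t0..t} g) has_vector_derivative g t) (at t)"
    using indefinite_integral_has_vector_derivative_ae[of g t0 e] int[of e] e by auto
  have der: "(x has_vector_derivative g t) (at t)" if "t0 < t" "t < e" "t \<notin> N" for t
  proof -
    have "((\<lambda>t. x0 0 + integral {t0..t} g) has_vector_derivative g t) (at t)"
      using has_vector_derivative_add[OF has_vector_derivative_const N(2)[OF that]] by simp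
    then show ?thesis
      by (rule has_vector_derivative_transform_within_open[of _ _ _ "{t0<..<e}"])
        (use that int xy in auto)
  qed
  \<comment> \<open>The derivative in \<open>is_solution\<close> is two-sided and may fail at
    \<open>t0\<close>, where the initial history need not be differentiable; one more null point
    absorbs this.\<close>
  have "N \<union> {t0} \<in> null_sets lebesgue"
    using N(1) by (simp add: negligible_iff_null_sets[symmetric])
  then have "AE t in lebesgue. t \<notin> N \<union> {t0}" by (rule AE_not_in)
  then have "AE t in lebesgue. t0 \<le> t \<and> ereal t < ereal e \<longrightarrow>
      (x has_vector_derivative f t (hist r t x) (d t)) (at t)"
    by (rule AE_mp) (use der in \<open>auto intro!: AE_I2 simp: g_def\<close>)
  moreover have "hist r t0 x = x0"
  proof (rule hist_space_eqI[OF hx x0])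
    fix \<theta> assume "\<theta> \<in> {-r..0}"
    then have "hist r t0 x \<theta> = x (t0 + \<theta>)"
      using r by (intro apply_hist continuous_on_subset[OF xc]) auto
    then show "hist r t0 x \<theta> = x0 \<theta>" using \<open>\<theta> \<in> {-r..0}\<close> by (simp add: x_def)
  qed (use r in simp)
  moreover have "abs_continuous_on t0 b x" if "b < e" for b
    by (rule abs_continuous_on_lipschitz[OF lipschitz_on_subset[OF xlip]]) (use that in auto)
  ultimately have "is_solution r f t0 x0 d x (ereal e)"
    unfolding is_solution_def using e by (auto intro: continuous_on_subset[OF xc])
  with e(1) xlip show ?thesis using that by blast
qed

section \<open>Maximal solutions\<close>

text \<open>The derivative looks slightly ahead of \<open>t\<close> and the history back to
  \<open>t - r\<close>, hence agreement on \<open>[t0 - r, q)\<close> with \<open>t < q\<close>. The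
  continuation argument takes the restart time as \<open>t0\<close>.\<close>

lemma solution_derivative_cong:
  assumes "r > 0" "t0 \<le> t" "t < q" "\<And>s. t0 - r \<le> s \<Longrightarrow> s < q \<Longrightarrow> z s = y s"
    and "(y has_vector_derivative f t (hist r t y) u) (at t)"
  shows "(z has_vector_derivative f t (hist r t z) u) (at t)"
proof -
  have "hist r t z = hist r t y" using assms(1-4) by (intro hist_cong) auto
  moreover have "(z has_vector_derivative f t (hist r t y) u) (at t)"
    by (rule has_vector_derivative_transform_within_open[OF assms(5), of "{t0 - r<..<q}"])
      (use assms(1-4) in auto)
  ultimately show ?thesis by simp
qed

text \<open>Continuity and absolute continuity are tested below the supremum, hence inside a single
  member. The almost everywhere equation is not: the exceptional sets of all members together may
  fail to be null.\<close>

lemma solution_glue: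
  fixes f :: "('n::finite, 'l::finite) rhs"
  assumes r: "r > 0" and ne: "\<C> \<noteq> {}"
    and sol: "\<And>X. X \<in> \<C> \<Longrightarrow> is_solution r f t0 x0 d (y X) (\<tau> X)"
    and eq: "\<And>X t. X \<in> \<C> \<Longrightarrow> t0 - r \<le> t \<Longrightarrow> ereal t < \<tau> X \<Longrightarrow> z t = y X t"
  shows "is_solution r f t0 x0 d z (SUP X\<in>\<C>. \<tau> X)"
proof -
  let ?T = "SUP X\<in>\<C>. \<tau> X"
  have ex: "\<exists>X\<in>\<C>. ereal t < \<tau> X" if "ereal t < ?T" for t
    using that by (simp add: less_SUP_iff)
  obtain X0 where X0: "X0 \<in> \<C>" using ne by blast
  have t0: "ereal t0 < \<tau> X" if "X \<in> \<C>" for X using sol[OF that] by (simp add: is_solution_def)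
  have "ereal t0 < ?T" using t0[OF X0] X0 by (auto simp: less_SUP_iff)
  moreover have "continuous_on {t. t0 - r \<le> t \<and> ereal t < ?T} z"
    unfolding continuous_on_eq_continuous_within
  proof
    fix t assume t: "t \<in> {t. t0 - r \<le> t \<and> ereal t < ?T}"
    then obtain X where X: "X \<in> \<C>" "ereal t < \<tau> X" using ex by blast
    then obtain b where b: "t < b" "ereal b < \<tau> X" using ereal_dense2 by (metis less_ereal.simps(1))
    let ?S = "{t. t0 - r \<le> t \<and> ereal t < \<tau> X}"
    have "continuous_on ?S (y X)" using sol[OF X(1)] by (simp add: is_solution_def)
    then have "continuous_on ?S z" by (rule continuous_on_eq) (use eq[OF X(1)] in auto)
    then have "continuous (at t within ?S) z"
      using t X by (auto simp: continuous_on_eq_continuous_within)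
    moreover have "at t within ?S = at t within {t. t0 - r \<le> t \<and> ereal t < ?T}"
    proof (rule at_within_nhd[of t "{..<b}"])
      have le: "\<tau> X \<le> ?T" by (rule SUP_upper[OF X(1)])
      have "ereal s < \<tau> X" "ereal s < ?T" if "s < b" for s
      proof -
        show "ereal s < \<tau> X" using that b(2) by (meson less_ereal.simps(1) less_trans)
        then show "ereal s < ?T" using le by (rule less_le_trans)
      qed
      then show "?S \<inter> {..<b} - {t} = {t. t0 - r \<le> t \<and> ereal t < ?T} \<inter> {..<b} - {t}" by auto
    qed (use b in auto)
    ultimately show "continuous (at t within {t. t0 - r \<le> t \<and> ereal t < ?T}) z" by simp
  qed
  moreover have "abs_continuous_on t0 b z" if "b \<ge> t0" "ereal b < ?T" for b
  proof -
    obtain X where X: "X \<in> \<C>" "ereal b < \<tau> X" using ex \<open>ereal b < ?T\<close> by blast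
    then have "abs_continuous_on t0 b (y X)" using sol[OF X(1)] that(1) by (simp add: is_solution_def)
    moreover have "z t = y X t" if "t0 \<le> t" "t \<le> b" for t
    proof (rule eq[OF X(1)])
      have "ereal t \<le> ereal b" using that by simp
      then show "ereal t < \<tau> X" using X(2) by (rule le_less_trans)
    qed (use that r in auto)
    ultimately show ?thesis by (metis abs_continuous_on_cong)
  qed
  moreover have "hist r t0 z = x0"
  proof -
    have "z t = y X0 t" if "t0 - r \<le> t" "t \<le> t0" for t
    proof (rule eq[OF X0])
      have "ereal t \<le> ereal t0" using that by simp
      then show "ereal t < \<tau> X0" using t0[OF X0] by (rule le_less_trans)
    qed (use that r in auto)
    then have "hist r t0 z = hist r t0 (y X0)" using r by (intro hist_cong) auto
    then show ?thesis using sol[OF X0] by (simp add: is_solution_def)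
  qed
  moreover have "AE t in lebesgue. t0 \<le> t \<and> ereal t < ?T \<longrightarrow>
      (z has_vector_derivative f t (hist r t z) (d t)) (at t)"
  proof -
    \<comment> \<open>Each rational below the supremum gets one member that lives beyond it, so
      countably many exceptional sets cover all times.\<close>
    let ?Q = "{q::rat. ereal (of_rat q) < ?T}"
    have "\<forall>q\<in>?Q. \<exists>X\<in>\<C>. ereal (of_rat q) < \<tau> X" using ex by blast
    then obtain X where X: "\<And>q. q \<in> ?Q \<Longrightarrow> X q \<in> \<C>" "\<And>q. q \<in> ?Q \<Longrightarrow> ereal (of_rat q) < \<tau> (X q)"
      by metis
    have "AE t in lebesgue. \<forall>q\<in>?Q. t0 \<le> t \<and> ereal t < \<tau> (X q) \<longrightarrow>
        (y (X q) has_vector_derivative f t (hist r t (y (X q))) (d t)) (at t)"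
      by (subst AE_ball_countable) (use sol[OF X(1)] in \<open>auto simp: is_solution_def intro: countableI_type\<close>)
    then show ?thesis
    proof (rule AE_mp, intro AE_I2 impI)
      fix t assume *: "\<forall>q\<in>?Q. t0 \<le> t \<and> ereal t < \<tau> (X q) \<longrightarrow>
        (y (X q) has_vector_derivative f t (hist r t (y (X q))) (d t)) (at t)"
        and t: "t0 \<le> t \<and> ereal t < ?T"
      then obtain b where b: "t < b" "ereal b < ?T" using ereal_dense2 by (metis less_ereal.simps(1))
      obtain q where q: "t < of_rat q" "of_rat q < b" using of_rat_dense[OF b(1)] by blast
      have "ereal (of_rat q) < ereal b" using q by simp
      then have qQ: "q \<in> ?Q" using less_trans[OF _ b(2)] by blast
      have lt: "ereal s < \<tau> (X q)" if "s < of_rat q" for s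
        using that X(2)[OF qQ] by (meson less_ereal.simps(1) less_trans)
      show "(z has_vector_derivative f t (hist r t z) (d t)) (at t)"
        by (rule solution_derivative_cong[OF r _ q(1), of t0 _ "y (X q)"])
          (use * t lt qQ q eq[OF X(1)[OF qQ]] in auto)
    qed
  qed
  ultimately show ?thesis unfolding is_solution_def by blast
qed

lemma maximal_solution_exists:
  fixes f :: "('n::finite, 'l::finite) rhs"
  assumes r: "r > 0" and "is_solution r f t0 x0 d x tm"
  shows "\<exists>y tm'. is_maximal_solution r f t0 x0 d y tm'"
proof -
  \<comment> \<open>Graphs cut down to the domain ignore the irrelevant values of the total
    function, and their inclusion is extension of solutions, the order to which Zorn's lemma is
    applied.\<close>
  define graph where "graph y tm = {(t, y t) | t. t0 - r \<le> t \<and> ereal t < tm}"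
    for y :: "real \<Rightarrow> real ^ 'n" and tm
  define \<A> where "\<A> = {graph y tm | y tm. is_solution r f t0 x0 d y tm}"
  have "\<exists>M\<in>\<A>. \<forall>X\<in>\<A>. M \<subseteq> X \<longrightarrow> X = M"
  proof (rule subset_Zorn_nonempty)
    show "\<A> \<noteq> {}" using assms(2) by (auto simp: \<A>_def)
    fix \<C> assume ne: "\<C> \<noteq> {}" and chain: "subset.chain \<A> \<C>"
    have "\<forall>X\<in>\<C>. \<exists>y tm. X = graph y tm \<and> is_solution r f t0 x0 d y tm"
      using chain by (auto simp: \<A>_def subset.chain_def subset_chain_def)
    then obtain y \<tau> where y: "\<And>X. X \<in> \<C> \<Longrightarrow> X = graph (y X) (\<tau> X)"
      "\<And>X. X \<in> \<C> \<Longrightarrow> is_solution r f t0 x0 d (y X) (\<tau> X)" by metis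
    have mem: "(t, v) \<in> X \<longleftrightarrow> t0 - r \<le> t \<and> ereal t < \<tau> X \<and> v = y X t" if "X \<in> \<C>" for t v X
      by (subst y(1)[OF that]) (auto simp: graph_def)
    have agree: "y X t = y X' t" if "X \<in> \<C>" "X' \<in> \<C>" "t0 - r \<le> t" "ereal t < \<tau> X" "ereal t < \<tau> X'" for X X' t
    proof -
      have "(t, y X t) \<in> X" "(t, y X' t) \<in> X'" using that mem by auto
      moreover have "X \<subseteq> X' \<or> X' \<subseteq> X"
        using chain that by (auto simp: subset_chain_def)
      ultimately have "(t, y X t) \<in> X' \<or> (t, y X' t) \<in> X" by blast
      then show ?thesis using mem that by auto
    qed
    define z where "z t = y (SOME X. X \<in> \<C> \<and> ereal t < \<tau> X) t" for t
    have z: "z t = y X t" if "X \<in> \<C>" "t0 - r \<le> t" "ereal t < \<tau> X" for X t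
    proof -
      have "(SOME X. X \<in> \<C> \<and> ereal t < \<tau> X) \<in> \<C> \<and> ereal t < \<tau> (SOME X. X \<in> \<C> \<and> ereal t < \<tau> X)"
        using that by (intro someI[of "\<lambda>X. X \<in> \<C> \<and> ereal t < \<tau> X" X]) auto
      then show ?thesis unfolding z_def using that by (intro agree) auto
    qed
    have "is_solution r f t0 x0 d z (SUP X\<in>\<C>. \<tau> X)"
      by (rule solution_glue[OF r ne y(2) z])
    moreover have "\<Union>\<C> = graph z (SUP X\<in>\<C>. \<tau> X)"
    proof (intro equalityI subsetI)
      fix p assume "p \<in> \<Union>\<C>"
      then obtain t v X where p: "p = (t, v)" "X \<in> \<C>" "(t, v) \<in> X" by (cases p) auto
      then have "t0 - r \<le> t" "ereal t < \<tau> X" "v = z t" using mem z by auto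
      then show "p \<in> graph z (SUP X\<in>\<C>. \<tau> X)"
        using p by (auto simp: graph_def less_SUP_iff)
    next
      fix p assume "p \<in> graph z (SUP X\<in>\<C>. \<tau> X)"
      then obtain t where t: "p = (t, z t)" "t0 - r \<le> t" "ereal t < (SUP X\<in>\<C>. \<tau> X)"
        by (auto simp: graph_def)
      then obtain X where "X \<in> \<C>" "ereal t < \<tau> X" by (auto simp: less_SUP_iff)
      then show "p \<in> \<Union>\<C>" using t mem z by auto
    qed
    ultimately show "\<Union>\<C> \<in> \<A>" unfolding \<A>_def by blast
  qed
  then obtain M where M: "M \<in> \<A>" "\<And>X. X \<in> \<A> \<Longrightarrow> M \<subseteq> X \<Longrightarrow> X = M" by blast
  from M(1) obtain y tm' where y: "is_solution r f t0 x0 d y tm'" and My: "M = graph y tm'"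
    by (auto simp: \<A>_def)
  have max: "graph z T = graph y tm'"
    if "is_solution r f t0 x0 d z T" "graph y tm' \<subseteq> graph z T" for z T
  proof -
    have "graph z T \<in> \<A>" using that(1) by (auto simp: \<A>_def)
    then show ?thesis using M(2) that(2) My by simp
  qed
  have "T = tm'" if z: "is_solution r f t0 x0 d z T" "tm' \<le> T"
    "\<forall>t. t0 - r \<le> t \<and> ereal t < tm' \<longrightarrow> z t = y t" for z T
  proof (rule ccontr)
    assume "T \<noteq> tm'"
    then have "tm' < T" using z(2) by order
    \<comment> \<open>A strict extension has a point of its graph at such a time \<open>s\<close>,
      which the smaller graph lacks.\<close>
    then obtain s where s: "tm' < ereal s" "ereal s < T" using ereal_dense2 by blast
    have "graph y tm' \<subseteq> graph z T"
      using z(2,3) by (auto simp: graph_def intro: less_le_trans)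
    then have "graph z T = graph y tm'" by (rule max[OF z(1)])
    moreover have "ereal t0 < tm'" using y by (simp add: is_solution_def)
    then have "ereal t0 < ereal s" using s(1) by (rule less_trans)
    then have "(s, z s) \<in> graph z T" using s r by (auto simp: graph_def)
    ultimately show False using s(1) by (auto simp: graph_def)
  qed
  then show ?thesis using y unfolding is_maximal_solution_def by blast
qed

text \<open>A bounded solution has bounded velocity by \<open>hyp2\<close>, hence is Lipschitz up to
  \<open>T\<close> and has a limit there. Restarting from that limit continues it; Lipschitz bounds
  on both sides of \<open>T\<close> give absolute continuity across it.\<close>

lemma bounded_solution_extends:
  fixes f :: "('n::finite, 'l::finite) rhs"
  assumes r: "r > 0" and f1: "hyp1 r f D" and f2: "hyp2 r f D" and f3: "hyp3 r f D"
    and t0: "0 \<le> t0" and d: "d \<in> disturbances D"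
    and sol: "is_solution r f t0 x0 d x (ereal T)"
    and B: "\<And>t. t0 - r \<le> t \<Longrightarrow> t < T \<Longrightarrow> norm (x t) \<le> B"
  obtains y T' where "T < T'" "is_solution r f t0 x0 d y (ereal T')"
    "\<And>t. t0 - r \<le> t \<Longrightarrow> t < T \<Longrightarrow> y t = x t"
proof -
  have T: "t0 < T" and xc: "continuous_on {t. t0 - r \<le> t \<and> t < T} x"
    and xac: "\<And>b. b \<ge> t0 \<Longrightarrow> b < T \<Longrightarrow> abs_continuous_on t0 b x"
    and x0: "hist r t0 x = x0"
    and xae: "AE t in lebesgue. t0 \<le> t \<and> t < T \<longrightarrow> (x has_vector_derivative f t (hist r t x) (d t)) (at t)"
    using sol by (auto simp: is_solution_def)
  have dD: "d t \<in> D" if "t \<ge> 0" for t using d that by (auto simp: disturbances_def)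
  let ?S = "{\<psi> \<in> hist_space r. norm \<psi> \<le> B}"
  have "bounded ({t0..T} \<times> ?S)"
    by (intro bounded_Times bounded_closed_interval) (auto simp: bounded_iff)
  moreover have "{t0..T} \<times> ?S \<subseteq> {0..} \<times> hist_space r" using t0 by auto
  ultimately have "bounded ((\<lambda>((t, x), d). f t x d) ` (({t0..T} \<times> ?S) \<times> D))"
    using f2 unfolding hyp2_def by blast
  then obtain M where M: "M > 0" "\<And>t \<psi> u. t \<in> {t0..T} \<Longrightarrow> \<psi> \<in> ?S \<Longrightarrow> u \<in> D \<Longrightarrow> norm (f t \<psi> u) \<le> M"
    unfolding bounded_pos by fastforce
  obtain N where N1: "N \<in> null_sets lebesgue" and N2: "\<And>t. t \<in> space lebesgue - N \<Longrightarrow>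
      t0 \<le> t \<and> t < T \<longrightarrow> (x has_vector_derivative f t (hist r t x) (d t)) (at t)"
    using AE_E3[OF xae] by blast
  have N: "N \<in> null_sets lebesgue"
    "\<And>t. t \<notin> N \<Longrightarrow> t0 \<le> t \<Longrightarrow> t < T \<Longrightarrow> (x has_vector_derivative f t (hist r t x) (d t)) (at t)"
    using N1 N2 by simp_all
  have lipb: "M-lipschitz_on {t0..b} x" if b: "t0 \<le> b" "b < T" for b
  proof (rule abs_continuous_on_derivative_bound[OF xac[OF b]])
    fix t assume t: "t0 \<le> t" "t < b" "t \<notin> N"
    have c: "continuous_on {t - r..t} x"
      by (rule continuous_on_subset[OF xc]) (use t b in auto)
    have "hist r t x \<in> ?S"
      using r t b by (auto intro!: hist_in_hist_space norm_hist_le c B)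
    then have "norm (f t (hist r t x) (d t)) \<le> M" using t b t0 by (intro M(2) dD) auto
    then show "\<exists>y. norm y \<le> M \<and> (x has_vector_derivative y) (at t)"
      using N(2)[of t] t b by auto
  qed (use M N in \<open>auto simp: negligible_iff_null_sets\<close>)
  have "M-lipschitz_on {t0..<T} x"
  proof (rule lipschitz_on_leI)
    fix s t assume "s \<in> {t0..<T}" "t \<in> {t0..<T}" "s \<le> t"
    then show "dist (x s) (x t) \<le> M * dist s t" by (intro lipschitz_onD[OF lipb[of t]]) auto
  qed (use M in simp)
  then obtain g where g: "M-lipschitz_on {t0..T} g" "\<And>t. t \<in> {t0..<T} \<Longrightarrow> g t = x t"
    using lipschitz_extend_closure[of M "{t0..<T}" x] T by auto
  define xx where "xx t = (if t < T then x t else g T)" for t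
  have xxlip: "M-lipschitz_on {t0..T} xx"
    by (rule lipschitz_on_transform[OF g(1)]) (use g(2) in \<open>auto simp: xx_def\<close>)
  have "continuous_on {t0 - r..t0} x"
    by (rule continuous_on_subset[OF xc]) (use T in auto)
  then have xx0: "continuous_on {t0 - r..t0} xx"
    by (rule continuous_on_eq) (use T in \<open>auto simp: xx_def\<close>)
  have ivl: "{t0 - r..t0} \<union> {t0..b} = {t0 - r..b}" if "t0 \<le> b" for b
    using that r by auto
  have "continuous_on ({t0 - r..t0} \<union> {t0..T}) xx"
    using xx0 lipschitz_on_continuous_on[OF xxlip] by (intro continuous_on_closed_Un) auto
  then have xxc: "continuous_on {t0 - r..T} xx" using ivl[of T] T by simp
  have xxcT: "continuous_on {T - r..T} xx" by (rule continuous_on_subset[OF xxc]) (use T in auto)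
  have "hist r T xx \<in> hist_space r" using r xxcT by (intro hist_in_hist_space) auto
  then obtain e y L where e: "T < e" "is_solution r f T (hist r T xx) d y (ereal e)" "L-lipschitz_on {T..e} y"
    using local_solution[OF r f1 f2 f3 _ _ d, of T "hist r T xx"] T t0 by auto
  have yc: "continuous_on {T - r..T} y"
    using e by (auto simp: is_solution_def intro: continuous_on_subset)
  \<comment> \<open>The initial history determines the restarted solution on
    \<open>[T - r, T]\<close>, so \<open>z\<close> equals \<open>y\<close> from \<open>T - r\<close>
    on, and the histories of \<open>z\<close> after \<open>T\<close> are those of
    \<open>y\<close>.\<close>
  have yxx: "y t = xx t" if "T - r \<le> t" "t \<le> T" for t
  proof -
    have "hist r T y (t - T) = hist r T xx (t - T)" using e by (simp add: is_solution_def)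
    then show ?thesis
      using that r apply_hist[OF _ yc, of "t - T"] apply_hist[OF _ xxcT, of "t - T"] by simp
  qed
  define z where "z t = (if t \<le> T then xx t else y t)" for t
  have zx: "z t = x t" if "t < T" for t using that by (simp add: z_def xx_def)
  have zy: "z t = y t" if "T - r \<le> t" for t using that yxx by (simp add: z_def)
  have zlip: "(max M L)-lipschitz_on {t0..e} z"
    unfolding z_def using xxlip e(3) yxx[of T] r by (intro lipschitz_on_concat_max) auto
  have "continuous_on {t0 - r..t0} z"
    by (rule continuous_on_eq[OF xx0]) (use T in \<open>auto simp: z_def\<close>)
  then have "continuous_on ({t0 - r..t0} \<union> {t0..e}) z"
    using lipschitz_on_continuous_on[OF zlip] by (intro continuous_on_closed_Un) auto
  then have zc: "continuous_on {t0 - r..e} z" using ivl[of e] T e(1) by simp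
  have yae: "AE t in lebesgue. T \<le> t \<and> t < e \<longrightarrow> (y has_vector_derivative f t (hist r t y) (d t)) (at t)"
    using e(2) by (simp add: is_solution_def)
  have "AE t in lebesgue. t0 \<le> t \<and> t < e \<longrightarrow> (z has_vector_derivative f t (hist r t z) (d t)) (at t)"
    using xae yae
  proof eventually_elim
    case (elim t)
    show ?case
    proof (intro impI, cases "t < T")
      case True
      assume t: "t0 \<le> t \<and> t < e"
      show "(z has_vector_derivative f t (hist r t z) (d t)) (at t)"
        by (rule solution_derivative_cong[OF r _ True, of t0 _ x]) (use True zx t elim in auto)
    next
      case False
      assume t: "t0 \<le> t \<and> t < e"
      show "(z has_vector_derivative f t (hist r t z) (d t)) (at t)"
        by (rule solution_derivative_cong[OF r, of T _ e _ y]) (use False zy t elim in auto)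
    qed
  qed
  moreover have "hist r t0 z = x0"
    using r x0 T zx hist_cong[of r t0 z x] by auto
  moreover have "abs_continuous_on t0 b z" if "b < e" for b
    by (rule abs_continuous_on_lipschitz[OF lipschitz_on_subset[OF zlip]]) (use that in auto)
  ultimately have "is_solution r f t0 x0 d z (ereal e)"
    unfolding is_solution_def using e(1) T by (auto intro: continuous_on_subset[OF zc])
  with e(1) zx show ?thesis using that by blast
qed

text \<open>The choice operator returns an arbitrary pair unless a maximal solution exists;
  existence makes the chosen pair one.\<close>

lemma max_solution_maximal:
  fixes f :: "('n::finite, 'l::finite) rhs"
  assumes r: "r > 0" and f1: "hyp1 r f D" and f2: "hyp2 r f D" and f3: "hyp3 r f D"
    and t0: "0 \<le> t0" and x0: "x0 \<in> hist_space r" and d: "d \<in> disturbances D"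
  shows "is_maximal_solution r f t0 x0 d (fst (max_solution r f t0 x0 d)) (tmax r f t0 x0 d)"
proof -
  obtain e x L where "is_solution r f t0 x0 d x (ereal e)"
    using local_solution[OF assms] by blast
  then obtain y tm where "is_maximal_solution r f t0 x0 d y tm"
    using maximal_solution_exists[OF r] by blast
  then have "case (SOME (x, tm). is_maximal_solution r f t0 x0 d x tm) of (x, tm) \<Rightarrow>
      is_maximal_solution r f t0 x0 d x tm"
    by (intro someI[of "\<lambda>(x, tm). is_maximal_solution r f t0 x0 d x tm" "(y, tm)"]) simp
  then show ?thesis by (simp add: max_solution_def tmax_def case_prod_unfold)
qed

text \<open>The bound may depend on the horizon \<open>T\<close>, which admits estimates that
  degenerate as time grows. At a finite end time the continuation would contradict
  maximality.\<close>

lemma bounded_maximal_solution_global: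
  fixes f :: "('n::finite, 'l::finite) rhs"
  assumes r: "r > 0" and f: "hyp1 r f D" "hyp2 r f D" "hyp3 r f D"
    and t0: "0 \<le> t0" and d: "d \<in> disturbances D"
    and max: "is_maximal_solution r f t0 x0 d x tm"
    and B: "\<And>T. \<exists>B. \<forall>t. t0 - r \<le> t \<and> t < T \<and> ereal t < tm \<longrightarrow> norm (x t) \<le> B"
  shows "tm = \<infinity>"
proof (rule ccontr)
  assume "tm \<noteq> \<infinity>"
  have sol: "is_solution r f t0 x0 d x tm" using max by (simp add: is_maximal_solution_def)
  then have "ereal t0 < tm" by (simp add: is_solution_def)
  with \<open>tm \<noteq> \<infinity>\<close> obtain T where T: "tm = ereal T" by (cases tm) auto
  obtain C where "\<And>t. t0 - r \<le> t \<Longrightarrow> t < T \<Longrightarrow> norm (x t) \<le> C" using B[of T] T by auto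
  then obtain y T' where y: "T < T'" "is_solution r f t0 x0 d y (ereal T')"
    "\<And>t. t0 - r \<le> t \<Longrightarrow> t < T \<Longrightarrow> y t = x t"
    using bounded_solution_extends[OF r f t0 d sol[unfolded T]] by metis
  have "ereal T' = ereal T"
    using max[unfolded is_maximal_solution_def T, THEN conjunct2, rule_format, of y "ereal T'"] y by auto
  with y(1) show False by simp
qed

section \<open>Comparison functions\<close>

lemma class_K_zero: "class_K a \<Longrightarrow> a 0 = 0"
  by (simp add: class_K_def pos_definite_def)

lemma class_K_less:
  assumes "class_K a" "0 \<le> s" "s < t"
  shows "a s < a t"
  using assms by (auto simp: class_K_def strict_mono_on_def)

lemma class_K_le:
  assumes "class_K a" "0 \<le> s" "s \<le> t"
  shows "a s \<le> a t"
  using class_K_less[OF assms(1,2), of t] assms(3) by (cases "s = t") auto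

lemma class_K_nonneg: "class_K a \<Longrightarrow> 0 \<le> s \<Longrightarrow> 0 \<le> a s"
  using class_K_le[of a 0 s] class_K_zero[of a] by simp

lemma class_Kinf_imp_K: "class_Kinf a \<Longrightarrow> class_K a"
  by (simp add: class_Kinf_def)

lemma class_Kinf_unbounded:
  assumes "class_Kinf a"
  obtains s where "s > 0" "a s \<ge> y"
proof -
  have "eventually (\<lambda>s. a s \<ge> y) at_top"
    using assms by (simp add: class_Kinf_def filterlim_at_top)
  then have "eventually (\<lambda>s. a s \<ge> y \<and> s > 0) at_top"
    using eventually_gt_at_top by (rule eventually_conj)
  then show ?thesis using that by (auto simp: eventually_at_top_linorder)
qed

lemma class_K_compose:
  assumes a: "class_K a" and b: "class_K b"
  shows "class_K (\<lambda>s. a (b s))"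
proof -
  have "strict_mono_on {0..} (\<lambda>s. a (b s))"
    by (rule strict_mono_onI) (use class_K_less[OF a] class_K_less[OF b] class_K_nonneg[OF b] in auto)
  moreover have "continuous_on {0..} (\<lambda>s. a (b s))"
    by (rule continuous_on_compose2[of "{0..}" a])
      (use a b class_K_nonneg[OF b] in \<open>auto simp: class_K_def\<close>)
  moreover have "a (b s) > 0" if "s > 0" for s
    using class_K_less[OF a, of 0 "b s"] class_K_less[OF b, of 0 s] that a b by (simp add: class_K_zero)
  ultimately show ?thesis
    using a b by (simp add: class_K_def pos_definite_def)
qed

lemma class_K_scale: "B > 0 \<Longrightarrow> class_K (\<lambda>s. B * s)"
  by (auto simp: class_K_def pos_definite_def strict_mono_on_def intro!: continuous_intros)

text \<open>Extending \<open>a\<close> by the identity to negative arguments makes it a homeomorphism of the real line.\<close>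

lemma class_Kinf_inverse:
  assumes a: "class_Kinf a"
  obtains b where "class_K b" "\<And>s. s \<ge> 0 \<Longrightarrow> b (a s) = s" "\<And>s. s \<ge> 0 \<Longrightarrow> a (b s) = s"
proof -
  note K = class_Kinf_imp_K[OF a]
  define e where "e s = (if s \<ge> 0 then a s else s)" for s
  have mono: "e s < e t" if "s < t" for s t
    using class_K_less[OF K, of s t] class_K_nonneg[OF K, of t] that by (auto simp: e_def)
  then have sm: "strict_mono e" by (simp add: strict_mono_def)
  have "\<exists>s. e s = y" for y
  proof (cases "y \<ge> 0")
    case True
    obtain s where s: "s > 0" "a s \<ge> y" using class_Kinf_unbounded[OF a] .
    have "\<exists>x\<ge>0. x \<le> s \<and> a x = y"
    proof (rule IVT')
      show "continuous_on {0..s} a" using K unfolding class_K_def by (auto intro: continuous_on_subset)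
    qed (use s True K in \<open>auto simp: class_K_zero\<close>)
    then show ?thesis by (auto simp: e_def)
  next
    case False
    then show ?thesis by (intro exI[of _ y]) (simp add: e_def)
  qed
  then have "surj e" by (metis surjI)
  then have bij: "bij e" using strict_mono_imp_inj_on[OF sm] by (simp add: bij_def)
  define b where "b = inv e"
  have eb: "e (b y) = y" and be: "b (e s) = s" for y s
    using bij by (auto simp: b_def bij_def surj_f_inv_f)
  have bmono: "b y < b z" if "y < z" for y z
    using that eb mono by (metis linorder_neqE_linordered_idom order_less_asym)
  have b0: "b 0 = 0" using be[of 0] K by (simp add: e_def class_K_zero)
  \<comment> \<open>A monotone function onto the real line cannot jump, so \<open>b\<close> is
    continuous.\<close>
  have "surj b" by (rule surjI[of b e]) (rule be)
  then have "continuous_on UNIV b"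
    by (intro continuous_onI_mono) (auto simp: less_imp_le bmono order.order_iff_strict)
  then have "class_K b"
    using bmono b0 unfolding class_K_def pos_definite_def strict_mono_on_def
    by (auto intro: continuous_on_subset) (metis bmono b0)
  moreover have "b (a s) = s" if "s \<ge> 0" for s using be[of s] that by (simp add: e_def)
  moreover have "a (b s) = s" if "s \<ge> 0" for s
  proof -
    have "b s \<ge> 0" using bmono[of 0 s] b0 that by (cases "s = 0") auto
    then show ?thesis using eb[of s] by (simp add: e_def)
  qed
  ultimately show ?thesis using that by blast
qed

section \<open>Assembling a KL bound from uniform attraction\<close>

lemma exp_min_0_lipschitz: "\<bar>exp (min 0 x) - exp (min 0 y)\<bar> \<le> \<bar>x - y\<bar>" for x y :: real
proof -
  have *: "\<bar>exp (min 0 x) - exp (min 0 y)\<bar> \<le> \<bar>x - y\<bar>" if "x \<le> y" for x y :: real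
  proof -
    define X Y where "X = min 0 x" and "Y = min 0 y"
    have XY: "X \<le> Y" "Y - X \<le> y - x" "Y \<le> 0" using that by (auto simp: X_def Y_def)
    \<comment> \<open>The exponential has slope at most 1 below 0: factor out
      \<open>exp Y \<le> 1\<close> and use \<open>1 + u \<le> exp u\<close>.\<close>
    have "exp Y * (1 - exp (X - Y)) \<le> 1 * (Y - X)"
    proof (rule mult_mono)
      show "1 - exp (X - Y) \<le> Y - X" using exp_ge_add_one_self[of "X - Y"] by linarith
    qed (use XY in auto)
    moreover have "exp Y * (1 - exp (X - Y)) = exp Y - exp X"
      by (simp add: right_diff_distrib exp_add[symmetric])
    moreover have "exp X \<le> exp Y" using XY by simp
    ultimately have "\<bar>exp X - exp Y\<bar> \<le> \<bar>x - y\<bar>" using XY that by simp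
    then show ?thesis by (simp add: X_def Y_def)
  qed
  show ?thesis using *[of x y] *[of y x] by (cases "x \<le> y") (auto simp: abs_minus_commute)
qed

text \<open>
  The majorant is \<open>\<sigma> s t = sqrt (g s * (k s t + exp (- t)))\<close>, where \<open>k\<close> is the supremum of the
  values \<open>y\<close> damped by a cutoff in \<open>s\<close> and an exponential in \<open>t\<close>; the factor \<open>g\<close> provides
  \<open>\<sigma> 0 t = 0\<close> and strict monotonicity.
\<close>

lemma class_KL_majorant:
  fixes Z :: "(real \<times> real \<times> real) set"
  assumes g: "class_K g"
    and Z: "\<And>s t y. (s, t, y) \<in> Z \<Longrightarrow> 0 \<le> s \<and> 0 \<le> t \<and> 0 \<le> y \<and> y \<le> g s"
    and attr: "\<And>R \<epsilon>. R \<ge> 0 \<Longrightarrow> \<epsilon> > 0 \<Longrightarrow> \<exists>\<tau>. \<forall>(s, t, y)\<in>Z. s \<le> R \<and> t \<ge> \<tau> \<longrightarrow> y \<le> \<epsilon>"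
  obtains \<sigma> where "class_KL \<sigma>" "\<And>s t y. (s, t, y) \<in> Z \<Longrightarrow> y \<le> \<sigma> s t"
proof -
  \<comment> \<open>The zero triple keeps the supremum over a nonempty set and makes
    \<open>k\<close> nonnegative.\<close>
  define Z' where "Z' = insert (0, 0, 0) Z"
  have Z': "0 \<le> s' \<and> 0 \<le> t' \<and> 0 \<le> y \<and> y \<le> g s'" if "(s', t', y) \<in> Z'" for s' t' y
    using that Z g by (auto simp: Z'_def class_K_zero)
  \<comment> \<open>\<open>c (s + 1 - s')\<close> is 1 for \<open>s' \<le> s\<close> and 0 for
    \<open>s' \<ge> s + 1\<close>: a Lipschitz replacement for the indicator of
    \<open>s' \<le> s\<close>, with which the supremum could jump in \<open>s\<close>.\<close>
  define c where "c u = max 0 (min 1 u)" for u :: real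
  have c: "0 \<le> c u" "c u \<le> 1" "\<bar>c u - c v\<bar> \<le> \<bar>u - v\<bar>" "u \<le> v \<Longrightarrow> c u \<le> c v" for u v
    by (auto simp: c_def)
  \<comment> \<open>At the point \<open>(s', t')\<close> of the sample itself both factors are 1 and
    \<open>w\<close> returns \<open>y\<close>. In general \<open>w\<close> is nondecreasing in
    \<open>s\<close> and nonincreasing in \<open>t\<close>.\<close>
  define w where "w s t z = (case z of (s', t', y) \<Rightarrow> y * (c (s + 1 - s') * exp (min 0 (t' - t))))"
    for s t :: real and z
  have w0: "w s t z = 0" if "z = (s', t', y)" "s' \<ge> s + 1" for s t z s' t' y
    using that by (simp add: w_def c_def)
  have y_le: "y \<le> g (s + 1)" if "(s', t', y) \<in> Z'" "s' \<le> s + 1" for s s' t' y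
    using Z'[OF that(1)] class_K_le[OF g, of s' "s + 1"] that(2) by simp
  have factor: "c (s + 1 - s') * exp (min 0 (t' - t)) \<le> 1" "c (s + 1 - s') * exp (min 0 (t' - t)) \<ge> 0"
    for s s' t t' using c(1)[of "s + 1 - s'"] c(2)[of "s + 1 - s'"] mult_mono[of "c (s + 1 - s')" 1 "exp (min 0 (t' - t))" 1]
    by auto
  have w_nonneg: "0 \<le> w s t z" if "z \<in> Z'" for s t z
    using Z' that factor(2) by (auto simp: w_def split: prod.splits)
  have w_le: "w s t z \<le> g (s + 1)" if z: "z \<in> Z'" and s: "s \<ge> 0" for s t z
  proof -
    obtain s' t' y where zz: "z = (s', t', y)" by (cases z) auto
    show ?thesis
    proof (cases "s' \<ge> s + 1")
      case True
      then show ?thesis using w0[OF zz] class_K_nonneg[OF g, of "s + 1"] s by simp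
    next
      case False
      have "w s t z \<le> y * 1"
        unfolding w_def zz prod.case using factor(1) Z'[of s' t' y] z zz by (intro mult_left_mono) auto
      then show ?thesis using y_le[of s' t' y s] False z zz by simp
    qed
  qed
  have w_mono: "w s1 t1 z \<le> w s2 t2 z" if "z \<in> Z'" "s1 \<le> s2" "t2 \<le> t1" for s1 s2 t1 t2 z
  proof -
    obtain s' t' y where zz: "z = (s', t', y)" by (cases z) auto
    show ?thesis unfolding w_def zz prod.case
      using that zz Z' by (intro mult_left_mono mult_mono c) auto
  qed
  \<comment> \<open>The constant \<open>g (m + 1)\<close> is common to all samples: those with
    \<open>s' \<ge> m + 1\<close> vanish for \<open>s \<le> m\<close>, the others satisfy
    \<open>y \<le> g (m + 1)\<close>. Hence the supremum \<open>k\<close> is Lipschitz on bounded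
    ranges of \<open>s\<close>.\<close>
  have w_lip: "w s1 t1 z \<le> w s2 t2 z + g (m + 1) * (\<bar>s1 - s2\<bar> + \<bar>t1 - t2\<bar>)"
    if z: "z \<in> Z'" and s: "0 \<le> s1" "s1 \<le> m" "0 \<le> s2" "s2 \<le> m" for s1 s2 t1 t2 m z
  proof -
    obtain s' t' y where zz: "z = (s', t', y)" by (cases z) auto
    have G: "g (m + 1) \<ge> 0" using class_K_nonneg[OF g] s by simp
    show ?thesis
    proof (cases "s' \<ge> m + 1")
      case True
      then show ?thesis using w0[OF zz, of s1] w0[OF zz, of s2] s G by simp
    next
      case False
      have y: "0 \<le> y" "y \<le> g (m + 1)" using y_le[of s' t' y m] Z'[of s' t' y] z zz False by auto
      let ?c = "\<lambda>s. c (s + 1 - s')" and ?e = "\<lambda>t. exp (min 0 (t' - t))"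
      have "?c s1 * ?e t1 - ?c s2 * ?e t2 = (?c s1 - ?c s2) * ?e t1 + ?c s2 * (?e t1 - ?e t2)"
        by (simp add: algebra_simps)
      also have "\<dots> \<le> \<bar>?c s1 - ?c s2\<bar> * 1 + 1 * \<bar>?e t1 - ?e t2\<bar>"
      proof (rule add_mono)
        show "(?c s1 - ?c s2) * ?e t1 \<le> \<bar>?c s1 - ?c s2\<bar> * 1"
          by (rule order_trans[OF mult_right_mono[OF abs_ge_self] mult_left_mono]) auto
        show "?c s2 * (?e t1 - ?e t2) \<le> 1 * \<bar>?e t1 - ?e t2\<bar>"
          by (rule order_trans[OF mult_left_mono[OF abs_ge_self] mult_right_mono]) (auto simp: c)
      qed
      also have "\<dots> \<le> \<bar>s1 - s2\<bar> + \<bar>t1 - t2\<bar>"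
        using c(3)[of "s1 + 1 - s'" "s2 + 1 - s'"] exp_min_0_lipschitz[of "t' - t1" "t' - t2"]
        by (simp add: abs_minus_commute[of t2])
      finally have "y * (?c s1 * ?e t1 - ?c s2 * ?e t2) \<le> g (m + 1) * (\<bar>s1 - s2\<bar> + \<bar>t1 - t2\<bar>)"
        using y by (meson abs_ge_zero add_nonneg_nonneg mult_left_mono mult_right_mono order_trans)
      then show ?thesis by (simp add: w_def zz right_diff_distrib)
    qed
  qed
  define k where "k s t = (SUP z\<in>Z'. w s t z)" for s t
  have ne: "Z' \<noteq> {}" by (simp add: Z'_def)
  have bdd: "bdd_above (w s t ` Z')" if "s \<ge> 0" for s t
    by (rule bdd_aboveI2[of _ _ "g (s + 1)"]) (rule w_le[OF _ that])
  have w_le_k: "w s t z \<le> k s t" if "z \<in> Z'" "s \<ge> 0" for s t z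
    unfolding k_def by (rule cSUP_upper[OF that(1) bdd[OF that(2)]])
  have k_le: "k s t \<le> u" if "\<And>z. z \<in> Z' \<Longrightarrow> w s t z \<le> u" for s t u
    unfolding k_def by (rule cSUP_least[OF ne that])
  have k_nonneg: "0 \<le> k s t" if "s \<ge> 0" for s t
    using w_le_k[of "(0, 0, 0)" s t] w_nonneg[of "(0, 0, 0)" s t] that by (simp add: Z'_def)
  have k_mono: "k s1 t1 \<le> k s2 t2" if "0 \<le> s1" "s1 \<le> s2" "t2 \<le> t1" for s1 s2 t1 t2
  proof (rule k_le)
    fix z assume z: "z \<in> Z'"
    have "w s1 t1 z \<le> w s2 t2 z" by (rule w_mono[OF z that(2,3)])
    also have "\<dots> \<le> k s2 t2" by (rule w_le_k[OF z]) (use that in simp)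
    finally show "w s1 t1 z \<le> k s2 t2" .
  qed
  have k_lip: "\<bar>k s1 t1 - k s2 t2\<bar> \<le> g (m + 1) * (\<bar>s1 - s2\<bar> + \<bar>t1 - t2\<bar>)"
    if s: "0 \<le> s1" "s1 \<le> m" "0 \<le> s2" "s2 \<le> m" for s1 s2 t1 t2 m
  proof -
    have *: "k s1 t1 \<le> k s2 t2 + g (m + 1) * (\<bar>s1 - s2\<bar> + \<bar>t1 - t2\<bar>)"
      if s: "0 \<le> s1" "s1 \<le> m" "0 \<le> s2" "s2 \<le> m" for s1 s2 t1 t2
    proof (rule k_le)
      fix z assume z: "z \<in> Z'"
      show "w s1 t1 z \<le> k s2 t2 + g (m + 1) * (\<bar>s1 - s2\<bar> + \<bar>t1 - t2\<bar>)"
        using w_lip[OF z s, of t1 t2] w_le_k[OF z s(3), of t2] by linarith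
    qed
    show ?thesis using *[OF s, of t1 t2] *[OF s(3,4,1,2), of t2 t1] by (simp add: abs_le_iff abs_minus_commute)
  qed
  have k_cont: "continuous_on ({0..} \<times> {0..}) (\<lambda>(s, t). k s t)"
    unfolding continuous_on_iff
  proof (intro ballI allI impI)
    fix p and e :: real assume p: "p \<in> {0::real..} \<times> {0::real..}" and "e > 0"
    obtain s t where st: "p = (s, t)" "s \<ge> 0" "t \<ge> 0" using p by auto
    define G where "G = g (s + 1 + 1)"
    have G: "G \<ge> 0" using class_K_nonneg[OF g] st by (simp add: G_def)
    define \<eta> where "\<eta> = min 1 (e / (2 * (G + 1)))"
    have \<eta>: "\<eta> > 0" "\<eta> \<le> 1" "\<eta> * (2 * (G + 1)) \<le> e"
      using G \<open>e > 0\<close> by (auto simp: \<eta>_def pos_le_divide_eq[symmetric])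
    show "\<exists>d>0. \<forall>x'\<in>{0..} \<times> {0..}. dist x' p < d \<longrightarrow> dist (case x' of (s, t) \<Rightarrow> k s t) (case p of (s, t) \<Rightarrow> k s t) < e"
    proof (intro exI[of _ \<eta>] conjI ballI impI)
      fix p' :: "real \<times> real" assume p': "p' \<in> {0..} \<times> {0..}" "dist p' p < \<eta>"
      obtain s' t' where st': "p' = (s', t')" "s' \<ge> 0" "t' \<ge> 0" using p' by auto
      have d: "\<bar>s' - s\<bar> < \<eta>" "\<bar>t' - t\<bar> < \<eta>"
        using dist_fst_le[of p' p] dist_snd_le[of p' p] p'(2) st st' by (auto simp: dist_real_def)
      have "\<bar>k s' t' - k s t\<bar> \<le> G * (\<bar>s' - s\<bar> + \<bar>t' - t\<bar>)"
        unfolding G_def using st st' d \<eta> by (intro k_lip) auto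
      also have "\<dots> \<le> G * (2 * \<eta>)" using d G by (intro mult_left_mono) auto
      also have "\<dots> < \<eta> * (2 * (G + 1))" using \<eta> by (simp add: algebra_simps)
      finally show "dist (case p' of (s, t) \<Rightarrow> k s t) (case p of (s, t) \<Rightarrow> k s t) < e"
        using \<eta> st st' by (simp add: dist_real_def)
    qed (use \<eta> in auto)
  qed
  have k_lim: "(k s \<longlongrightarrow> 0) at_top" if s: "s \<ge> 0" for s
  proof (rule tendstoI)
    fix e :: real assume "e > 0"
    obtain \<tau> where \<tau>: "\<forall>(s', t', y)\<in>Z. s' \<le> s + 1 \<and> t' \<ge> \<tau> \<longrightarrow> y \<le> e / 2"
      using attr[of "s + 1" "e / 2"] s \<open>e > 0\<close> by auto
    have "((\<lambda>t. g (s + 1) * exp (\<tau> - t)) \<longlongrightarrow> 0) at_top" by real_asymp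
    then have "eventually (\<lambda>t. g (s + 1) * exp (\<tau> - t) < e / 2) at_top"
      using \<open>e > 0\<close> by (intro order_tendstoD(2)[where a = "e / 2"]) auto
    then show "eventually (\<lambda>t. dist (k s t) 0 < e) at_top"
    proof eventually_elim
      case (elim t)
      have "k s t \<le> e / 2"
      proof (rule k_le)
        fix z assume z: "z \<in> Z'"
        obtain s' t' y where zz: "z = (s', t', y)" by (cases z) auto
        note zp = Z'[OF z[unfolded zz]]
        \<comment> \<open>Samples beyond the cutoff vanish, late ones are small by attraction, and
          early ones are damped by \<open>exp (\<tau> - t)\<close> since
          \<open>t' \<le> \<tau>\<close>.\<close>
        consider "s' \<ge> s + 1" | "s' \<le> s + 1" "t' \<ge> \<tau>" | "s' \<le> s + 1" "t' \<le> \<tau>" by linarith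
        then show "w s t z \<le> e / 2"
        proof cases
          case 1
          then show ?thesis using w0[OF zz] \<open>e > 0\<close> by simp
        next
          case 2
          then have "y \<le> e / 2" using \<tau> z zz \<open>e > 0\<close> by (auto simp: Z'_def)
          moreover have "w s t z \<le> y * 1"
            unfolding w_def zz prod.case using factor zp by (intro mult_left_mono) auto
          ultimately show ?thesis by simp
        next
          case 3
          have "w s t z \<le> g (s + 1) * (1 * exp (\<tau> - t))"
            unfolding w_def zz prod.case
            using y_le[OF z[unfolded zz] 3(1)] zp 3 c by (intro mult_mono) auto
          then show ?thesis using elim by simp
        qed
      qed
      then show ?case using k_nonneg[OF s, of t] \<open>e > 0\<close> by (simp add: dist_real_def)
    qed
  qed
  define \<sigma> where "\<sigma> s t = sqrt (g s * (k s t + exp (- t)))" for s t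
  \<comment> \<open>Where \<open>k\<close> is 0 the growth of \<open>g\<close> would be lost in the
    product; the exponential keeps the second factor positive.\<close>
  have pos: "k s t + exp (- t) > 0" if "s \<ge> 0" for s t
    using k_nonneg[OF that, of t] by (simp add: add_nonneg_pos)
  have \<sigma>_cont: "continuous_on ({0..} \<times> {0..}) (\<lambda>(s, t). \<sigma> s t)"
  proof -
    have "continuous_on ({0..} \<times> {0..}) (\<lambda>p::real \<times> real. g (fst p))"
      by (rule continuous_on_compose2[of "{0..}" g])
        (use g in \<open>auto simp: class_K_def intro!: continuous_intros\<close>)
    then show ?thesis
      using k_cont unfolding \<sigma>_def case_prod_unfold by (intro continuous_intros)
  qed
  have "class_K (\<lambda>s. \<sigma> s t)" if t: "t \<ge> 0" for t
  proof -
    have mono: "\<sigma> s1 t < \<sigma> s2 t" if "0 \<le> s1" "s1 < s2" for s1 s2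
    proof -
      have "g s1 * (k s1 t + exp (- t)) \<le> g s1 * (k s2 t + exp (- t))"
        using k_mono[of s1 s2 t t] class_K_nonneg[OF g that(1)] that by (intro mult_left_mono) auto
      also have "\<dots> < g s2 * (k s2 t + exp (- t))"
        using pos[of s2 t] class_K_less[OF g that] that by (intro mult_strict_right_mono) auto
      finally show ?thesis by (simp add: \<sigma>_def)
    qed
    have "continuous_on {0..} (\<lambda>s. case (s, t) of (s, t) \<Rightarrow> \<sigma> s t)"
      by (rule continuous_on_compose2[OF \<sigma>_cont]) (use t in \<open>auto intro!: continuous_intros\<close>)
    then show ?thesis
      using mono[of 0] mono g
      by (auto simp: class_K_def pos_definite_def strict_mono_on_def \<sigma>_def)
  qed
  moreover have "antimono_on {0..} (\<sigma> s)" if "s \<ge> 0" for s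
    by (rule monotone_onI)
      (use k_mono[of s s] that class_K_nonneg[OF g that] in \<open>auto simp: \<sigma>_def intro!: mult_left_mono add_mono\<close>)
  moreover have "(\<sigma> s \<longlongrightarrow> 0) at_top" if "s \<ge> 0" for s
  proof -
    have "((\<lambda>t::real. exp (- t)) \<longlongrightarrow> 0) at_top" by real_asymp
    then have "((\<lambda>t. sqrt (g s * (k s t + exp (- t)))) \<longlongrightarrow> sqrt (g s * (0 + 0))) at_top"
      by (intro tendsto_intros k_lim[OF that])
    then show ?thesis by (simp add: \<sigma>_def[abs_def])
  qed
  ultimately have "class_KL \<sigma>" using \<sigma>_cont by (simp add: class_KL_def)
  moreover have "y \<le> \<sigma> s t" if "(s, t, y) \<in> Z" for s t y
  proof -
    have p: "0 \<le> s" "0 \<le> y" "y \<le> g s" using Z[OF that] by auto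
    have "w s t (s, t, y) \<le> k s t" using that p by (intro w_le_k) (auto simp: Z'_def)
    then have "y \<le> k s t" by (simp add: w_def c_def)
    \<comment> \<open>Both factors under the root bound \<open>y\<close>, so their geometric mean
      does as well.\<close>
    then have "y * y \<le> g s * (k s t + exp (- t))"
      using p by (intro mult_mono) (auto simp: add_increasing2)
    then show ?thesis unfolding \<sigma>_def by (intro real_le_rsqrt) (simp add: power2_eq_square)
  qed
  ultimately show ?thesis using that by blast
qed

section \<open>The Razumikhin condition\<close>

text \<open>From the last time at level \<open>q\<close> on, \<open>v\<close> stays above
  \<open>q\<close>, which is the lower bound that \<open>razumikhin_decay\<close> asks for. That
  time exists because the sublevel set is closed.\<close>

lemma last_time_below:
  fixes v :: "real \<Rightarrow> real"
  assumes v: "continuous_on {s0..t1} v" and s0: "s0 \<le> t1" "v s0 \<le> q" and t1: "q < v t1"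
  obtains s where "s0 \<le> s" "s < t1" "v s = q" "\<And>\<tau>. s \<le> \<tau> \<Longrightarrow> \<tau> \<le> t1 \<Longrightarrow> q \<le> v \<tau>"
proof -
  define S where "S = {\<tau> \<in> {s0..t1}. v \<tau> \<in> {..q}}"
  define s where "s = Sup S"
  have "closed S" unfolding S_def by (rule continuous_closed_preimage[OF v, unfolded vimage_def Int_def mem_Collect_eq]) auto
  moreover have "s0 \<in> S" using s0 by (simp add: S_def)
  moreover have ne: "bdd_above S" by (rule bdd_aboveI[of _ t1]) (auto simp: S_def)
  ultimately have sS: "s \<in> S" unfolding s_def by (intro closed_contains_Sup) auto
  have above: "q < v \<tau>" if "s < \<tau>" "\<tau> \<le> t1" for \<tau>
  proof (rule ccontr)
    assume "\<not> q < v \<tau>"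
    then have "\<tau> \<in> S" using that sS by (auto simp: S_def)
    then have "\<tau> \<le> s" unfolding s_def using ne by (rule cSup_upper)
    with that show False by simp
  qed
  have s: "s0 \<le> s" "s \<le> t1" "v s \<le> q" using sS by (auto simp: S_def)
  have "s < t1" using s t1 by (cases "s = t1") auto
  moreover have "v s = q"
  proof -
    have "\<exists>x\<ge>s. x \<le> t1 \<and> v x = q"
      using s t1 by (intro IVT' continuous_on_subset[OF v]) auto
    then obtain x where x: "s \<le> x" "x \<le> t1" "v x = q" by blast
    then show ?thesis using above[of x] by (cases "x = s") auto
  qed
  ultimately show ?thesis
    using s above by (intro that[of s]) (auto simp: order.order_iff_strict)
qed

text \<open>
  The integrated form of the differential inequality: while \<open>v\<close> stays between \<open>q\<close> and \<open>P\<close>, the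
  hypothesis \<open>a P \<le> q\<close> guarantees that the Razumikhin condition is satisfied.
\<close>

definition razumikhin_decay ::
  "real \<Rightarrow> (real \<Rightarrow> real) \<Rightarrow> (real \<Rightarrow> real) \<Rightarrow> real \<Rightarrow> ereal \<Rightarrow> (real \<Rightarrow> real) \<Rightarrow> bool" where
  "razumikhin_decay r a \<rho> t0 tm v \<longleftrightarrow>
     continuous_on {t. t0 - r \<le> t \<and> ereal t < tm} v \<and>
     (\<forall>t. t0 - r \<le> t \<and> ereal t < tm \<longrightarrow> 0 \<le> v t) \<and>
     (\<forall>s t q P c. t0 \<le> s \<longrightarrow> s \<le> t \<longrightarrow> ereal t < tm \<longrightarrow> a P \<le> q \<longrightarrow> 0 \<le> c \<longrightarrow>
        (\<forall>u\<in>{q..P}. c \<le> \<rho> u) \<longrightarrow> (\<forall>\<tau>\<in>{s - r..t}. v \<tau> \<le> P) \<longrightarrow> (\<forall>\<tau>\<in>{s..t}. q \<le> v \<tau>) \<longrightarrow>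
        v t \<le> v s - c * (t - s))"

lemma razumikhin_decayD:
  assumes "razumikhin_decay r a \<rho> t0 tm v" "t0 \<le> s" "s \<le> t" "ereal t < tm" "a P \<le> q" "0 \<le> c"
    and "\<And>u. q \<le> u \<Longrightarrow> u \<le> P \<Longrightarrow> c \<le> \<rho> u" "\<And>\<tau>. s - r \<le> \<tau> \<Longrightarrow> \<tau> \<le> t \<Longrightarrow> v \<tau> \<le> P"
    and "\<And>\<tau>. s \<le> \<tau> \<Longrightarrow> \<tau> \<le> t \<Longrightarrow> q \<le> v \<tau>"
  shows "v t \<le> v s - c * (t - s)"
  by (rule assms(1)[unfolded razumikhin_decay_def, THEN conjunct2, THEN conjunct2, rule_format, OF assms(2-6)])
    (use assms(7-9) in auto)

lemma razumikhin_decay_continuous_on: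
  assumes "razumikhin_decay r a \<rho> t0 tm v" "t0 - r \<le> s" "ereal t < tm"
  shows "continuous_on {s..t} v"
proof -
  have "ereal \<tau> < tm" if "\<tau> \<le> t" for \<tau>
  proof -
    have "ereal \<tau> \<le> ereal t" using that by simp
    then show ?thesis using assms(3) by (rule le_less_trans)
  qed
  then have "{s..t} \<subseteq> {t. t0 - r \<le> t \<and> ereal t < tm}" using assms(2) by auto
  then show ?thesis
    using assms(1) unfolding razumikhin_decay_def by (auto intro: continuous_on_subset)
qed

text \<open>If \<open>v\<close> exceeded \<open>P\<close>, its maximum \<open>v m\<close> over the
  whole interval would be attained after \<open>s0\<close>. Because \<open>a (v m) < v m\<close>, a
  level \<open>q\<close> below the maximum is admissible with upper level \<open>v m\<close>, and
  then \<open>v\<close> cannot climb from \<open>q\<close> to its maximum.\<close>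

lemma razumikhin_invariant:
  assumes dec: "razumikhin_decay r a \<rho> t0 tm v" and r: "r \<ge> 0"
    and a: "class_K a" "\<And>s. s > 0 \<Longrightarrow> a s < s" and \<rho>: "pos_definite \<rho>"
    and P: "P \<ge> 0" "t0 \<le> s0" "\<And>\<tau>. s0 - r \<le> \<tau> \<Longrightarrow> \<tau> \<le> s0 \<Longrightarrow> v \<tau> \<le> P"
    and t: "s0 \<le> t" "ereal t < tm"
  shows "v t \<le> P"
proof (rule ccontr)
  assume "\<not> v t \<le> P"
  have c: "continuous_on {s0 - r..t} v"
    by (rule razumikhin_decay_continuous_on[OF dec _ t(2)]) (use P in simp)
  obtain m where m: "m \<in> {s0 - r..t}" "\<And>\<tau>. \<tau> \<in> {s0 - r..t} \<Longrightarrow> v \<tau> \<le> v m"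
    using continuous_attains_sup[OF compact_Icc _ c] t r by fastforce
  have vm: "v m > P" using m(2)[of t] t r \<open>\<not> v t \<le> P\<close> by simp
  then have "s0 < m" using P(3)[of m] m(1) by (cases "s0 < m") auto
  have mt: "m \<le> t" using m by simp
  \<comment> \<open>Above \<open>P\<close>, so that \<open>v\<close> starts below \<open>q\<close>;
    above \<open>a (v m)\<close>, for the decay property; below \<open>v m\<close>, for the
    contradiction.\<close>
  define q where "q = (max P (a (v m)) + v m) / 2"
  have "a (v m) < v m" using a(2) vm P by simp
  then have q: "P < q" "a (v m) < q" "q < v m" using vm by (auto simp: q_def max_def)
  have "continuous_on {s0..m} v" by (rule continuous_on_subset[OF c]) (use r mt in auto)
  then obtain s where s: "s0 \<le> s" "s < m" "v s = q" "\<And>\<tau>. s \<le> \<tau> \<Longrightarrow> \<tau> \<le> m \<Longrightarrow> q \<le> v \<tau>"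
    by (rule last_time_below[of s0 m v q]) (use \<open>s0 < m\<close> P(3)[of s0] q r in auto)
  have mtm: "ereal m < tm" using mt t(2) by (meson ereal_less_eq(3) le_less_trans)
  have "v m \<le> v s - 0 * (m - s)"
  proof (rule razumikhin_decayD[OF dec _ less_imp_le[OF s(2)] mtm])
    show "0 \<le> \<rho> u" if "q \<le> u" for u using \<rho> that q P by (simp add: pos_definite_def less_imp_le)
    show "v \<tau> \<le> v m" if "s - r \<le> \<tau>" "\<tau> \<le> m" for \<tau> using that s mt by (intro m(2)) auto
  qed (use s q P in auto)
  then show False using s(3) q(3) by simp
qed

text \<open>In contrast to \<open>razumikhin_invariant\<close>, the value at the single time
  \<open>s1\<close> suffices instead of a full window: the bound \<open>P\<close> on the past is
  known in advance and \<open>a P \<le> q\<close>.\<close>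

lemma razumikhin_stays_below:
  assumes dec: "razumikhin_decay r a \<rho> t0 tm v" and \<rho>: "pos_definite \<rho>"
    and P: "t0 \<le> s0" "\<And>\<tau>. s0 - r \<le> \<tau> \<Longrightarrow> ereal \<tau> < tm \<Longrightarrow> v \<tau> \<le> P"
    and q: "0 < q" "a P \<le> q" and s1: "s0 \<le> s1" "v s1 \<le> q" and t: "s1 \<le> t" "ereal t < tm" and r: "r \<ge> 0"
  shows "v t \<le> q"
proof (rule ccontr)
  assume "\<not> v t \<le> q"
  then have "q < v t" by simp
  have "continuous_on {s1..t} v"
    by (rule razumikhin_decay_continuous_on[OF dec _ t(2)]) (use P s1 r in simp)
  then obtain s where s: "s1 \<le> s" "s < t" "v s = q" "\<And>\<tau>. s \<le> \<tau> \<Longrightarrow> \<tau> \<le> t \<Longrightarrow> q \<le> v \<tau>"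
    by (rule last_time_below[OF _ t(1) s1(2) \<open>q < v t\<close>]) auto
  have "v t \<le> v s - 0 * (t - s)"
  proof (rule razumikhin_decayD[OF dec _ less_imp_le[OF s(2)] t(2) q(2)])
    show "0 \<le> \<rho> u" if "q \<le> u" for u using \<rho> that q by (simp add: pos_definite_def less_imp_le)
    show "v \<tau> \<le> P" if "s - r \<le> \<tau>" "\<tau> \<le> t" for \<tau>
    proof (rule P(2))
      have "ereal \<tau> \<le> ereal t" using that by simp
      then show "ereal \<tau> < tm" using t(2) by (rule le_less_trans)
    qed (use that s s1 in simp)
  qed (use s s1 P in auto)
  with s(3) \<open>q < v t\<close> show False by simp
qed

text \<open>A descent from \<open>P\<close> to \<open>q\<close> at rate \<open>c\<close> takes the
  time \<open>(P - q) / c\<close>, so \<open>q\<close> is reached by then and kept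
  afterwards.\<close>

lemma razumikhin_level_drop:
  assumes dec: "razumikhin_decay r a \<rho> t0 \<infinity> v" and r: "r \<ge> 0" and \<rho>: "pos_definite \<rho>"
    and P: "t0 \<le> s0" "\<And>\<tau>. s0 - r \<le> \<tau> \<Longrightarrow> v \<tau> \<le> P"
    and q: "0 < q" "a P \<le> q" "q \<le> P" and c: "c > 0" "\<And>u. q \<le> u \<Longrightarrow> u \<le> P \<Longrightarrow> c \<le> \<rho> u"
    and t: "t \<ge> s0 + (P - q) / c"
  shows "v t \<le> q"
proof -
  let ?t = "s0 + (P - q) / c"
  have st: "s0 \<le> ?t" using q c by simp
  have "\<exists>s1\<in>{s0..?t}. v s1 \<le> q"
  proof (rule ccontr)
    assume *: "\<not> (\<exists>s1\<in>{s0..?t}. v s1 \<le> q)"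
    have "v ?t \<le> v s0 - c * (?t - s0)"
      by (rule razumikhin_decayD[OF dec P(1) st _ q(2) less_imp_le[OF c(1)] c(2)])
        (use P(2) * in \<open>auto simp: not_le intro: less_imp_le\<close>)
    also have "c * (?t - s0) = P - q" using c by simp
    finally have "v ?t \<le> q" using P(2)[of s0] r by simp
    then show False using * st by auto
  qed
  then obtain s1 where "s0 \<le> s1" "s1 \<le> ?t" "v s1 \<le> q" by auto
  then show ?thesis
    using razumikhin_stays_below[OF dec \<rho> P(1) _ q(1,2), of s1 t] P(2) t r by simp
qed

text \<open>
  The infimum of the levels that are eventually reached uniformly cannot be a positive number \<open>p\<close>:
  from a level slightly above \<open>p\<close> one drops below it because \<open>a p < p\<close>.
\<close>

lemma razumikhin_attractive:
  assumes r: "r \<ge> 0" and a: "class_K a" "\<And>s. s > 0 \<Longrightarrow> a s < s"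
    and \<rho>: "pos_definite \<rho>" "continuous_on {0..} \<rho>" and \<epsilon>: "\<epsilon> > 0"
  obtains T where "T \<ge> 0" "\<And>t0 v t. razumikhin_decay r a \<rho> t0 \<infinity> v \<Longrightarrow>
      (\<And>\<tau>. t0 - r \<le> \<tau> \<Longrightarrow> \<tau> \<le> t0 \<Longrightarrow> v \<tau> \<le> M) \<Longrightarrow> t0 + T \<le> t \<Longrightarrow> v t \<le> \<epsilon>"
proof -
  define good where "good t0 v \<longleftrightarrow> razumikhin_decay r a \<rho> t0 \<infinity> v \<and> (\<forall>\<tau>. t0 - r \<le> \<tau> \<longrightarrow> \<tau> \<le> t0 \<longrightarrow> v \<tau> \<le> M)"
    for t0 v
  define E where "E = {P. \<exists>T\<ge>0. \<forall>t0 v t. good t0 v \<longrightarrow> t0 + T \<le> t \<longrightarrow> v t \<le> P}"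
  have up: "P' \<in> E" if "P \<in> E" "P \<le> P'" for P P'
  proof -
    from that(1) obtain T where "T \<ge> 0" "\<forall>t0 v t. good t0 v \<longrightarrow> t0 + T \<le> t \<longrightarrow> v t \<le> P"
      by (auto simp: E_def)
    with that(2) show ?thesis unfolding E_def by (blast intro: order_trans)
  qed
  have "\<epsilon> \<in> E"
  proof (rule ccontr)
    assume "\<epsilon> \<notin> E"
    then have lower: "\<epsilon> \<le> P" if "P \<in> E" for P using up[OF that, of \<epsilon>] by fastforce
    \<comment> \<open>\<open>M\<close> may be negative, while invariance is stated for levels
      \<open>P \<ge> 0\<close>.\<close>
    have M: "max M 0 \<in> E"
    proof -
      have "v t \<le> max M 0" if "good t0 v" "t0 + 0 \<le> t" for t0 v t
        by (rule razumikhin_invariant[where ?s0.0 = t0, OF _ r a \<rho>(1)])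
          (use that in \<open>auto simp: good_def intro: max.coboundedI1\<close>)
      then show ?thesis unfolding E_def by blast
    qed
    define p where "p = Inf E"
    have bdd: "bdd_below E" using lower by (rule bdd_belowI)
    have p: "p > 0" using cInf_greatest[of E \<epsilon>] M lower \<epsilon> unfolding p_def by force
    obtain q where q: "a p < q" "q < p" using a(2)[OF p] dense by blast
    have q0: "q > 0" using q class_K_nonneg[OF a(1), of p] p by simp
    have "continuous (at p within {0..}) a"
      using a(1) p by (auto simp: class_K_def continuous_on_eq_continuous_within)
    then obtain d where d: "d > 0" "\<And>s. s \<ge> 0 \<Longrightarrow> dist s p < d \<Longrightarrow> dist (a s) (a p) < q - a p"
      unfolding continuous_within_eps_delta using q by (metis atLeast_iff diff_gt_0_iff_gt)
    \<comment> \<open>With \<open>q\<close> fixed strictly between \<open>a p\<close> and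
      \<open>p\<close>, continuity of \<open>a\<close> preserves \<open>a P \<le> q\<close> for
      \<open>P\<close> close enough to the infimum.\<close>
    obtain P where P: "P \<in> E" "P < p + d" using cInf_lessD[of E "p + d"] M d unfolding p_def by force
    have pP: "p \<le> P" unfolding p_def by (rule cInf_lower[OF P(1) bdd])
    have aP: "a P \<le> q" using d(2)[of P] P(2) pP p by (auto simp: dist_real_def)
    have "continuous_on {q..P} \<rho>" by (rule continuous_on_subset[OF \<rho>(2)]) (use q0 in auto)
    then obtain u0 where u0: "u0 \<in> {q..P}" "\<And>u. u \<in> {q..P} \<Longrightarrow> \<rho> u0 \<le> \<rho> u"
      using continuous_attains_inf[of "{q..P}" \<rho>] q pP by force
    \<comment> \<open>\<open>q > 0\<close> keeps \<open>[q, P]\<close> away from the zero of \<rho>,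
      so the minimal rate is positive.\<close>
    have c: "\<rho> u0 > 0" using u0(1) q0 \<rho>(1) by (auto simp: pos_definite_def)
    obtain T where T: "T \<ge> 0" "\<And>t0 v t. good t0 v \<Longrightarrow> t0 + T \<le> t \<Longrightarrow> v t \<le> P"
      using P(1) by (auto simp: E_def)
    \<comment> \<open>Waiting \<open>r\<close> beyond \<open>T\<close> puts a whole window below
      \<open>P\<close> before the descent starts.\<close>
    have "v t \<le> q" if g: "good t0 v" and t: "t0 + (T + r + (P - q) / \<rho> u0) \<le> t" for t0 v t
      by (rule razumikhin_level_drop[where ?s0.0 = "t0 + T + r" and ?t0.0 = t0 and v = v and t = t and a = a and P = P, OF _ r \<rho>(1) _ _ q0 aP _ c])
        (use g T(2)[OF g] t T(1) q pP u0(2) r in \<open>auto simp: good_def[of t0 v]\<close>)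
    moreover have "T + r + (P - q) / \<rho> u0 \<ge> 0" using T r c q pP by simp
    ultimately have "q \<in> E" unfolding E_def by blast
    then have "p \<le> q" unfolding p_def using bdd by (rule cInf_lower)
    with q show False by simp
  qed
  then show ?thesis using that unfolding E_def good_def by blast
qed

section \<open>The decay property along solutions\<close>

lemma Dplus_lessD:
  fixes V :: "real \<Rightarrow> 'a::real_vector \<Rightarrow> real"
  assumes "Dplus V t x y < ereal c"
  shows "eventually (\<lambda>h. V (t + h) (x + h *\<^sub>R y) - V t x < c * h) (at_right 0)"
proof -
  have "eventually (\<lambda>h. ereal ((V (t + h) (x + h *\<^sub>R y) - V t x) / h) < ereal c) (at_right 0)"
    using assms unfolding Dplus_def by (rule Limsup_lessD)
  moreover have "eventually (\<lambda>h::real. 0 < h) (at_right 0)" by (rule eventually_at_right_less)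
  ultimately show ?thesis by eventually_elim (simp add: pos_divide_less_eq)
qed

text \<open>The map is viewed as time-dependent with the single time 0, so that the compactness
  theorem for \<open>local_lipschitz\<close> applies.\<close>

lemma locally_lipschitz_on_compact:
  assumes "locally_lipschitz_on S F" "compact K" "K \<subseteq> S"
  obtains L where "L-lipschitz_on K F"
proof -
  have "local_lipschitz {0::real} K (\<lambda>_. F)"
  proof (rule local_lipschitzI)
    fix z assume "z \<in> K"
    then obtain u L where "u > 0" "L-lipschitz_on (cball z u \<inter> S) F"
      using assms(1,3) unfolding locally_lipschitz_on_def by blast
    then show "\<exists>u>0. \<exists>L. \<forall>t\<in>cball t u \<inter> {0::real}. L-lipschitz_on (cball z u \<inter> K) F" for t
      using assms(3) by (intro exI[of _ u] conjI exI[of _ L] ballI) (auto intro: lipschitz_on_subset)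
  qed
  then obtain L where "\<And>t. t \<in> {0::real} \<Longrightarrow> L-lipschitz_on K F"
    by (rule local_lipschitz_compact_implies_lipschitz) (use assms(2) in auto)
  then show ?thesis using that by auto
qed

text \<open>\<open>Dplus\<close> is taken along the tangent line, not along \<open>x\<close>. The
  two paths differ by a quantity that is small relative to \<open>h\<close>, and the local Lipschitz
  constant of \<open>V\<close> transfers this to the values; one half of \<epsilon> covers this
  error, the other half the limes superior.\<close>

lemma solution_dini_bound:
  fixes V :: "real \<Rightarrow> 'a::real_normed_vector \<Rightarrow> real"
  assumes V: "locally_lipschitz_on ({b..} \<times> UNIV) (\<lambda>(t, x). V t x)" and t: "b \<le> t"
    and x: "(x has_vector_derivative y) (at t)"
    and D: "Dplus V t (x t) y \<le> ereal (- c)" and \<epsilon>: "\<epsilon> > 0"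
  shows "\<exists>\<eta>>0. \<forall>h. 0 < h \<and> h < \<eta> \<longrightarrow> V (t + h) (x (t + h)) \<le> V t (x t) - c * h + \<epsilon> * h"
proof -
  obtain u L where u: "u > 0" and L: "L-lipschitz_on (cball (t, x t) u \<inter> ({b..} \<times> UNIV)) (\<lambda>(t, x). V t x)"
    using V[unfolded locally_lipschitz_on_def, rule_format, of "(t, x t)"] t by auto
  have L0: "L \<ge> 0" by (rule lipschitz_on_nonneg[OF L])
  define e where "e = \<epsilon> / (2 * (L + 1))"
  have e: "e > 0" "L * e \<le> \<epsilon> / 2"
    using \<epsilon> L0 by (auto simp: e_def divide_simps)
  have pos: "eventually (\<lambda>h::real. 0 < h) (at_right 0)" by (rule eventually_at_right_less)
  have "Dplus V t (x t) y < ereal (- c + \<epsilon> / 2)" using D by (rule le_less_trans) (use \<epsilon> in simp)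
  from Dplus_lessD[OF this]
  have 1: "eventually (\<lambda>h. V (t + h) (x t + h *\<^sub>R y) - V t (x t) < (- c + \<epsilon> / 2) * h) (at_right 0)" .
  have id: "((\<lambda>h::real. h) \<longlongrightarrow> 0) (at_right 0)" by (rule tendsto_ident_at)
  have th: "((\<lambda>h. t + h) \<longlongrightarrow> t) (at_right 0)"
    using tendsto_add[OF tendsto_const[of t] id] by simp
  have "isCont x t" using x by (rule has_vector_derivative_continuous)
  then have xh: "((\<lambda>h. x (t + h)) \<longlongrightarrow> x t) (at_right 0)" by (rule isCont_tendsto_compose[OF _ th])
  have yh: "((\<lambda>h. x t + h *\<^sub>R y) \<longlongrightarrow> x t) (at_right 0)"
    using tendsto_add[OF tendsto_const[of "x t"] tendsto_scaleR[OF id tendsto_const[of y]]] by simp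
  have 2: "eventually (\<lambda>h. dist (t + h, x (t + h)) (t, x t) < u) (at_right 0)"
    using tendsto_Pair[OF th xh] u by (rule tendstoD)
  have 3: "eventually (\<lambda>h. dist (t + h, x t + h *\<^sub>R y) (t, x t) < u) (at_right 0)"
    using tendsto_Pair[OF th yh] u by (rule tendstoD)
  obtain d where d: "d > 0" "\<And>s. norm (s - t) < d \<Longrightarrow> norm (x s - x t - (s - t) *\<^sub>R y) \<le> e * norm (s - t)"
    using x e(1) unfolding has_vector_derivative_def has_derivative_at_alt by blast
  have 4: "eventually (\<lambda>h. h < d) (at_right 0)"
    using id d(1) by (rule order_tendstoD)
  have "eventually (\<lambda>h. V (t + h) (x (t + h)) \<le> V t (x t) - c * h + \<epsilon> * h) (at_right 0)"
    using pos 1 2 3 4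
  proof eventually_elim
    case (elim h)
    have "dist (V (t + h) (x (t + h))) (V (t + h) (x t + h *\<^sub>R y)) \<le> L * dist (t + h, x (t + h)) (t + h, x t + h *\<^sub>R y)"
      using lipschitz_onD[OF L, of "(t + h, x (t + h))" "(t + h, x t + h *\<^sub>R y)"] elim t
      by (simp add: dist_commute)
    also have "dist (t + h, x (t + h)) (t + h, x t + h *\<^sub>R y) = norm (x (t + h) - x t - h *\<^sub>R y)"
      by (simp add: dist_Pair_Pair dist_norm algebra_simps)
    also have "L * \<dots> \<le> L * (e * h)"
      using d(2)[of "t + h"] elim L0 by (intro mult_left_mono) auto
    also have "\<dots> \<le> \<epsilon> / 2 * h" using e(2) elim by (simp add: mult.assoc[symmetric] mult_right_mono)
    finally have "V (t + h) (x (t + h)) - V (t + h) (x t + h *\<^sub>R y) \<le> \<epsilon> / 2 * h"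
      using order_trans[OF abs_ge_self] by (simp only: dist_real_def)
    moreover have "(- c + \<epsilon> / 2) * h = - c * h + \<epsilon> / 2 * h" by (simp add: algebra_simps)
    ultimately show ?case using elim(2) by simp
  qed
  then show ?thesis by (auto simp: eventually_at_right_field)
qed

text \<open>Adding \<open>c * \<tau>\<close> to \<open>V \<tau> (x \<tau>)\<close> turns decay at
  rate \<open>c\<close> into monotonicity. The window supremum is at most \<open>P\<close>, so
  \<open>a P \<le> q \<le> V \<tau> (x \<tau>)\<close> forces the Razumikhin condition throughout
  the interval.\<close>

lemma solution_razumikhin_decay:
  fixes f :: "('n::finite, 'l::finite) rhs"
  assumes r: "r > 0" and sol: "is_solution r f t0 x0 d x tm" and t0: "t0 \<ge> 0" and d: "d \<in> disturbances D"
    and V: "locally_lipschitz_on ({-r..} \<times> UNIV) (\<lambda>(t, x). V t x)" and V0: "\<And>t x. t \<ge> -r \<Longrightarrow> V t x \<ge> 0"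
    and a: "class_K a"
    and D: "\<And>t x d. t \<ge> 0 \<Longrightarrow> x \<in> hist_space r \<Longrightarrow> d \<in> D \<Longrightarrow>
        a (SUP \<theta>\<in>{-r..0}. V (t + \<theta>) (apply_bcontfun x \<theta>)) \<le> V t (apply_bcontfun x 0) \<Longrightarrow>
        Dplus V t (apply_bcontfun x 0) (f t x d) \<le> ereal (- \<rho> (V t (apply_bcontfun x 0)))"
  shows "razumikhin_decay r a \<rho> t0 tm (\<lambda>t. V t (x t))"
proof -
  let ?S = "{t. t0 - r \<le> t \<and> ereal t < tm}"
  have xc: "continuous_on ?S x" and xac: "\<And>b. b \<ge> t0 \<Longrightarrow> ereal b < tm \<Longrightarrow> abs_continuous_on t0 b x"
    and xae: "AE t in lebesgue. t0 \<le> t \<and> ereal t < tm \<longrightarrow>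
        (x has_vector_derivative f t (hist r t x) (d t)) (at t)"
    using sol by (auto simp: is_solution_def)
  have lt: "ereal \<tau> < tm" if "\<tau> \<le> t" "ereal t < tm" for \<tau> t
  proof -
    have "ereal \<tau> \<le> ereal t" using that by simp
    then show ?thesis using that(2) by (rule le_less_trans)
  qed
  have Vc: "continuous_on ({-r..} \<times> UNIV) (\<lambda>(t, x). V t x)"
    unfolding continuous_on_eq_continuous_within
  proof
    fix z :: "real \<times> (real ^ 'n)" assume z: "z \<in> {-r..} \<times> UNIV"
    then obtain u L where u: "u > 0" and L: "L-lipschitz_on (cball z u \<inter> ({-r..} \<times> UNIV)) (\<lambda>(t, x). V t x)"
      using V unfolding locally_lipschitz_on_def by blast
    have "continuous (at z within cball z u \<inter> ({-r..} \<times> UNIV)) (\<lambda>(t, x). V t x)"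
      using lipschitz_on_continuous_within[OF L, of z] z u by auto
    moreover have "at z within cball z u \<inter> ({-r..} \<times> UNIV) = at z within ({-r..} \<times> UNIV)"
      by (rule at_within_nhd[of z "ball z u"]) (use u in auto)
    ultimately show "continuous (at z within {-r..} \<times> UNIV) (\<lambda>(t, x). V t x)" by simp
  qed
  have "continuous_on ?S (\<lambda>t. case (t, x t) of (t, x) \<Rightarrow> V t x)"
    by (rule continuous_on_compose2[OF Vc]) (use t0 in \<open>auto intro!: continuous_intros xc\<close>)
  then have vc: "continuous_on ?S (\<lambda>t. V t (x t))" by simp
  moreover have "V t (x t) \<le> V s (x s) - c * (t - s)"
    if st: "t0 \<le> s" "s \<le> t" "ereal t < tm" and q: "a P \<le> q" and c: "0 \<le> c" "\<forall>u\<in>{q..P}. c \<le> \<rho> u"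
      and P: "\<forall>\<tau>\<in>{s - r..t}. V \<tau> (x \<tau>) \<le> P" and Q: "\<forall>\<tau>\<in>{s..t}. q \<le> V \<tau> (x \<tau>)" for s t q P c
  proof -
    define w where "w \<tau> = V \<tau> (x \<tau>) + c * \<tau>" for \<tau>
    have ac: "abs_continuous_on s t x"
      using xac[of t] st by (auto intro: abs_continuous_on_subinterval)
    obtain N where N1: "N \<in> null_sets lebesgue" and N2: "\<And>t. t \<in> space lebesgue - N \<Longrightarrow>
        t0 \<le> t \<and> ereal t < tm \<longrightarrow> (x has_vector_derivative f t (hist r t x) (d t)) (at t)"
      using AE_E3[OF xae] by blast
    have "w t \<le> w s"
    proof (rule abs_continuous_on_dini_nonincreasing[OF st(2), of w N])
      show "negligible N" using N1 by (simp add: negligible_iff_null_sets)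
      show "abs_continuous_on s t w"
      proof -
        have "continuous_on {s..t} x" by (rule abs_continuous_on_imp_continuous_on[OF ac])
        \<comment> \<open>\<open>V\<close> is only locally Lipschitz; on the compact graph of
          \<open>x\<close> one constant serves, which makes \<open>w\<close> absolutely
          continuous.\<close>
        then have "compact ((\<lambda>\<tau>. (\<tau>, x \<tau>)) ` {s..t})"
          by (intro compact_continuous_image continuous_intros) auto
        moreover have "(\<lambda>\<tau>. (\<tau>, x \<tau>)) ` {s..t} \<subseteq> {-r..} \<times> UNIV" using st t0 r by auto
        ultimately obtain L where L: "L-lipschitz_on ((\<lambda>\<tau>. (\<tau>, x \<tau>)) ` {s..t}) (\<lambda>(t, x). V t x)"
          using locally_lipschitz_on_compact[OF V] by blast
        have L0: "L \<ge> 0" by (rule lipschitz_on_nonneg[OF L])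
        show ?thesis
        proof (rule abs_continuous_on_bound[OF ac, of "L + c"])
          fix u v assume uv: "s \<le> u" "u \<le> v" "v \<le> t"
          have "\<bar>V v (x v) - V u (x u)\<bar> \<le> L * dist (v, x v) (u, x u)"
            using lipschitz_onD[OF L, of "(v, x v)" "(u, x u)"] uv by (auto simp: dist_real_def)
          also have "\<dots> \<le> L * (norm (x v - x u) + (v - u))"
            using norm_Pair_le[of "v - u" "x v - x u"] uv L0
            by (intro mult_left_mono) (auto simp: dist_norm)
          finally have "\<bar>V v (x v) - V u (x u)\<bar> + c * (v - u) \<le> (L + c) * (norm (x v - x u) + (v - u))"
            using mult_nonneg_nonneg[OF c(1) norm_ge_zero[of "x v - x u"]] by (simp add: algebra_simps)
          moreover have "\<bar>w v - w u\<bar> \<le> \<bar>V v (x v) - V u (x u)\<bar> + c * (v - u)"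
            using mult_left_mono[OF uv(2) c(1)] by (simp add: w_def algebra_simps abs_if)
          ultimately show "norm (w v - w u) \<le> (L + c) * (norm (x v - x u) + (v - u))" by simp
        qed (use L0 c in simp)
      qed
      fix \<tau> \<epsilon> :: real assume \<tau>: "s \<le> \<tau>" "\<tau> < t" "\<tau> \<notin> N" "\<epsilon> > 0"
      have der: "(x has_vector_derivative f \<tau> (hist r \<tau> x) (d \<tau>)) (at \<tau>)"
        using N2[of \<tau>] \<tau> st lt[OF _ st(3), of \<tau>] by simp
      have cx: "continuous_on {\<tau> - r..\<tau>} x"
        by (rule continuous_on_subset[OF xc]) (use \<tau> st lt[OF _ st(3)] in auto)
      have h0: "hist r \<tau> x 0 = x \<tau>" using apply_hist[OF _ cx, of 0] r by simp
      have hist: "V (\<tau> + \<theta>) (hist r \<tau> x \<theta>) = V (\<tau> + \<theta>) (x (\<tau> + \<theta>))" if "\<theta> \<in> {-r..0}" for \<theta>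
        using apply_hist[OF _ cx that] r by simp
      let ?W = "SUP \<theta>\<in>{-r..0}. V (\<tau> + \<theta>) (hist r \<tau> x \<theta>)"
      have bd: "V (\<tau> + \<theta>) (hist r \<tau> x \<theta>) \<le> P" if "\<theta> \<in> {-r..0}" for \<theta>
        using hist[OF that] P that \<tau> by auto
      have "?W \<le> P" by (rule cSUP_least) (use r bd in auto)
      \<comment> \<open>\<open>a\<close> is monotone only on nonnegative arguments, so the supremum
        has to be bounded below first.\<close>
      moreover have "0 \<le> ?W"
      proof -
        have "V (\<tau> + 0) (hist r \<tau> x 0) \<le> ?W"
          by (rule cSUP_upper) (use r bd in \<open>auto intro!: bdd_aboveI2[of _ _ P]\<close>)
        moreover have "0 \<le> V (\<tau> + 0) (hist r \<tau> x 0)" using \<tau> st t0 r by (intro V0) auto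
        ultimately show ?thesis by linarith
      qed
      ultimately have "a ?W \<le> a P" by (intro class_K_le[OF a])
      also have "\<dots> \<le> V \<tau> (x \<tau>)" using q Q \<tau> by (auto intro: order_trans)
      finally have "a ?W \<le> V \<tau> (hist r \<tau> x 0)" using h0 by simp
      then have "Dplus V \<tau> (hist r \<tau> x 0) (f \<tau> (hist r \<tau> x) (d \<tau>)) \<le> ereal (- \<rho> (V \<tau> (hist r \<tau> x 0)))"
        using \<tau> st t0 r d cx by (intro D hist_in_hist_space) (auto simp: disturbances_def)
      also have "\<dots> \<le> ereal (- c)"
        using c(2) P Q \<tau> r h0 by auto
      finally have Dc: "Dplus V \<tau> (x \<tau>) (f \<tau> (hist r \<tau> x) (d \<tau>)) \<le> ereal (- c)" using h0 by simp
      show "\<exists>\<eta>>0. \<forall>h. 0 < h \<and> h < \<eta> \<longrightarrow> w (\<tau> + h) \<le> w \<tau> + \<epsilon> * h"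
        using solution_dini_bound[OF V _ der Dc \<tau>(4)] \<tau> st t0 r by (simp add: w_def algebra_simps)
    qed
    then show ?thesis by (simp add: w_def algebra_simps)
  qed
  moreover have "0 \<le> V t (x t)" if "t0 - r \<le> t" for t using that t0 by (intro V0) auto
  ultimately show ?thesis unfolding razumikhin_decay_def by blast
qed

section \<open>The stability theorem\<close>

lemma class_K_le_cancel:
  assumes "class_K a" "a s \<le> a t" "0 \<le> t"
  shows "s \<le> t"
  using class_K_less[OF assms(1,3), of s] assms(2) by force

text \<open>Strict monotonicity of \<open>a1\<close> inverts the lower bound on \<open>V\<close> at
  each time of the window, and \<open>b2\<close> then acts on the window supremum of
  \<open>h\<close>. Writing the level as \<open>a1 \<eta>\<close> avoids an inverse
  function.\<close>

lemma output_le: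
  fixes H :: "('n::finite, 'y::real_normed_vector) output_map" and h :: "real \<Rightarrow> real ^ 'n \<Rightarrow> real ^ 'p::finite"
  assumes b2: "class_K b2" and a1: "class_K a1"
    and H: "\<And>t x. t \<ge> 0 \<Longrightarrow> x \<in> hist_space r \<Longrightarrow>
        norm (H t x) \<le> b2 (SUP \<theta>\<in>{-r..0}. norm (h (t + \<theta>) (apply_bcontfun x \<theta>)))"
    and h: "\<And>t x. t \<ge> 0 \<Longrightarrow> a1 (norm (h (t - r) x)) \<le> V (t - r) x"
    and r: "r \<ge> 0" and t: "t \<ge> 0" and x: "continuous_on {t - r..t} x" and \<eta>: "\<eta> \<ge> 0"
    and V: "\<And>\<tau>. t - r \<le> \<tau> \<Longrightarrow> \<tau> \<le> t \<Longrightarrow> V \<tau> (x \<tau>) \<le> a1 \<eta>"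
  shows "norm (H t (hist r t x)) \<le> b2 \<eta>"
proof -
  let ?k = "\<lambda>\<theta>. norm (h (t + \<theta>) (hist r t x \<theta>))"
  have le: "?k \<theta> \<le> \<eta>" if "\<theta> \<in> {-r..0}" for \<theta>
  proof (rule class_K_le_cancel[OF a1 _ \<eta>])
    \<comment> \<open>The lower bound is given at \<open>t - r\<close> for \<open>t \<ge> 0\<close>,
      that is, at all times from \<open>-r\<close> on; hence the shift by \<open>r\<close>.\<close>
    have "a1 (norm (h (t + \<theta>) (x (t + \<theta>)))) \<le> V (t + \<theta>) (x (t + \<theta>))"
      using h[of "t + \<theta> + r" "x (t + \<theta>)"] that t by simp
    also have "\<dots> \<le> a1 \<eta>" using that by (intro V) auto
    finally show "a1 (?k \<theta>) \<le> a1 \<eta>" using apply_hist[OF r x that] by simp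
  qed
  have "0 \<le> ?k 0" by simp
  also have "?k 0 \<le> (SUP \<theta>\<in>{-r..0}. ?k \<theta>)"
    by (rule cSUP_upper) (use r le in \<open>auto intro!: bdd_aboveI2[of _ _ \<eta>]\<close>)
  finally have "0 \<le> (SUP \<theta>\<in>{-r..0}. ?k \<theta>)" .
  moreover have "(SUP \<theta>\<in>{-r..0}. ?k \<theta>) \<le> \<eta>" by (rule cSUP_least) (use r le in auto)
  ultimately have "b2 (SUP \<theta>\<in>{-r..0}. ?k \<theta>) \<le> b2 \<eta>" by (rule class_K_le[OF b2])
  with H[OF t hist_in_hist_space[OF r x]] show ?thesis by linarith
qed

theorem proposition5p1:
  fixes r :: real
    and f :: "('n::finite, 'l::finite) rhs"
    and H :: "('n, 'y::real_normed_vector) output_map"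
    and D :: "(real ^ 'l) set"
    and h :: "real \<Rightarrow> real ^ 'n \<Rightarrow> real ^ 'p::finite"
    and V :: "real \<Rightarrow> real ^ 'n \<Rightarrow> real"
    and a1 a2 a \<beta> \<rho> :: "real \<Rightarrow> real"
  assumes "system_A r f H D"
    and "standing_hyps r f H D"
    and "equiv_finite_dim r H h"
    and "locally_lipschitz_on ({-r..} \<times> UNIV) (\<lambda>(t, x). V t x)"
    and "\<forall>t\<ge>-r. \<forall>x. V t x \<ge> 0"
    and "class_Kinf a1" and "class_Kinf a2" and "class_Kinf a"
    and "\<forall>s>0. a s < s"
    and "class_Kplus \<beta>"
    and "continuous_on {0..} \<rho>" and "pos_definite \<rho>"
    and "\<forall>t\<ge>0. \<forall>x. a1 (norm (h (t - r) x)) \<le> V (t - r) x \<and> V (t - r) x \<le> a2 (\<beta> t * norm x)"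
    and "\<forall>t\<ge>0. \<forall>x\<in>hist_space r. \<forall>d\<in>D.
           a (SUP \<theta>\<in>{-r..0}. V (t + \<theta>) (apply_bcontfun x \<theta>)) \<le> V t (apply_bcontfun x 0) \<longrightarrow>
           Dplus V t (apply_bcontfun x 0) (f t x d) \<le> ereal (- \<rho> (V t (apply_bcontfun x 0)))"
    and "RFC r f D \<or>
         (\<exists>\<zeta> \<mu> R. class_Kinf \<zeta> \<and> class_Kplus \<mu> \<and> R \<ge> 0 \<and>
            (\<forall>t\<ge>0. \<forall>x. \<zeta> (\<mu> t * norm x) \<le> V (t - r) x + R))"
  shows "RGAOS r f H D \<and> (bounded (\<beta> ` {0..}) \<longrightarrow> URGAOS r f H D)"
proof -
  have r: "r > 0" using assms(1) by (simp add: system_A_def)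
  then have r0: "r \<ge> 0" by simp
  have f: "hyp1 r f D" "hyp2 r f D" "hyp3 r f D" using assms(2) by (auto simp: standing_hyps_def)
  note K = assms(6-8)[THEN class_Kinf_imp_K]
  have a_less: "a s < s" if "s > 0" for s using assms(9) that by blast
  obtain b2 where b2: "class_Kinf b2" and Hb2: "\<And>t x. t \<ge> 0 \<Longrightarrow> x \<in> hist_space r \<Longrightarrow>
      norm (H t x) \<le> b2 (SUP \<theta>\<in>{-r..0}. norm (h (t + \<theta>) (apply_bcontfun x \<theta>)))"
    using assms(3) unfolding equiv_finite_dim_def by blast
  note b2K = class_Kinf_imp_K[OF b2]
  have V_lower: "a1 (norm (h (t - r) x)) \<le> V (t - r) x" if "t \<ge> 0" for t x using assms(13) that by blast
  have V_upper: "V t x \<le> a2 (\<beta> (t + r) * norm x)" if "t \<ge> -r" for t x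
    using assms(13)[rule_format, of "t + r" x] that by simp
  define X where "X t0 x0 d = fst (max_solution r f t0 x0 d)" for t0 x0 d
  define adm where "adm t0 x0 d \<longleftrightarrow> 0 \<le> t0 \<and> x0 \<in> hist_space r \<and> d \<in> disturbances D"
    for t0 :: real and x0 :: "real \<Rightarrow>\<^sub>C (real ^ 'n)" and d
  have max: "is_maximal_solution r f t0 x0 d (X t0 x0 d) (tmax r f t0 x0 d)" if "adm t0 x0 d" for t0 x0 d
    using max_solution_maximal[OF r f, of t0 x0 d] that by (simp add: X_def adm_def)
  have sol: "is_solution r f t0 x0 d (X t0 x0 d) (tmax r f t0 x0 d)" if "adm t0 x0 d" for t0 x0 d
    using max[OF that] by (simp add: is_maximal_solution_def)
  have Xc: "continuous_on {t - r..t} (X t0 x0 d)"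
    if "adm t0 x0 d" "t0 \<le> t" "ereal t < tmax r f t0 x0 d" for t0 x0 d t
  proof (rule continuous_on_subset)
    show "continuous_on {t. t0 - r \<le> t \<and> ereal t < tmax r f t0 x0 d} (X t0 x0 d)"
      using sol[OF that(1)] by (simp add: is_solution_def)
    show "{t - r..t} \<subseteq> {t. t0 - r \<le> t \<and> ereal t < tmax r f t0 x0 d}"
      using that(2,3) by (auto intro: le_less_trans[of _ "ereal t"])
  qed
  have X0: "X t0 x0 d \<tau> = x0 (\<tau> - t0)" if "adm t0 x0 d" "t0 - r \<le> \<tau>" "\<tau> \<le> t0" for t0 x0 d \<tau>
  proof -
    have "ereal t0 < tmax r f t0 x0 d" "hist r t0 (X t0 x0 d) = x0"
      using sol[OF that(1)] by (auto simp: is_solution_def)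
    then show ?thesis using apply_hist[OF r0 Xc[OF that(1)], of t0 "\<tau> - t0"] that by simp
  qed
  have dec: "razumikhin_decay r a \<rho> t0 (tmax r f t0 x0 d) (\<lambda>t. V t (X t0 x0 d t))" if "adm t0 x0 d" for t0 x0 d
    by (rule solution_razumikhin_decay[OF r sol[OF that], of D])
      (use that assms(4,5,14) K(3) in \<open>auto simp: adm_def\<close>)
  \<comment> \<open>\<open>V\<close> at time \<tau> involves \<open>\<beta> (\<tau> + r)\<close>, so
    the initial window \<open>[t0 - r, t0]\<close> asks for \<beta> on
    \<open>[t0, t0 + r]\<close>.\<close>
  have window: "V \<tau> (X t0 x0 d \<tau>) \<le> a2 (B * R)"
    if x0: "adm t0 x0 d" "norm x0 \<le> R" and B: "\<And>t. t0 \<le> t \<Longrightarrow> t \<le> t0 + r \<Longrightarrow> \<beta> t \<le> B"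
      and \<tau>: "t0 - r \<le> \<tau>" "\<tau> \<le> t0" for t0 x0 d B R \<tau>
  proof -
    have \<beta>: "0 < \<beta> (\<tau> + r)" using assms(10) \<tau> x0 by (simp add: class_Kplus_def adm_def)
    have "V \<tau> (X t0 x0 d \<tau>) \<le> a2 (\<beta> (\<tau> + r) * norm (X t0 x0 d \<tau>))"
      using \<tau> x0 by (intro V_upper) (simp add: adm_def)
    also have "\<dots> \<le> a2 (B * R)"
    proof (rule class_K_le[OF K(2)])
      have "norm (X t0 x0 d \<tau>) \<le> R" using X0[OF x0(1) \<tau>] norm_bounded[of x0 "\<tau> - t0"] x0(2) by simp
      then show "\<beta> (\<tau> + r) * norm (X t0 x0 d \<tau>) \<le> B * R"
        using B[of "\<tau> + r"] \<beta> \<tau> by (intro mult_mono) auto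
    qed (use \<beta> in simp)
    finally show ?thesis .
  qed
  \<comment> \<open>Stated up to \<open>tmax\<close> only, since global existence under alternative
    (ii) is derived from this bound.\<close>
  have V_bound: "V t (X t0 x0 d t) \<le> a2 (B * R)"
    if x0: "adm t0 x0 d" "norm x0 \<le> R" and B: "\<And>t. t0 \<le> t \<Longrightarrow> t \<le> t0 + r \<Longrightarrow> \<beta> t \<le> B" "B > 0"
      and t: "t0 - r \<le> t" "ereal t < tmax r f t0 x0 d" for t0 x0 d B R t
  proof (cases "t \<le> t0")
    case True
    then show ?thesis using window[OF x0 B(1)] t by blast
  next
    case False
    have "R \<ge> 0" using x0(2) norm_ge_zero[of x0] by linarith
    then have "0 \<le> a2 (B * R)" using B(2) by (intro class_K_nonneg[OF K(2)]) simp
    from razumikhin_invariant[OF dec[OF x0(1)] r0 K(3) a_less assms(12) this order_refl window[OF x0 B(1)] _ t(2)]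
    show ?thesis using False by simp
  qed
  have \<beta>_bound: "\<exists>B>0. \<forall>t\<in>{0..T}. \<beta> t \<le> B" for T
  proof -
    have "continuous_on {0..T} \<beta>" using assms(10) by (auto simp: class_Kplus_def intro: continuous_on_subset)
    then have "bounded (\<beta> ` {0..T})" by (intro compact_imp_bounded compact_continuous_image) auto
    then obtain B where "B > 0" "\<And>t. t \<in> {0..T} \<Longrightarrow> norm (\<beta> t) \<le> B" unfolding bounded_pos by auto
    then show ?thesis by (intro exI[of _ B]) (auto simp: abs_le_iff)
  qed
  have RFC: "RFC r f D"
    using assms(15)
  proof (elim disjE exE conjE)
    fix \<zeta> \<mu> :: "real \<Rightarrow> real" and R0 :: real
    assume \<zeta>: "class_Kinf \<zeta>" and \<mu>: "class_Kplus \<mu>" and "R0 \<ge> 0"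
      and coercive: "\<forall>t\<ge>0. \<forall>x. \<zeta> (\<mu> t * norm x) \<le> V (t - r) x + R0"
    \<comment> \<open>\<open>2 * T\<close> is the largest \<open>t0 + \<xi>\<close> in the
      definition of \<open>RFC\<close>. Restricting to times below \<open>tmax\<close> lets one
      bound prove both global existence and the supremum condition.\<close>
    have bound: "\<exists>C. \<forall>t0 x0 d t. adm t0 x0 d \<longrightarrow> t0 \<le> T \<longrightarrow> norm x0 \<le> s \<longrightarrow> t0 - r \<le> t \<longrightarrow> t \<le> 2 * T \<longrightarrow>
        ereal t < tmax r f t0 x0 d \<longrightarrow> norm (X t0 x0 d t) \<le> C" if T: "T \<ge> 0" for T s
    proof -
      obtain B where B: "B > 0" "\<And>t. t \<in> {0..T + r} \<Longrightarrow> \<beta> t \<le> B" using \<beta>_bound by blast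
      obtain \<eta> where \<eta>: "\<eta> > 0" "\<zeta> \<eta> \<ge> a2 (B * s) + R0" using class_Kinf_unbounded[OF \<zeta>] by blast
      have "continuous_on {0..2 * T + r} \<mu>" using \<mu> by (auto simp: class_Kplus_def intro: continuous_on_subset)
      \<comment> \<open>The positive minimum of \<mu> on the compact time range converts a bound on
        \<open>\<mu> (t + r) * norm (X t0 x0 d t)\<close> into one on the norm.\<close>
      then obtain u where u: "u \<in> {0..2 * T + r}" "\<And>t. t \<in> {0..2 * T + r} \<Longrightarrow> \<mu> u \<le> \<mu> t"
        using continuous_attains_inf[of "{0..2 * T + r}" \<mu>] T r by force
      have m: "\<mu> u > 0" using u(1) \<mu> by (simp add: class_Kplus_def)
      have "norm (X t0 x0 d t) \<le> \<eta> / \<mu> u"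
        if x0: "adm t0 x0 d" "t0 \<le> T" "norm x0 \<le> s" and t: "t0 - r \<le> t" "t \<le> 2 * T" "ereal t < tmax r f t0 x0 d"
        for t0 x0 d t
      proof -
        have t0: "t0 \<ge> 0" using x0 by (simp add: adm_def)
        have "\<zeta> (\<mu> (t + r) * norm (X t0 x0 d t)) \<le> V t (X t0 x0 d t) + R0"
          using coercive[rule_format, of "t + r" "X t0 x0 d t"] t t0 by simp
        also have "\<dots> \<le> a2 (B * s) + R0"
          using V_bound[OF x0(1,3) B(2) B(1) t(1,3)] x0(2) t0 by simp
        also have "\<dots> \<le> \<zeta> \<eta>" by (rule \<eta>(2))
        finally have "\<mu> (t + r) * norm (X t0 x0 d t) \<le> \<eta>"
          by (rule class_K_le_cancel[OF class_Kinf_imp_K[OF \<zeta>]]) (use \<eta>(1) in simp)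
        moreover have "\<mu> u * norm (X t0 x0 d t) \<le> \<mu> (t + r) * norm (X t0 x0 d t)"
          using t t0 by (intro mult_right_mono u(2)) auto
        ultimately show ?thesis using m by (simp add: pos_le_divide_eq mult.commute)
      qed
      then show ?thesis by blast
    qed
    have global: "tmax r f t0 x0 d = \<infinity>" if x0: "adm t0 x0 d" for t0 x0 d
    proof (rule bounded_maximal_solution_global[OF r f _ _ max[OF x0]])
      fix T
      \<comment> \<open>\<open>bound\<close> wants \<open>t0\<close> below its horizon, and the
        horizon must also reach \<open>T\<close>.\<close>
      have T: "0 \<le> max t0 T" "t0 \<le> max t0 T" using x0 by (auto simp: adm_def)
      obtain C where "\<forall>t. t0 - r \<le> t \<longrightarrow> t \<le> 2 * max t0 T \<longrightarrow> ereal t < tmax r f t0 x0 d \<longrightarrow> norm (X t0 x0 d t) \<le> C"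
        using bound[OF T(1), of "norm x0"] x0 T(2) by blast
      moreover have "t \<le> 2 * max t0 T" if "t < T" for t using that x0 by (auto simp: adm_def)
      ultimately show "\<exists>B. \<forall>t. t0 - r \<le> t \<and> t < T \<and> ereal t < tmax r f t0 x0 d \<longrightarrow> norm (X t0 x0 d t) \<le> B"
        by blast
    qed (use x0 in \<open>auto simp: adm_def\<close>)
    show ?thesis unfolding RFC_def
    proof (intro conjI allI impI ballI)
      fix t0 :: real and x0 :: "real \<Rightarrow>\<^sub>C (real ^ 'n)" and d assume "t0 \<ge> 0" "x0 \<in> hist_space r" "d \<in> disturbances D"
      then show "tmax r f t0 x0 d = \<infinity>" by (intro global) (simp add: adm_def)
    next
      fix s T :: real assume "s \<ge> 0" "T \<ge> 0"
      obtain C where C: "\<And>t0 x0 d t. adm t0 x0 d \<Longrightarrow> t0 \<le> T \<Longrightarrow> norm x0 \<le> s \<Longrightarrow> t0 - r \<le> t \<Longrightarrow> t \<le> 2 * T \<Longrightarrow>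
          ereal t < tmax r f t0 x0 d \<Longrightarrow> norm (X t0 x0 d t) \<le> C"
        using bound[OF \<open>T \<ge> 0\<close>, of s] by blast
      show "bdd_above {norm (phi r f (t0 + \<xi>) t0 x0 d) | \<xi> x0 t0 d.
        \<xi> \<in> {0..T} \<and> x0 \<in> hist_space r \<and> norm x0 \<le> s \<and> t0 \<in> {0..T} \<and> d \<in> disturbances D}"
      proof (rule bdd_aboveI[of _ C], elim CollectE exE conjE)
        fix y \<xi> x0 t0 d
        assume y: "y = norm (phi r f (t0 + \<xi>) t0 x0 d)" and \<xi>: "\<xi> \<in> {0..T}" and s: "norm x0 \<le> s" "t0 \<in> {0..T}"
          and x0: "x0 \<in> hist_space r" "d \<in> disturbances D"
        then have x0: "adm t0 x0 d" by (simp add: adm_def)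
        show "y \<le> C"
          unfolding y phi_def X_def[symmetric]
          by (rule norm_hist_le[OF r0 Xc[OF x0]]) (use \<xi> s global[OF x0] in \<open>auto intro!: C[OF x0]\<close>)
      qed
    qed
  qed auto
  have tmax: "tmax r f t0 x0 d = \<infinity>" if "adm t0 x0 d" for t0 x0 d
    using RFC that by (simp add: RFC_def adm_def)
  have H_le: "norm (H t (phi r f t t0 x0 d)) \<le> b2 \<eta>"
    if x0: "adm t0 x0 d" and t: "t0 \<le> t" and \<eta>: "\<eta> \<ge> 0"
      and V: "\<And>\<tau>. t - r \<le> \<tau> \<Longrightarrow> \<tau> \<le> t \<Longrightarrow> V \<tau> (X t0 x0 d \<tau>) \<le> a1 \<eta>" for t t0 x0 d \<eta>
    unfolding phi_def X_def[symmetric]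
    by (rule output_le[OF b2K K(1) Hb2 V_lower r0 _ Xc[OF x0 t] \<eta> V])
      (use x0 t tmax[OF x0] in \<open>auto simp: adm_def\<close>)
  have output_bound: "norm (H t (phi r f t t0 x0 d)) \<le> b2 \<eta>"
    if x0: "adm t0 x0 d" "norm x0 \<le> R" and B: "\<And>t. t0 \<le> t \<Longrightarrow> t \<le> t0 + r \<Longrightarrow> \<beta> t \<le> B" "B > 0"
      and \<eta>: "\<eta> \<ge> 0" "a2 (B * R) \<le> a1 \<eta>" and t: "t0 \<le> t" for t t0 x0 d B R \<eta>
  proof (rule H_le[OF x0(1) t \<eta>(1)])
    fix \<tau> assume "t - r \<le> \<tau>"
    then have "V \<tau> (X t0 x0 d \<tau>) \<le> a2 (B * R)"
      using t tmax[OF x0(1)] by (intro V_bound[OF x0 B]) auto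
    then show "V \<tau> (X t0 x0 d \<tau>) \<le> a1 \<eta>" using \<eta>(2) by linarith
  qed
  obtain b2' where b2': "class_K b2'" "\<And>s. s \<ge> 0 \<Longrightarrow> b2 (b2' s) = s"
    using class_Kinf_inverse[OF b2] by metis
  have pos: "k s > 0" if "class_K k" "s > 0" for k and s :: real
    using that by (simp add: class_K_def pos_definite_def)
  \<comment> \<open>The waiting time depends on \<open>t0\<close> only through the bound
    \<open>B\<close> for \<beta> on \<open>[t0, t0 + r]\<close>. With \<open>B\<close> taken on a
    compact time range this gives P3; with a global \<open>B\<close> it gives uniform
    attraction.\<close>
  have attr: "\<exists>\<tau>\<ge>0. \<forall>t0 x0 d t. adm t0 x0 d \<longrightarrow> norm x0 \<le> R \<longrightarrow> (\<forall>t\<in>{t0..t0 + r}. \<beta> t \<le> B) \<longrightarrow>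
      t0 + \<tau> \<le> t \<longrightarrow> norm (H t (phi r f t t0 x0 d)) \<le> \<epsilon>" if \<epsilon>: "\<epsilon> > 0" for B R \<epsilon>
  proof -
    define \<eta> where "\<eta> = b2' \<epsilon>"
    have \<eta>: "\<eta> > 0" "b2 \<eta> = \<epsilon>" using pos[OF b2'(1) \<epsilon>] b2'(2) \<epsilon> by (auto simp: \<eta>_def)
    obtain T where T: "T \<ge> 0" "\<And>t0 v t. razumikhin_decay r a \<rho> t0 \<infinity> v \<Longrightarrow>
        (\<And>\<tau>. t0 - r \<le> \<tau> \<Longrightarrow> \<tau> \<le> t0 \<Longrightarrow> v \<tau> \<le> a2 (B * R)) \<Longrightarrow> t0 + T \<le> t \<Longrightarrow> v t \<le> a1 \<eta>"
      using razumikhin_attractive[OF r0 K(3) a_less assms(12,11) pos[OF K(1) \<eta>(1)], of "a2 (B * R)"] by blast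
    \<comment> \<open>The output at \<open>t\<close> depends on the window
      \<open>[t - r, t]\<close>; adding \<open>r\<close> to the waiting time places all of it after
      \<open>t0 + T\<close>.\<close>
    have "norm (H t (phi r f t t0 x0 d)) \<le> \<epsilon>"
      if x0: "adm t0 x0 d" "norm x0 \<le> R" "\<forall>t\<in>{t0..t0 + r}. \<beta> t \<le> B" and t: "t0 + (T + r) \<le> t" for t0 x0 d t
    proof -
      have "norm (H t (phi r f t t0 x0 d)) \<le> b2 \<eta>"
      proof (rule H_le[OF x0(1)])
        fix \<tau> assume "t - r \<le> \<tau>"
        then show "V \<tau> (X t0 x0 d \<tau>) \<le> a1 \<eta>"
          using t by (intro T(2)[of t0] dec[OF x0(1), unfolded tmax[OF x0(1)]] window[OF x0(1,2)]) (use x0 in auto)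
      qed (use t T r \<eta> in auto)
      then show ?thesis using \<eta> by simp
    qed
    then show ?thesis using T(1) r by (intro exI[of _ "T + r"]) auto
  qed
  have P1: "bdd_above {norm (H t (phi r f t t0 x0 d)) | t x0 t0 d.
        t \<ge> t0 \<and> x0 \<in> hist_space r \<and> norm x0 \<le> \<epsilon> \<and> t0 \<in> {0..T} \<and> d \<in> disturbances D}" for \<epsilon> T
  proof -
    obtain B where B: "B > 0" "\<And>t. t \<in> {0..T + r} \<Longrightarrow> \<beta> t \<le> B" using \<beta>_bound by blast
    obtain \<eta> where \<eta>: "\<eta> > 0" "a1 \<eta> \<ge> a2 (B * \<epsilon>)" using class_Kinf_unbounded[OF assms(6)] by blast
    show ?thesis
    proof (rule bdd_aboveI[of _ "b2 \<eta>"], elim CollectE exE conjE)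
      fix y t x0 t0 d
      assume y: "y = norm (H t (phi r f t t0 x0 d))"
        and "t \<ge> t0" "x0 \<in> hist_space r" "norm x0 \<le> \<epsilon>" "t0 \<in> {0..T}" "d \<in> disturbances D"
      then show "y \<le> b2 \<eta>"
        unfolding y using B \<eta> by (intro output_bound[of t0 x0 d \<epsilon> B]) (auto simp: adm_def)
    qed
  qed
  have P2: "\<exists>\<delta>>0. \<forall>x0\<in>hist_space r. \<forall>t0\<in>{0..T}. norm x0 \<le> \<delta> \<longrightarrow>
        (\<forall>t\<ge>t0. \<forall>d\<in>disturbances D. norm (H t (phi r f t t0 x0 d)) \<le> \<epsilon>)" if \<epsilon>: "\<epsilon> > 0" for \<epsilon> T
  proof -
    obtain B where B: "B > 0" "\<And>t. t \<in> {0..T + r} \<Longrightarrow> \<beta> t \<le> B" using \<beta>_bound by blast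
    define \<eta> where "\<eta> = b2' \<epsilon>"
    have \<eta>: "\<eta> > 0" "b2 \<eta> = \<epsilon>" using pos[OF b2'(1) \<epsilon>] b2'(2) \<epsilon> by (auto simp: \<eta>_def)
    obtain a2' where a2': "class_K a2'" "\<And>s. s \<ge> 0 \<Longrightarrow> a2 (a2' s) = s"
      using class_Kinf_inverse[OF assms(7)] by metis
    \<comment> \<open>Solves \<open>a2 (B * \<delta>) = a1 \<eta>\<close>: the initial level of
      \<open>V\<close> then keeps the output below \<open>b2 \<eta> = \<epsilon>\<close>.\<close>
    define \<delta> where "\<delta> = a2' (a1 \<eta>) / B"
    have "\<delta> > 0" "a2 (B * \<delta>) = a1 \<eta>"
      using pos[OF a2'(1) pos[OF K(1) \<eta>(1)]] pos[OF K(1) \<eta>(1)] a2'(2)[of "a1 \<eta>"] B(1) by (auto simp: \<delta>_def)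
    moreover have "norm (H t (phi r f t t0 x0 d)) \<le> \<epsilon>"
      if "x0 \<in> hist_space r" "t0 \<in> {0..T}" "norm x0 \<le> \<delta>" "t \<ge> t0" "d \<in> disturbances D" for x0 t0 t d
      unfolding \<eta>(2)[symmetric] using that B \<eta>(1) \<open>a2 (B * \<delta>) = a1 \<eta>\<close>
      by (intro output_bound[of t0 x0 d \<delta> B]) (auto simp: adm_def)
    ultimately show ?thesis by blast
  qed
  have P3: "\<exists>\<tau>\<ge>0. \<forall>x0\<in>hist_space r. \<forall>t0\<in>{0..T}. norm x0 \<le> R \<longrightarrow>
        (\<forall>t\<ge>t0 + \<tau>. \<forall>d\<in>disturbances D. norm (H t (phi r f t t0 x0 d)) \<le> \<epsilon>)" if \<epsilon>: "\<epsilon> > 0" for \<epsilon> T R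
  proof -
    obtain B where B: "B > 0" "\<And>t. t \<in> {0..T + r} \<Longrightarrow> \<beta> t \<le> B" using \<beta>_bound by blast
    obtain \<tau> where \<tau>: "\<tau> \<ge> 0" "\<And>t0 x0 d t. adm t0 x0 d \<Longrightarrow> norm x0 \<le> R \<Longrightarrow> (\<forall>t\<in>{t0..t0 + r}. \<beta> t \<le> B) \<Longrightarrow>
      t0 + \<tau> \<le> t \<Longrightarrow> norm (H t (phi r f t t0 x0 d)) \<le> \<epsilon>"
      using attr[OF \<epsilon>] by blast
    show ?thesis
    proof (intro exI[of _ \<tau>] conjI ballI allI impI \<tau>(1))
      fix x0 :: "real \<Rightarrow>\<^sub>C (real ^ 'n)" and t0 t :: real and d
      assume "x0 \<in> hist_space r" "t0 \<in> {0..T}" "norm x0 \<le> R" "t0 + \<tau> \<le> t" "d \<in> disturbances D"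
      then show "norm (H t (phi r f t t0 x0 d)) \<le> \<epsilon>"
        using B(2) by (intro \<tau>(2)) (auto simp: adm_def)
    qed
  qed
  have RGAOS: "RGAOS r f H D"
    unfolding RGAOS_def by (intro conjI RFC allI impI P1 P2 P3)
  moreover have "URGAOS r f H D" if bdd: "bounded (\<beta> ` {0..})"
  proof -
    obtain B where B: "B > 0" "\<And>t. t \<ge> 0 \<Longrightarrow> norm (\<beta> t) \<le> B"
      using bdd unfolding bounded_pos by auto
    then have B': "\<beta> t \<le> B" if "t \<ge> 0" for t using that by (force simp: abs_le_iff)
    obtain a1' where a1': "class_K a1'" "\<And>s. s \<ge> 0 \<Longrightarrow> a1 (a1' s) = s"
      using class_Kinf_inverse[OF assms(6)] by metis
    \<comment> \<open>Overshoot gain: initial norm to level of \<open>V\<close> by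
      \<open>a2\<close>, level to size of \<open>h\<close> by the inverse of \<open>a1\<close>, size
      of \<open>h\<close> to output by \<open>b2\<close>.\<close>
    define g where "g s = b2 (a1' (a2 (B * s)))" for s
    have g: "class_K g"
      unfolding g_def by (intro class_K_compose[OF b2K] class_K_compose[OF a1'(1)] class_K_compose[OF K(2)] class_K_scale B(1))
    \<comment> \<open>These triples forget the initial time, which is harmless here because
      \<open>B\<close> bounds \<beta> at all times.\<close>
    define Z where "Z = {(norm x0, t - t0, norm (H t (phi r f t t0 x0 d))) | t0 x0 d t. adm t0 x0 d \<and> t0 \<le> t}"
    have Z1: "0 \<le> s \<and> 0 \<le> t \<and> 0 \<le> y \<and> y \<le> g s" if "(s, t, y) \<in> Z" for s t y
    proof -
      obtain t0 x0 d t' where z: "s = norm x0" "t = t' - t0" "y = norm (H t' (phi r f t' t0 x0 d))"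
        "adm t0 x0 d" "t0 \<le> t'" using \<open>(s, t, y) \<in> Z\<close> by (auto simp: Z_def)
      have a: "a2 (B * norm x0) \<ge> 0" using B(1) by (intro class_K_nonneg[OF K(2)]) simp
      have "y \<le> g s"
        unfolding z g_def
        by (rule output_bound[OF z(4) order_refl _ B(1) class_K_nonneg[OF a1'(1) a] _ z(5)])
          (use B' z(4) a1'(2)[OF a] in \<open>auto simp: adm_def\<close>)
      then show ?thesis using z by simp
    qed
    have Z2: "\<exists>\<tau>. \<forall>(s, t, y)\<in>Z. s \<le> R \<and> t \<ge> \<tau> \<longrightarrow> y \<le> \<epsilon>" if \<epsilon>: "\<epsilon> > 0" for R \<epsilon>
    proof -
      obtain \<tau> where \<tau>: "\<And>t0 x0 d t. adm t0 x0 d \<Longrightarrow> norm x0 \<le> R \<Longrightarrow> (\<forall>t\<in>{t0..t0 + r}. \<beta> t \<le> B) \<Longrightarrow>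
        t0 + \<tau> \<le> t \<Longrightarrow> norm (H t (phi r f t t0 x0 d)) \<le> \<epsilon>"
        using attr[OF \<epsilon>] by blast
      have "norm (H t (phi r f t t0 x0 d)) \<le> \<epsilon>" if "adm t0 x0 d" "norm x0 \<le> R" "t - t0 \<ge> \<tau>" for t0 x0 d t
        using that B' by (intro \<tau>) (auto simp: adm_def)
      then show ?thesis unfolding Z_def by (intro exI[of _ \<tau>]) blast
    qed
    obtain \<sigma> where \<sigma>: "class_KL \<sigma>" "\<And>s t y. (s, t, y) \<in> Z \<Longrightarrow> y \<le> \<sigma> s t"
      using class_KL_majorant[OF g Z1 Z2] by blast
    have "norm (H t (phi r f t t0 x0 d)) \<le> \<sigma> (norm x0) (t - t0)"
      if "t0 \<ge> 0" "x0 \<in> hist_space r" "d \<in> disturbances D" "t \<ge> t0" for t0 x0 d t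
    proof (rule \<sigma>(2))
      have "adm t0 x0 d" using that by (simp add: adm_def)
      then show "(norm x0, t - t0, norm (H t (phi r f t t0 x0 d))) \<in> Z"
        unfolding Z_def using \<open>t \<ge> t0\<close> by blast
    qed
    then show ?thesis unfolding URGAOS_def using RGAOS \<sigma>(1) by blast
  qed
  ultimately show ?thesis by blast
qed

end
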